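(* Suppose that $A \in \mathrm{M}(n, C(\mathbb{C}P^m))$ is normal and multiplicity-free and that $m > 1$. Then $A$ is diagonalizable.
   Context: $C(X)$ is the algebra of continuous complex-valued functions on a space $X$, and $\mathrm{M}(n,C(X))$ is the ring of $n\times n$ matrices over $C(X)$; an element $A$ is identified with a continuous map $X \to \mathrm{M}(n,\mathbb{C})$, and $A^*$ is the pointwise conjugate transpose. $A$ is normal if $AA^*=A^*A$. $A$ is multiplicity-free if for each $x\in X$ the matrix $A(x)$ has $n$ distinct eigenvalues. $A$ is diagonalizable if there is a unitary $U\in \mathrm{M}(n,C(X))$ (that is, $U^*U=UU^*=I$) such that $U^*AU$ is diagonal. $\mathbb{C}P^m$ is complex projective space of complex dimension $m$. *)

theory Defs
  imports "HOL-Analysis.Analysis"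
begin

text \<open>
  An element of the ring of matrices over \<open>C(X)\<close> is a map \<open>A\<close> with
  \<open>continuous_map X euclidean A\<close>; only its values on \<open>topspace X\<close> matter, so the
  predicates below are relativised to \<open>topspace X\<close>.
\<close>

definition conj_transpose :: "complex^'n^'m \<Rightarrow> complex^'m^'n"
  where "conj_transpose M = (\<chi> i j. cnj (M $ j $ i))"

definition eigenvalues :: "complex^'n^'n \<Rightarrow> complex set"
  where "eigenvalues M = {c. \<exists>v. v \<noteq> 0 \<and> M *v v = c *s v}"

definition diagonal_matrix :: "complex^'n^'n \<Rightarrow> bool"
  where "diagonal_matrix M \<longleftrightarrow> (\<forall>i j. i \<noteq> j \<longrightarrow> M $ i $ j = 0)"

definition normal_over :: "'a topology \<Rightarrow> ('a \<Rightarrow> complex^'n^'n) \<Rightarrow> bool"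
  where "normal_over X A \<longleftrightarrow>
    (\<forall>x\<in>topspace X. A x ** conj_transpose (A x) = conj_transpose (A x) ** A x)"

definition multiplicity_free_over :: "'a topology \<Rightarrow> ('a \<Rightarrow> complex^'n^'n) \<Rightarrow> bool"
  where "multiplicity_free_over X A \<longleftrightarrow>
    (\<forall>x\<in>topspace X. card (eigenvalues (A x)) = CARD('n))"

definition unitary_over :: "'a topology \<Rightarrow> ('a \<Rightarrow> complex^'n^'n) \<Rightarrow> bool"
  where "unitary_over X U \<longleftrightarrow>
    (\<forall>x\<in>topspace X. conj_transpose (U x) ** U x = mat 1 \<and>
                    U x ** conj_transpose (U x) = mat 1)"

definition diagonalizable_over :: "'a topology \<Rightarrow> ('a \<Rightarrow> complex^'n^'n) \<Rightarrow> bool"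
  where "diagonalizable_over X A \<longleftrightarrow>
    (\<exists>U :: 'a \<Rightarrow> complex^'n^'n. continuous_map X euclidean U \<and> unitary_over X U \<and>
      (\<forall>x\<in>topspace X. diagonal_matrix (conj_transpose (U x) ** A x ** U x)))"

definition quotient_topology :: "'a topology \<Rightarrow> ('a \<Rightarrow> 'b) \<Rightarrow> 'b topology"
  where "quotient_topology X q =
    topology (\<lambda>U. U \<subseteq> q ` topspace X \<and> openin X {x \<in> topspace X. q x \<in> U})"

lemma openin_quotient_topology:
  "openin (quotient_topology X q) U \<longleftrightarrow>
     U \<subseteq> q ` topspace X \<and> openin X {x \<in> topspace X. q x \<in> U}"
proof -
  have "istopology (\<lambda>U. U \<subseteq> q ` topspace X \<and> openin X {x \<in> topspace X. q x \<in> U})"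
    unfolding istopology_def
  proof (intro conjI allI impI)
    fix S T
    assume S: "S \<subseteq> q ` topspace X \<and> openin X {x \<in> topspace X. q x \<in> S}"
      and T: "T \<subseteq> q ` topspace X \<and> openin X {x \<in> topspace X. q x \<in> T}"
    then show "S \<inter> T \<subseteq> q ` topspace X" by blast
    have "{x \<in> topspace X. q x \<in> S \<inter> T} =
          {x \<in> topspace X. q x \<in> S} \<inter> {x \<in> topspace X. q x \<in> T}" by blast
    then show "openin X {x \<in> topspace X. q x \<in> S \<inter> T}" using S T by (simp add: openin_Int)
  next
    fix K
    assume K: "\<forall>S\<in>K. S \<subseteq> q ` topspace X \<and> openin X {x \<in> topspace X. q x \<in> S}"
    then show "\<Union>K \<subseteq> q ` topspace X" by blast
    have "{x \<in> topspace X. q x \<in> \<Union>K} = (\<Union>S\<in>K. {x \<in> topspace X. q x \<in> S})" by blast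
    then show "openin X {x \<in> topspace X. q x \<in> \<Union>K}" using K by (auto intro!: openin_Union)
  qed
  then show ?thesis
    unfolding quotient_topology_def by (simp add: topology_inverse')
qed

lemma topspace_quotient_topology [simp]: "topspace (quotient_topology X q) = q ` topspace X"
proof -
  have "{x \<in> topspace X. q x \<in> q ` topspace X} = topspace X" by blast
  then have "openin (quotient_topology X q) (q ` topspace X)"
    by (simp add: openin_quotient_topology)
  then show ?thesis
    by (metis openin_quotient_topology openin_subset openin_topspace subset_antisym)
qed

lemma quotient_map_quotient_topology: "quotient_map X (quotient_topology X q) q"
  by (auto simp: quotient_map_def openin_quotient_topology)

text \<open>
  The space of complex lines through the origin of \<open>complex^'k\<close>, of complex
  dimension \<open>CARD('k) - 1\<close>. Here \<open>vec.span\<close> is the span over the field of scalars of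
  \<open>(*s)\<close>, i.e. over the complex numbers, unlike the real span \<open>span\<close>.
\<close>

definition complex_projective_space :: "(complex^'k) set topology"
  where "complex_projective_space =
    quotient_topology (top_of_set (- {0})) (\<lambda>v. vec.span {v})"

end

theory Submission
  imports Defs "HOL-Probability.Distributions"
begin

text \<open>
  Write \<open>k = m + 1\<close>. Pull \<open>A\<close> back to the complement of the origin in complex \<open>k\<close>-space. That space is
  simply connected, so the \<open>n\<close> distinct eigenvalues become \<open>n\<close> continuous functions
  (\<open>continuous_eigenvalue_branches\<close>), each constant on every complex line, and their eigenspaces are
  \<open>n\<close> mutually orthogonal fields of complex lines. Each field has a continuous unit section \<open>u\<^sub>i\<close>,
  because a line field on the sphere is glued from two hemispheres along an equator that is again
  simply connected. The field does not change when \<open>x\<close> is rotated to \<open>z x\<close> with \<open>|z| = 1\<close>, so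
  \<open>u\<^sub>i (z x)\<close> is a phase times \<open>u\<^sub>i x\<close>; averaging the logarithm of that phase over the circle corrects
  \<open>u\<^sub>i\<close> so that \<open>u\<^sub>i (z x) = z\<^bsup>a\<^esup> u\<^sub>i x\<close> for an integer \<open>a = a\<^sub>i\<close> (\<open>equivariant_line_field_section\<close>). Up to
  sign \<open>a\<^sub>i\<close> is the first Chern number of the \<open>i\<close>-th eigenline bundle. If all \<open>a\<^sub>i\<close> vanish, then the
  unitary matrix \<open>U x\<close> with columns \<open>u\<^sub>i x\<close> depends only on the line through \<open>x\<close> and diagonalizes \<open>A\<close>.

  The topological reason for \<open>a\<^sub>i = 0\<close> is that the eigenline bundles add up to a trivial bundle: the
  product of the total Chern classes \<open>1 + a\<^sub>i h\<close> is \<open>1\<close> modulo \<open>h\<^bsup>m+1\<^esup>\<close>, and for \<open>m > 1\<close> the coefficients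
  of \<open>h\<close> and \<open>h\<^sup>2\<close> give that the sum of the \<open>a\<^sub>i\<^sup>2\<close> is zero. Here this is replaced by a dimension count
  in the spirit of Toeplitz operators. Let \<open>H\<^sub>d\<close> be the space of homogeneous holomorphic polynomials
  of degree \<open>d\<close> in \<open>k\<close> variables, with the inner product of a Gaussian measure. Multiplication by \<open>U\<close>,
  extended to be constant on real rays, is isometric on \<open>n\<close>-tuples of functions. Moreover, multiplication
  by a fixed continuous function of weight \<open>a\<close> sends \<open>H\<^sub>d\<close> into \<open>H\<^bsub>d+a\<^esub>\<close> up to a relative error that tends
  to zero as \<open>d\<close> grows: this is a computation for a coordinate function and its conjugate, and
  it persists under sums, products and uniform limits, hence holds in general by the
  Stone-Weierstrass theorem (\<open>continuous_weight_asymptotically_toeplitz\<close>). So for large \<open>d\<close> a tuple from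
  the direct sum of the spaces \<open>H\<^bsub>d-a\<^esub>\<close> over the weights \<open>a = a\<^sub>i\<close> cannot be sent by \<open>U\<close> into the
  orthogonal complement of \<open>n\<close> copies of \<open>H\<^sub>d\<close> unless it is zero, and therefore the sum of the \<open>dim H\<^bsub>d-a\<^esub>\<close> is at most
  \<open>n dim H\<^sub>d\<close> (\<open>equivariant_isometry_dimension_le\<close>). The complex conjugate of \<open>U\<close> gives the same with
  \<open>-a\<^sub>i\<close>. The two bounds together contradict the strict convexity of \<open>d \<mapsto> dim H\<^sub>d\<close> unless every \<open>a\<^sub>i\<close>
  is zero. Strict convexity needs at least three variables, which is the hypothesis \<open>m > 1\<close>; for two
  variables \<open>dim H\<^sub>d = d + 1\<close> is affine in \<open>d\<close>.
\<close>

section \<open>Counting monomials\<close>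

text \<open>
  Exponents of the monomials of total degree \<open>d\<close>; their number is the dimension of the space of
  homogeneous polynomials of degree \<open>d\<close>.
\<close>
definition exponents :: "nat \<Rightarrow> ('k::finite \<Rightarrow> nat) set"
  where "exponents d = {\<gamma>. sum \<gamma> UNIV = d}"

lemma finite_exponents [simp]: "finite (exponents d :: ('k::finite \<Rightarrow> nat) set)"
proof -
  have "exponents d \<subseteq> (UNIV :: 'k set) \<rightarrow>\<^sub>E {..d}"
    by (auto simp: exponents_def PiE_def intro: member_le_sum)
  then show ?thesis
    by (rule finite_subset) (intro finite_PiE, auto)
qed

definition raise_exp :: "'k \<Rightarrow> ('k \<Rightarrow> nat) \<Rightarrow> ('k \<Rightarrow> nat)"
  where "raise_exp j \<gamma> = \<gamma>(j := \<gamma> j + 1)"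

definition lower_exp :: "'k \<Rightarrow> ('k \<Rightarrow> nat) \<Rightarrow> ('k \<Rightarrow> nat)"
  where "lower_exp j \<gamma> = \<gamma>(j := \<gamma> j - 1)"

lemma raise_lower_exp: "\<gamma> j > 0 \<Longrightarrow> raise_exp j (lower_exp j \<gamma>) = \<gamma>"
  by (auto simp: raise_exp_def lower_exp_def)

lemma lower_raise_exp: "lower_exp j (raise_exp j \<gamma>) = \<gamma>"
  by (auto simp: raise_exp_def lower_exp_def)

lemma raise_exp_eq_iff [simp]: "raise_exp j \<gamma> = raise_exp j \<gamma>' \<longleftrightarrow> \<gamma> = \<gamma>'"
  by (metis lower_raise_exp)

lemma raise_exp_exponents:
  fixes \<gamma> :: "'k::finite \<Rightarrow> nat"
  shows "raise_exp j \<gamma> \<in> exponents (Suc d) \<longleftrightarrow> \<gamma> \<in> exponents d"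
proof -
  have "sum (raise_exp j \<gamma>) UNIV = (\<Sum>i\<in>UNIV. \<gamma> i + (if i = j then 1 else 0))"
    by (intro sum.cong) (auto simp: raise_exp_def)
  then show ?thesis by (simp add: exponents_def sum.distrib)
qed

lemma exponents_lower:
  fixes \<gamma> :: "'k::finite \<Rightarrow> nat"
  assumes "\<gamma> \<in> exponents d" "\<gamma> j > 0"
  shows "lower_exp j \<gamma> \<in> exponents (d - 1)" and "d > 0"
proof -
  have "\<gamma> j \<le> sum \<gamma> UNIV" by (intro member_le_sum) auto
  then show "d > 0" using assms by (simp add: exponents_def)
  then show "lower_exp j \<gamma> \<in> exponents (d - 1)"
    using raise_exp_exponents[of j "lower_exp j \<gamma>" "d - 1"] assms by (simp add: raise_lower_exp)
qed

text \<open>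
  A monomial of degree \<open>d + 1\<close> either is the variable \<open>j\<close> times a monomial of degree \<open>d\<close> or does not
  contain that variable. Hence the first difference of the dimension counts monomials in one
  variable less.
\<close>
lemma card_exponents_Suc:
  fixes j :: "'k::finite"
  shows "card (exponents (Suc d) :: ('k \<Rightarrow> nat) set)
       = card (exponents d :: ('k \<Rightarrow> nat) set) + card {\<gamma> \<in> exponents (Suc d). \<gamma> j = 0}"
proof -
  let ?f = "raise_exp j :: ('k \<Rightarrow> nat) \<Rightarrow> _"
  have inj: "inj_on ?f (exponents d)" by (intro inj_onI) simp
  have "exponents (Suc d) = ?f ` exponents d \<union> {\<gamma> \<in> exponents (Suc d). \<gamma> j = 0}"
  proof (intro equalityI subsetI)
    fix \<gamma> :: "'k \<Rightarrow> nat" assume g: "\<gamma> \<in> exponents (Suc d)"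
    show "\<gamma> \<in> ?f ` exponents d \<union> {\<gamma> \<in> exponents (Suc d). \<gamma> j = 0}"
    proof (cases "\<gamma> j = 0")
      case False
      then have "\<gamma> = ?f (lower_exp j \<gamma>)" by (simp add: raise_lower_exp)
      moreover have "lower_exp j \<gamma> \<in> exponents d"
        using exponents_lower(1)[OF g, of j] False by simp
      ultimately show ?thesis by blast
    qed (use g in auto)
  qed (auto simp: raise_exp_exponents)
  moreover have "?f ` exponents d \<inter> {\<gamma> \<in> exponents (Suc d). \<gamma> j = 0} = {}"
    by (auto simp: raise_exp_def)
  ultimately show ?thesis
    using inj by (metis (no_types, lifting) card_Un_disjoint card_image finite_Un finite_exponents)
qed

text \<open>
  With \<open>j\<close> excluded at least two variables \<open>i\<close> and \<open>l\<close> remain: multiplication by \<open>i\<close> is injective and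
  misses the pure power of \<open>l\<close>. This is where the number of variables enters.
\<close>
lemma card_exponents_slice_less:
  fixes j :: "'k::finite"
  assumes "CARD('k) > 2"
  shows "card {\<gamma> \<in> exponents d. \<gamma> j = 0} < card {\<gamma> \<in> exponents (Suc d). \<gamma> j = (0::nat)}"
proof -
  obtain i where i: "i \<noteq> j"
  proof -
    have "\<not> (UNIV :: 'k set) \<subseteq> {j}"
      using assms card_mono[of "{j}" "UNIV :: 'k set"] by auto
    then show ?thesis using that by blast
  qed
  obtain l where l: "l \<noteq> j" "l \<noteq> i"
  proof -
    have "\<not> (UNIV :: 'k set) \<subseteq> {j, i}"
      using assms card_mono[of "{j, i}" "UNIV :: 'k set"] i by auto
    then show ?thesis using that by blast
  qed
  let ?f = "raise_exp i :: ('k \<Rightarrow> nat) \<Rightarrow> _"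
  let ?S = "{\<gamma> \<in> exponents d. \<gamma> j = 0}" and ?T = "{\<gamma> \<in> exponents (Suc d). \<gamma> j = 0}"
  have inj: "inj_on ?f ?S" by (intro inj_onI) simp
  have sub: "?f ` ?S \<subseteq> ?T" using i by (auto simp: raise_exp_exponents, auto simp: raise_exp_def)
  have "(\<lambda>x. if x = l then Suc d else 0) \<in> ?T" using l by (simp add: exponents_def)
  moreover have "(\<lambda>x. if x = l then Suc d else 0) \<notin> ?f ` ?S"
  proof
    assume "(\<lambda>x. if x = l then Suc d else 0) \<in> ?f ` ?S"
    then obtain \<gamma> where "(\<lambda>x. if x = l then Suc d else 0) = ?f \<gamma>" by blast
    from fun_cong[OF this, of i] l show False by (auto simp: raise_exp_def)
  qed
  ultimately have "?f ` ?S \<subset> ?T" using sub by blast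
  then have "card (?f ` ?S) < card ?T" by (intro psubset_card_mono) auto
  then show ?thesis using inj by (simp add: card_image)
qed

lemma card_exponents_strictly_convex:
  assumes "CARD('k::finite) > 2" "a > 0" "a \<le> d"
  shows "2 * card (exponents d :: ('k \<Rightarrow> nat) set)
       < card (exponents (d + a) :: ('k \<Rightarrow> nat) set) + card (exponents (d - a) :: ('k \<Rightarrow> nat) set)"
proof -
  fix j :: 'k
  let ?D = "\<lambda>d. card (exponents d :: ('k \<Rightarrow> nat) set)"
  let ?E = "\<lambda>d. card {\<gamma> :: 'k \<Rightarrow> nat. \<gamma> \<in> exponents d \<and> \<gamma> j = 0}"
  have mono: "strict_mono ?E"
    unfolding strict_mono_Suc_iff using card_exponents_slice_less[OF assms(1)] by blast
  \<comment> \<open>Each step adds a difference at a higher degree and removes one at a lower degree.\<close>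
  have "a \<le> d \<Longrightarrow> 2 * ?D d + a \<le> ?D (d + a) + ?D (d - a)"
  proof (induction a)
    case (Suc a)
    have "?D (d + Suc a) = ?D (d + a) + ?E (d + Suc a)"
      using card_exponents_Suc[of "d + a" j] by simp
    moreover have "?D (d - a) = ?D (d - Suc a) + ?E (d - a)"
      using card_exponents_Suc[of "d - Suc a" j] Suc.prems by (simp add: Suc_diff_Suc)
    moreover have "?E (d - a) < ?E (d + Suc a)"
      using Suc.prems by (intro strict_monoD[OF mono]) auto
    ultimately show ?case using Suc by linarith
  qed simp
  with assms show ?thesis by fastforce
qed

lemma underdetermined_system_has_nonzero_solution:
  fixes m :: "'j \<Rightarrow> 'i \<Rightarrow> 'a::field"
  assumes "finite J" "finite I" "card J < card I"
  shows "\<exists>c. (\<exists>i\<in>I. c i \<noteq> 0) \<and> (\<forall>j\<in>J. (\<Sum>i\<in>I. m j i * c i) = 0)"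
  using assms
proof (induction J arbitrary: I m)
  case empty
  then obtain i where "i \<in> I" by fastforce
  then show ?case by (intro exI[of _ "\<lambda>_. 1"]) auto
next
  case (insert j J)
  show ?case
  proof (cases "\<forall>i\<in>I. m j i = 0")
    case True
    have "\<exists>c. (\<exists>i\<in>I. c i \<noteq> 0) \<and> (\<forall>j\<in>J. (\<Sum>i\<in>I. m j i * c i) = 0)"
      using insert by (intro insert.IH) auto
    with True show ?thesis by auto
  next
    case False
    then obtain p where p: "p \<in> I" "m j p \<noteq> 0" by blast
    let ?I = "I - {p}"
    have "card J < card ?I" using insert p by auto
    then have "\<exists>c. (\<exists>i\<in>?I. c i \<noteq> 0) \<and>
        (\<forall>l\<in>J. (\<Sum>i\<in>?I. (m l i - m l p * (m j i / m j p)) * c i) = 0)"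
      using insert by (intro insert.IH) auto
    then obtain c where c: "\<exists>i\<in>?I. c i \<noteq> 0"
      and eq: "\<And>l. l \<in> J \<Longrightarrow> (\<Sum>i\<in>?I. (m l i - m l p * (m j i / m j p)) * c i) = 0" by blast
    define s where "s = - (\<Sum>i\<in>?I. (m j i / m j p) * c i)"
    have split: "(\<Sum>i\<in>I. m l i * (c(p := s)) i) = m l p * s + (\<Sum>i\<in>?I. m l i * c i)" for l
      using p insert.prems by (subst sum.remove[of I p]) (auto intro!: sum.cong)
    have "m j p * s + (\<Sum>i\<in>?I. m j i * c i) = 0"
      unfolding s_def using p(2) by (simp add: sum_distrib_left)
    then have "(\<Sum>i\<in>I. m j i * (c(p := s)) i) = 0"
      by (simp only: split)
    moreover have "(\<Sum>i\<in>I. m l i * (c(p := s)) i) = 0" if "l \<in> J" for l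
    proof -
      have "m l p * s + (\<Sum>i\<in>?I. m l i * c i) = 0"
        unfolding s_def using eq[OF that]
        by (simp add: sum_distrib_left sum_subtractf algebra_simps)
      then show ?thesis by (simp only: split)
    qed
    ultimately show ?thesis
      using c by (intro exI[of _ "c(p := s)"]) auto
  qed
qed

section \<open>A Gaussian measure on complex coordinate space\<close>

text \<open>
  Polar coordinates of one complex Gaussian coordinate: the squared modulus is exponentially
  distributed and the argument is uniform. Working with these two laws reduces all moments to
  one-dimensional integrals.
\<close>
definition radial_law :: "real measure"
  where "radial_law = density lborel (exponential_density 1)"

definition angular_law :: "real measure"
  where "angular_law = density lborel (\<lambda>t. indicator {0..2*pi} t / (2*pi))"

lemma prob_space_radial_law: "prob_space radial_law"
  unfolding radial_law_def by (rule prob_space_exponential_density) simp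

lemma prob_space_angular_law: "prob_space angular_law"
proof
  have "emeasure angular_law (space angular_law)
      = (\<integral>\<^sup>+t. ennreal (1 / (2*pi)) * indicator {0..2*pi} t \<partial>lborel)"
    unfolding angular_law_def
    by (subst emeasure_density) (auto intro!: nn_integral_cong split: split_indicator)
  also have "\<dots> = ennreal (1 / (2*pi)) * ennreal (2*pi)"
    by (subst nn_integral_cmult_indicator) auto
  also have "\<dots> = 1"
    by (simp add: ennreal_mult'[symmetric])
  finally show "emeasure angular_law (space angular_law) = 1" .
qed

lemma radial_moment:
  "integrable radial_law (\<lambda>r. r ^ n)" "integral\<^sup>L radial_law (\<lambda>r. r ^ n) = fact n"
proof -
  interpret prob_space radial_law by (rule prob_space_radial_law)
  have "distributed radial_law lborel (\<lambda>x. x) (exponential_density 1)"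
    unfolding distributed_def radial_law_def
    by (auto simp: distr_id2 erlang_density_nonneg)
  from erlang_ith_moment_integrable[OF _ this, of n] erlang_ith_moment[OF _ this, of n]
  show "integrable radial_law (\<lambda>r. r ^ n)" "integral\<^sup>L radial_law (\<lambda>r. r ^ n) = fact n"
    by simp_all
qed

lemma AE_radial_law_nonneg: "AE r in radial_law. 0 \<le> r"
  unfolding radial_law_def by (subst AE_density) (auto simp: erlang_density_def)

lemma integrable_radial_sqrt_power: "integrable radial_law (\<lambda>r. complex_of_real (sqrt r) ^ n)"
proof -
  interpret prob_space radial_law by (rule prob_space_radial_law)
  show ?thesis
  proof (rule Bochner_Integration.integrable_bound)
    show "integrable radial_law (\<lambda>r. 1 + r ^ n)"
      using radial_moment(1)[of n] by simp
    show "(\<lambda>r. complex_of_real (sqrt r) ^ n) \<in> borel_measurable radial_law"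
      unfolding radial_law_def by measurable
    show "AE r in radial_law. norm (complex_of_real (sqrt r) ^ n) \<le> norm (1 + r ^ n)"
      using AE_radial_law_nonneg
    proof eventually_elim
      case (elim r)
      have "sqrt r ^ n \<le> 1 + r ^ n"
      proof (cases "r \<le> 1")
        case True
        then have "sqrt r ^ n \<le> 1" using elim by (intro power_le_one) auto
        then show ?thesis using elim by (smt (verit) zero_le_power)
      next
        case False
        then have "sqrt r \<le> r" using real_sqrt_le_mono[of r "r\<^sup>2"] elim
          by (simp add: power2_eq_square)
        then have "sqrt r ^ n \<le> r ^ n" using elim by (intro power_mono) auto
        then show ?thesis by simp
      qed
      then show ?case using elim by (simp add: norm_power)
    qed
  qed
qed

lemma angular_fourier:
  "integrable angular_law (\<lambda>t. cis t ^ a * cnj (cis t) ^ b)"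
  "integral\<^sup>L angular_law (\<lambda>t. cis t ^ a * cnj (cis t) ^ b) = (if a = b then 1 else 0)"
proof -
  interpret prob_space angular_law by (rule prob_space_angular_law)
  have eq: "cis t ^ a * cnj (cis t) ^ b = cis ((real a - real b) * t)" for t
    by (simp add: Complex.DeMoivre cis_mult cis_cnj algebra_simps)
  have meas: "(\<lambda>t. cis ((real a - real b) * t)) \<in> borel_measurable borel"
    by (intro borel_measurable_continuous_onI continuous_intros)
  show "integrable angular_law (\<lambda>t. cis t ^ a * cnj (cis t) ^ b)"
    unfolding eq
    by (rule integrable_const_bound[of _ 1]) (auto simp: angular_law_def meas)
  show "integral\<^sup>L angular_law (\<lambda>t. cis t ^ a * cnj (cis t) ^ b) = (if a = b then 1 else 0)"
  proof (cases "a = b")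
    case True
    then show ?thesis unfolding eq by (simp add: prob_space)
  next
    case False
    define c where "c = real a - real b"
    have c: "c \<noteq> 0" using False by (simp add: c_def)
    have per: "cis (c * (2*pi)) = 1"
    proof -
      have "cis (c * (2*pi)) = cis (2*pi) ^ a * cnj (cis (2*pi)) ^ b"
        unfolding eq c_def by simp
      then show ?thesis by simp
    qed
    have "(\<integral>t. indicator {0..2*pi} t *\<^sub>R cis (c * t) \<partial>lborel)
        = cis (c * (2*pi)) / (\<i> * c) - cis (c * 0) / (\<i> * c)"
    proof (rule integral_FTC_Icc)
      show "((\<lambda>t. cis (c * t) / (\<i> * c)) has_vector_derivative cis (c * t)) (at t within {0..2*pi})" for t
      proof -
        have "((\<lambda>t. cis (c * t)) has_vector_derivative c *\<^sub>R (\<i> * cis (c * t))) (at t within {0..2*pi})"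
          unfolding has_vector_derivative_def
          by (auto intro!: derivative_eq_intros simp: algebra_simps scaleR_conv_of_real)
        then have "((\<lambda>t. cis (c * t) / (\<i> * c)) has_vector_derivative (c *\<^sub>R (\<i> * cis (c * t))) / (\<i> * c))
            (at t within {0..2*pi})"
          by (rule has_vector_derivative_divide)
        then show ?thesis using c by (simp add: scaleR_conv_of_real)
      qed
    qed (auto intro!: continuous_intros)
    also have "\<dots> = 0" using per by simp
    finally have zero: "(\<integral>t. indicator {0..2*pi} t *\<^sub>R cis (c * t) \<partial>lborel) = 0" .
    have "integral\<^sup>L angular_law (\<lambda>t. cis (c * t))
        = (\<integral>t. (indicator {0..2*pi} t / (2*pi)) *\<^sub>R cis (c * t) \<partial>lborel)"
      unfolding angular_law_def
      by (subst integral_density) (auto intro!: borel_measurable_continuous_onI continuous_intros)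
    also have "\<dots> = (\<integral>t. (1/(2*pi)) *\<^sub>R (indicator {0..2*pi} t *\<^sub>R cis (c * t)) \<partial>lborel)"
      by (intro Bochner_Integration.integral_cong) auto
    also have "\<dots> = 0" by (subst integral_scaleR_right) (simp add: zero)
    finally show ?thesis using False unfolding eq c_def by simp
  qed
qed

text \<open>
  The index \<open>Inl j\<close> carries the squared modulus and \<open>Inr j\<close> the argument of the \<open>j\<close>-th coordinate.
\<close>
definition polar_measure :: "('k::finite + 'k \<Rightarrow> real) measure"
  where "polar_measure = Pi\<^sub>M UNIV (case_sum (\<lambda>_. radial_law) (\<lambda>_. angular_law))"

definition polar_point :: "('k::finite + 'k \<Rightarrow> real) \<Rightarrow> complex^'k"
  where "polar_point \<omega> = (\<chi> j. complex_of_real (sqrt (\<omega> (Inl j))) * cis (\<omega> (Inr j)))"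

definition gaussian :: "(complex^'k) measure"
  where "gaussian = distr polar_measure borel polar_point"

definition monomial :: "('k::finite \<Rightarrow> nat) \<Rightarrow> complex^'k \<Rightarrow> complex"
  where "monomial \<gamma> x = (\<Prod>j\<in>UNIV. (x $ j) ^ \<gamma> j)"

definition mfact :: "('k::finite \<Rightarrow> nat) \<Rightarrow> real"
  where "mfact \<gamma> = (\<Prod>j\<in>UNIV. fact (\<gamma> j))"

lemma sets_gaussian [simp, measurable_cong]: "sets gaussian = sets borel"
  by (simp add: gaussian_def)

lemma space_gaussian [simp]: "space gaussian = UNIV"
  by (simp add: gaussian_def)

lemma measurable_polar_point: "polar_point \<in> measurable polar_measure borel"
proof (rule borel_measurable_euclidean_space[THEN iffD2], intro ballI)
  fix b :: "complex^'k" assume "b \<in> Basis"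
  then obtain j u where b: "b = axis j u" by (auto simp: Basis_vec_def)
  have comp: "(\<lambda>\<omega>. \<omega> i) \<in> borel_measurable (polar_measure :: ('k + 'k \<Rightarrow> real) measure)" for i
  proof -
    have "(\<lambda>\<omega>. \<omega> i) \<in> measurable (Pi\<^sub>M UNIV (case_sum (\<lambda>_. radial_law) (\<lambda>_. angular_law)))
       (case_sum (\<lambda>_. radial_law) (\<lambda>_. angular_law) i)"
      by (rule measurable_component_singleton) simp
    moreover have "sets (case_sum (\<lambda>_. radial_law) (\<lambda>_. angular_law) i) = sets borel"
      by (cases i) (auto simp: radial_law_def angular_law_def)
    ultimately show ?thesis
      unfolding polar_measure_def using measurable_cong_sets by blast
  qed
  have [measurable]: "cis \<in> borel_measurable borel"
    by (intro borel_measurable_continuous_onI continuous_intros)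
  note [measurable] = comp[of "Inl j"] comp[of "Inr j"]
  show "(\<lambda>x. polar_point x \<bullet> b) \<in> borel_measurable polar_measure"
    unfolding b by (simp add: inner_axis polar_point_def)
qed

text \<open>
  Monomials are orthogonal because of the angular integrals, and the squared norm of a monomial is
  the product of the factorials of its exponents because of the radial ones. All later computations
  with the Gaussian measure use only this.
\<close>
lemma gaussian_moment:
  fixes \<alpha> \<beta> :: "'k::finite \<Rightarrow> nat"
  shows "integrable gaussian (\<lambda>x. monomial \<alpha> x * cnj (monomial \<beta> x))"
    and "(\<integral>x. monomial \<alpha> x * cnj (monomial \<beta> x) \<partial>gaussian)
         = (if \<alpha> = \<beta> then complex_of_real (mfact \<alpha>) else 0)"
proof -
  define F :: "'k + 'k \<Rightarrow> real \<Rightarrow> complex" where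
    "F = case_sum (\<lambda>j r. complex_of_real (sqrt r) ^ (\<alpha> j + \<beta> j))
                  (\<lambda>j t. cis t ^ \<alpha> j * cnj (cis t) ^ \<beta> j)"
  let ?M = "case_sum (\<lambda>_. radial_law) (\<lambda>_. angular_law) :: 'k + 'k \<Rightarrow> real measure"
  interpret product_sigma_finite ?M
  proof (rule product_sigma_finite.intro)
    fix i :: "'k + 'k"
    have "prob_space (?M i)"
      by (cases i) (auto simp: prob_space_radial_law prob_space_angular_law)
    then show "sigma_finite_measure (?M i)"
      by (simp add: prob_space_imp_sigma_finite)
  qed
  have intF: "integrable (?M i) (F i)" for i
    by (cases i) (auto simp: F_def integrable_radial_sqrt_power angular_fourier(1))
  have split: "(\<Prod>i\<in>UNIV. G i) = (\<Prod>j\<in>UNIV. G (Inl j) * G (Inr j))" for G :: "'k + 'k \<Rightarrow> complex"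
    by (simp add: UNIV_Plus_UNIV[symmetric] prod.Plus prod.distrib del: UNIV_Plus_UNIV)
  have prod: "monomial \<alpha> (polar_point \<omega>) * cnj (monomial \<beta> (polar_point \<omega>)) = (\<Prod>i\<in>UNIV. F i (\<omega> i))" for \<omega>
    unfolding split monomial_def polar_point_def
    by (simp add: F_def prod.distrib[symmetric] power_mult_distrib power_add mult_ac)
  have meas: "(\<lambda>x :: complex^'k. monomial \<alpha> x * cnj (monomial \<beta> x)) \<in> borel_measurable borel"
    unfolding monomial_def by (intro borel_measurable_continuous_onI continuous_intros)
  have int: "integrable polar_measure (\<lambda>\<omega>. \<Prod>i\<in>UNIV. F i (\<omega> i))"
    unfolding polar_measure_def by (rule product_integrable_prod) (auto simp: intF)
  then show "integrable gaussian (\<lambda>x. monomial \<alpha> x * cnj (monomial \<beta> x))"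
    unfolding gaussian_def
    by (subst integrable_distr_eq[OF measurable_polar_point meas]) (simp add: prod)
  have "(\<integral>x. monomial \<alpha> x * cnj (monomial \<beta> x) \<partial>gaussian) = (\<integral>\<omega>. (\<Prod>i\<in>UNIV. F i (\<omega> i)) \<partial>polar_measure)"
    unfolding gaussian_def
    by (subst integral_distr[OF measurable_polar_point meas]) (simp add: prod)
  also have "\<dots> = (\<Prod>i\<in>UNIV. integral\<^sup>L (?M i) (F i))"
    unfolding polar_measure_def by (rule product_integral_prod) (auto simp: intF)
  also have "\<dots> = (\<Prod>j\<in>UNIV. integral\<^sup>L radial_law (\<lambda>r. complex_of_real (sqrt r) ^ (\<alpha> j + \<beta> j))
        * (if \<alpha> j = \<beta> j then 1 else 0))"
    unfolding split by (simp add: F_def angular_fourier(2))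
  also have "\<dots> = (if \<alpha> = \<beta> then complex_of_real (mfact \<alpha>) else 0)"
  proof (cases "\<alpha> = \<beta>")
    case True
    have "integral\<^sup>L radial_law (\<lambda>r. complex_of_real (sqrt r) ^ (n + n)) = complex_of_real (fact n)" for n
    proof -
      have "integral\<^sup>L radial_law (\<lambda>r. complex_of_real (sqrt r) ^ (n + n))
          = integral\<^sup>L radial_law (\<lambda>r. complex_of_real (r ^ n))"
      proof (rule integral_cong_AE)
        show "AE r in radial_law. complex_of_real (sqrt r) ^ (n + n) = complex_of_real (r ^ n)"
          using AE_radial_law_nonneg
        proof eventually_elim
          case (elim r)
          have "sqrt r ^ (n + n) = r ^ n"
            using elim by (simp add: power_add power_mult_distrib[symmetric])
          then show ?case by (metis of_real_power)
        qed
      qed (auto simp: radial_law_def)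
      then show ?thesis by (simp add: radial_moment(2) del: of_real_power)
    qed
    with True show ?thesis by (simp add: mfact_def)
  next
    case False
    then obtain j where "\<alpha> j \<noteq> \<beta> j" by auto
    then show ?thesis using False by (auto intro!: prod_zero)
  qed
  finally show "(\<integral>x. monomial \<alpha> x * cnj (monomial \<beta> x) \<partial>gaussian)
         = (if \<alpha> = \<beta> then complex_of_real (mfact \<alpha>) else 0)" .
qed

lemma prod_raise_exp:
  fixes f :: "nat \<Rightarrow> 'k::finite \<Rightarrow> 'a::comm_monoid_mult"
  assumes "f (Suc (\<gamma> j)) j = c * f (\<gamma> j) j"
  shows "(\<Prod>i\<in>UNIV. f (raise_exp j \<gamma> i) i) = c * (\<Prod>i\<in>UNIV. f (\<gamma> i) i)"
proof -
  have "(\<Prod>i\<in>UNIV. f (raise_exp j \<gamma> i) i) = f (Suc (\<gamma> j)) j * (\<Prod>i\<in>UNIV - {j}. f (\<gamma> i) i)"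
    by (subst prod.remove[of _ j]) (auto simp: raise_exp_def intro!: prod.cong)
  also have "\<dots> = c * (f (\<gamma> j) j * (\<Prod>i\<in>UNIV - {j}. f (\<gamma> i) i))"
    by (simp add: assms mult_ac)
  also have "f (\<gamma> j) j * (\<Prod>i\<in>UNIV - {j}. f (\<gamma> i) i) = (\<Prod>i\<in>UNIV. f (\<gamma> i) i)"
    by (subst prod.remove[of UNIV j]) auto
  finally show ?thesis .
qed

lemma monomial_raise: "monomial (raise_exp j \<gamma>) x = x $ j * monomial \<gamma> x"
  unfolding monomial_def by (rule prod_raise_exp) simp

lemma mfact_raise: "mfact (raise_exp j \<gamma>) = real (\<gamma> j + 1) * mfact \<gamma>"
  unfolding mfact_def by (rule prod_raise_exp[where f = "\<lambda>n _. fact n"]) simp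

lemma mfact_pos: "mfact \<gamma> > 0"
  unfolding mfact_def by (intro prod_pos) auto

lemma borel_measurable_monomial [measurable]: "monomial \<gamma> \<in> borel_measurable borel"
  unfolding monomial_def by (intro borel_measurable_continuous_onI continuous_intros)

lemma borel_measurable_cnj [measurable]:
  "f \<in> borel_measurable M \<Longrightarrow> (\<lambda>x. cnj (f x)) \<in> borel_measurable M"
  by (rule borel_measurable_continuous_on[of cnj]) (auto intro: continuous_intros)

lemma norm_vec_sq: "(norm (x :: complex^'n))\<^sup>2 = (\<Sum>j\<in>UNIV. (cmod (x $ j))\<^sup>2)"
  by (simp add: norm_vec_def L2_set_def sum_nonneg)

lemma norm_vec_sq_complex: "complex_of_real ((norm (x :: complex^'n))\<^sup>2) = (\<Sum>j\<in>UNIV. x $ j * cnj (x $ j))"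
  unfolding norm_vec_sq by (simp only: of_real_sum complex_norm_square)

section \<open>Square-integrable functions for the Gaussian measure\<close>

definition square_integrable :: "(complex^'k \<Rightarrow> complex) \<Rightarrow> bool"
  where "square_integrable F \<longleftrightarrow>
    F \<in> borel_measurable borel \<and> integrable gaussian (\<lambda>x. (cmod (F x))\<^sup>2)"

definition sq_norm :: "(complex^'k \<Rightarrow> complex) \<Rightarrow> real"
  where "sq_norm F = (\<integral>x. (cmod (F x))\<^sup>2 \<partial>gaussian)"

lemma sq_norm_nonneg: "sq_norm F \<ge> 0"
  unfolding sq_norm_def by simp

lemma square_integrable_measurable: "square_integrable F \<Longrightarrow> F \<in> borel_measurable borel"
  by (simp add: square_integrable_def)

lemma cmod_add_sq_le: "(cmod (a + b))\<^sup>2 \<le> 2 * (cmod a)\<^sup>2 + 2 * (cmod b)\<^sup>2"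
proof -
  have "(cmod (a + b))\<^sup>2 \<le> (cmod a + cmod b)\<^sup>2"
    by (intro power_mono norm_triangle_ineq norm_ge_zero)
  also have "\<dots> \<le> 2 * (cmod a)\<^sup>2 + 2 * (cmod b)\<^sup>2"
    using sum_squares_bound[of "cmod a" "cmod b"] by (simp add: power2_sum)
  finally show ?thesis .
qed

lemma square_integrable_dominated:
  assumes "square_integrable G" "F \<in> borel_measurable borel"
    and "\<And>x. cmod (F x) \<le> B * cmod (G x)"
  shows "square_integrable F" "sq_norm F \<le> B\<^sup>2 * sq_norm G"
proof -
  have le: "(cmod (F x))\<^sup>2 \<le> B\<^sup>2 * (cmod (G x))\<^sup>2" for x
    using power_mono[OF assms(3)[of x], of 2] by (simp add: power_mult_distrib)
  have G: "integrable gaussian (\<lambda>x. B\<^sup>2 * (cmod (G x))\<^sup>2)"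
    using assms(1) by (simp add: square_integrable_def)
  have F: "integrable gaussian (\<lambda>x. (cmod (F x))\<^sup>2)"
    using assms(2) le by (intro Bochner_Integration.integrable_bound[OF G]) auto
  then show "square_integrable F" using assms(2) by (simp add: square_integrable_def)
  have "sq_norm F \<le> (\<integral>x. B\<^sup>2 * (cmod (G x))\<^sup>2 \<partial>gaussian)"
    unfolding sq_norm_def by (intro integral_mono F G le)
  then show "sq_norm F \<le> B\<^sup>2 * sq_norm G" by (simp add: sq_norm_def)
qed

lemma square_integrable_add:
  assumes "square_integrable F" "square_integrable G"
  shows "square_integrable (\<lambda>x. F x + G x)"
    and "sq_norm (\<lambda>x. F x + G x) \<le> 2 * sq_norm F + 2 * sq_norm G"
proof -
  note [measurable] = assms[THEN square_integrable_measurable]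
  have FG: "integrable gaussian (\<lambda>x. 2 * (cmod (F x))\<^sup>2 + 2 * (cmod (G x))\<^sup>2)"
    using assms by (simp add: square_integrable_def)
  have S: "integrable gaussian (\<lambda>x. (cmod (F x + G x))\<^sup>2)"
    using cmod_add_sq_le by (intro Bochner_Integration.integrable_bound[OF FG]) auto
  then show "square_integrable (\<lambda>x. F x + G x)" by (simp add: square_integrable_def)
  have "sq_norm (\<lambda>x. F x + G x) \<le> (\<integral>x. 2 * (cmod (F x))\<^sup>2 + 2 * (cmod (G x))\<^sup>2 \<partial>gaussian)"
    unfolding sq_norm_def by (intro integral_mono S FG cmod_add_sq_le)
  also have "\<dots> = 2 * sq_norm F + 2 * sq_norm G"
    using assms by (simp add: sq_norm_def square_integrable_def)
  finally show "sq_norm (\<lambda>x. F x + G x) \<le> 2 * sq_norm F + 2 * sq_norm G" .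
qed

lemma square_integrable_scale:
  assumes "square_integrable F"
  shows "square_integrable (\<lambda>x. c * F x)" "sq_norm (\<lambda>x. c * F x) = (cmod c)\<^sup>2 * sq_norm F"
  using assms by (auto simp: square_integrable_def sq_norm_def norm_mult power_mult_distrib)

lemma square_integrable_diff:
  assumes "square_integrable F" "square_integrable G"
  shows "square_integrable (\<lambda>x. F x - G x)"
    and "sq_norm (\<lambda>x. F x - G x) \<le> 2 * sq_norm F + 2 * sq_norm G"
  using square_integrable_add[OF assms(1) square_integrable_scale(1)[OF assms(2), of "-1"]]
  by (simp_all add: square_integrable_scale(2)[OF assms(2), of "-1", simplified])

lemma square_integrable_sum:
  assumes "finite I" "\<And>i. i \<in> I \<Longrightarrow> square_integrable (F i)"
  shows "square_integrable (\<lambda>x. \<Sum>i\<in>I. F i x)"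
  using assms
proof (induction I rule: finite_induct)
  case empty then show ?case by (simp add: square_integrable_def)
next
  case (insert i I)
  then show ?case using square_integrable_add(1)[of "F i" "\<lambda>x. \<Sum>i\<in>I. F i x"] by simp
qed

lemma sq_norm_sum_le:
  assumes "finite I" "\<And>i. i \<in> I \<Longrightarrow> square_integrable (F i)"
  shows "sq_norm (\<lambda>x. \<Sum>i\<in>I. F i x) \<le> real (card I) * (\<Sum>i\<in>I. sq_norm (F i))"
proof -
  have le: "(cmod (\<Sum>i\<in>I. F i x))\<^sup>2 \<le> real (card I) * (\<Sum>i\<in>I. (cmod (F i x))\<^sup>2)" for x
  proof -
    have "(cmod (\<Sum>i\<in>I. F i x))\<^sup>2 \<le> (\<Sum>i\<in>I. cmod (F i x))\<^sup>2"
      by (intro power_mono norm_sum norm_ge_zero)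
    also have "\<dots> \<le> real (card I) * (\<Sum>i\<in>I. (cmod (F i x))\<^sup>2)"
      using Cauchy_Schwarz_ineq_sum[of "\<lambda>_. 1" "\<lambda>i. cmod (F i x)" I] by simp
    finally show ?thesis .
  qed
  have int: "integrable gaussian (\<lambda>x. (cmod (F i x))\<^sup>2)" if "i \<in> I" for i
    using assms(2)[OF that] by (simp add: square_integrable_def)
  have "sq_norm (\<lambda>x. \<Sum>i\<in>I. F i x) \<le> (\<integral>x. real (card I) * (\<Sum>i\<in>I. (cmod (F i x))\<^sup>2) \<partial>gaussian)"
    unfolding sq_norm_def
  proof (intro integral_mono le)
    show "integrable gaussian (\<lambda>x. (cmod (\<Sum>i\<in>I. F i x))\<^sup>2)"
      using square_integrable_sum[OF assms] by (simp add: square_integrable_def)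
  qed (use int in auto)
  also have "\<dots> = real (card I) * (\<Sum>i\<in>I. sq_norm (F i))"
    using int by (simp add: sq_norm_def)
  finally show ?thesis .
qed

lemma square_integrable_mult_cnj:
  assumes "square_integrable F" "square_integrable G"
  shows "integrable gaussian (\<lambda>x. F x * cnj (G x))"
proof -
  note [measurable] = assms[THEN square_integrable_measurable]
  have FG: "integrable gaussian (\<lambda>x. (cmod (F x))\<^sup>2 + (cmod (G x))\<^sup>2)"
    using assms by (simp add: square_integrable_def)
  have "cmod (F x * cnj (G x)) \<le> (cmod (F x))\<^sup>2 + (cmod (G x))\<^sup>2" for x
  proof -
    have "2 * (cmod (F x) * cmod (G x)) \<le> (cmod (F x))\<^sup>2 + (cmod (G x))\<^sup>2"
      using sum_squares_bound[of "cmod (F x)" "cmod (G x)"] by (simp add: mult.assoc)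
    moreover have "0 \<le> cmod (F x) * cmod (G x)" by simp
    ultimately have "cmod (F x) * cmod (G x) \<le> (cmod (F x))\<^sup>2 + (cmod (G x))\<^sup>2" by linarith
    then show ?thesis by (simp add: norm_mult)
  qed
  then show ?thesis by (intro Bochner_Integration.integrable_bound[OF FG]) auto
qed

lemma pythagoras_orthogonal:
  assumes F: "square_integrable F" and G: "square_integrable G"
    and orth: "(\<integral>x. F x * cnj (G x) \<partial>gaussian) = 0"
  shows "sq_norm (\<lambda>x. F x - G x) = sq_norm F + sq_norm G"
proof -
  have exp: "(cmod (F x - G x))\<^sup>2 = (cmod (F x))\<^sup>2 + (cmod (G x))\<^sup>2 - 2 * Re (F x * cnj (G x))" for x
    unfolding cmod_power2 by (simp add: power2_eq_square algebra_simps)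
  have int: "integrable gaussian (\<lambda>x. F x * cnj (G x))"
    by (rule square_integrable_mult_cnj[OF F G])
  have "sq_norm (\<lambda>x. F x - G x) = sq_norm F + sq_norm G - 2 * (\<integral>x. Re (F x * cnj (G x)) \<partial>gaussian)"
    unfolding sq_norm_def exp using F G integrable_Re[OF int]
    by (subst Bochner_Integration.integral_diff) (auto simp: square_integrable_def simp del: times_complex.sel)
  also have "(\<integral>x. Re (F x * cnj (G x)) \<partial>gaussian) = 0"
    using integral_Re[OF int] orth by simp
  finally show ?thesis by simp
qed

text \<open>
  Used for images of monomials under operators that preserve their orthogonality, which turns operator
  norms into a maximum over monomials.
\<close>
lemma sq_norm_orthogonal_sum:
  fixes \<phi> :: "'i \<Rightarrow> complex^'k \<Rightarrow> complex"
  assumes "finite I"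
    and "\<And>i. i \<in> I \<Longrightarrow> \<phi> i \<in> borel_measurable borel"
    and int: "\<And>i j. i \<in> I \<Longrightarrow> j \<in> I \<Longrightarrow> integrable gaussian (\<lambda>x. \<phi> i x * cnj (\<phi> j x))"
    and val: "\<And>i j. i \<in> I \<Longrightarrow> j \<in> I \<Longrightarrow>
      (\<integral>x. \<phi> i x * cnj (\<phi> j x) \<partial>gaussian) = (if i = j then complex_of_real (w i) else 0)"
  shows "square_integrable (\<lambda>x. \<Sum>i\<in>I. c i * \<phi> i x)"
    and "sq_norm (\<lambda>x. \<Sum>i\<in>I. c i * \<phi> i x) = (\<Sum>i\<in>I. (cmod (c i))\<^sup>2 * w i)"
proof -
  let ?F = "\<lambda>x. \<Sum>i\<in>I. c i * \<phi> i x"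
  have exp: "complex_of_real ((cmod (?F x))\<^sup>2) = (\<Sum>i\<in>I. \<Sum>j\<in>I. c i * cnj (c j) * (\<phi> i x * cnj (\<phi> j x)))" for x
    unfolding complex_norm_square by (simp add: sum_product mult_ac)
  have intc: "integrable gaussian (\<lambda>x. complex_of_real ((cmod (?F x))\<^sup>2))"
    unfolding exp using int by auto
  then have "integrable gaussian (\<lambda>x. (cmod (?F x))\<^sup>2)"
    using integrable_Re[OF intc] by simp
  then show "square_integrable ?F"
    using assms(2) by (auto simp: square_integrable_def)
  have "complex_of_real (sq_norm ?F) = (\<Sum>i\<in>I. \<Sum>j\<in>I. c i * cnj (c j) * (if i = j then complex_of_real (w i) else 0))"
    unfolding sq_norm_def integral_complex_of_real[symmetric] exp
    using int by (subst Bochner_Integration.integral_sum) (auto simp: Bochner_Integration.integral_sum val)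
  also have "\<dots> = (\<Sum>i\<in>I. complex_of_real ((cmod (c i))\<^sup>2 * w i))"
    using assms(1)
    by (simp add: if_distrib[of "\<lambda>x. _ * x"] complex_norm_square[symmetric]
      flip: of_real_mult of_real_power cong: if_cong)
  finally have "complex_of_real (sq_norm ?F) = complex_of_real (\<Sum>i\<in>I. (cmod (c i))\<^sup>2 * w i)"
    by simp
  then show "sq_norm ?F = (\<Sum>i\<in>I. (cmod (c i))\<^sup>2 * w i)"
    using of_real_eq_iff by blast
qed

section \<open>Homogeneous polynomials and their almost-commutation relations\<close>

definition hom_polys :: "nat \<Rightarrow> (complex^'k \<Rightarrow> complex) set"
  where "hom_polys d = range (\<lambda>c x. \<Sum>\<gamma>\<in>exponents d. c \<gamma> * monomial \<gamma> x)"

lemma hom_polysI: "p = (\<lambda>x. \<Sum>\<gamma>\<in>exponents d. c \<gamma> * monomial \<gamma> x) \<Longrightarrow> p \<in> hom_polys d"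
  unfolding hom_polys_def by (rule range_eqI)

lemma hom_polys_sq_norm:
  fixes c :: "('k::finite \<Rightarrow> nat) \<Rightarrow> complex"
  assumes "finite I"
  shows "square_integrable (\<lambda>x. \<Sum>\<gamma>\<in>I. c \<gamma> * monomial \<gamma> x)"
    and "sq_norm (\<lambda>x. \<Sum>\<gamma>\<in>I. c \<gamma> * monomial \<gamma> x)
         = (\<Sum>\<gamma>\<in>I. (cmod (c \<gamma>))\<^sup>2 * mfact \<gamma>)"
  by (rule sq_norm_orthogonal_sum(1)[OF assms borel_measurable_monomial gaussian_moment])
    (rule sq_norm_orthogonal_sum(2)[OF assms borel_measurable_monomial gaussian_moment])

lemma hom_polys_square_integrable: "p \<in> hom_polys d \<Longrightarrow> square_integrable p"
  by (auto simp: hom_polys_def intro: hom_polys_sq_norm(1)[OF finite_exponents])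

lemma hom_polys_zero: "(\<lambda>x. 0) \<in> hom_polys d"
  unfolding hom_polys_def by (rule range_eqI[where x = "\<lambda>_. 0"]) simp

lemma hom_polys_add:
  assumes "p \<in> hom_polys d" "q \<in> hom_polys d"
  shows "(\<lambda>x. p x + q x) \<in> hom_polys d"
proof -
  obtain a b where "p = (\<lambda>x. \<Sum>\<gamma>\<in>exponents d. a \<gamma> * monomial \<gamma> x)"
    "q = (\<lambda>x. \<Sum>\<gamma>\<in>exponents d. b \<gamma> * monomial \<gamma> x)"
    using assms by (auto simp: hom_polys_def)
  then have "(\<lambda>x. p x + q x) = (\<lambda>x. \<Sum>\<gamma>\<in>exponents d. (a \<gamma> + b \<gamma>) * monomial \<gamma> x)"
    by (simp add: sum.distrib algebra_simps)
  then show ?thesis by (rule hom_polysI)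
qed

lemma hom_polys_scale:
  assumes "p \<in> hom_polys d"
  shows "(\<lambda>x. c * p x) \<in> hom_polys d"
proof -
  obtain a where "p = (\<lambda>x. \<Sum>\<gamma>\<in>exponents d. a \<gamma> * monomial \<gamma> x)"
    using assms by (auto simp: hom_polys_def)
  then have "(\<lambda>x. c * p x) = (\<lambda>x. \<Sum>\<gamma>\<in>exponents d. (c * a \<gamma>) * monomial \<gamma> x)"
    by (simp add: sum_distrib_left algebra_simps)
  then show ?thesis by (rule hom_polysI)
qed

lemma hom_polys_sum:
  "finite I \<Longrightarrow> (\<And>i. i \<in> I \<Longrightarrow> p i \<in> hom_polys d) \<Longrightarrow> (\<lambda>x. \<Sum>i\<in>I. p i x) \<in> hom_polys d"
  by (induction I rule: finite_induct) (auto intro: hom_polys_zero hom_polys_add)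

lemma monomial_in_hom_polys:
  assumes "\<gamma> \<in> exponents d"
  shows "monomial \<gamma> \<in> hom_polys d"
proof -
  have "monomial \<gamma> = (\<lambda>x. \<Sum>\<delta>\<in>exponents d. (if \<delta> = \<gamma> then 1 else 0) * monomial \<delta> x)"
    using assms by (intro ext) (simp add: if_distrib[of "\<lambda>c. c * _"] cong: if_cong)
  then show ?thesis by (rule hom_polysI)
qed

lemma hom_polys_at_zero:
  fixes p :: "complex^'k \<Rightarrow> complex"
  assumes "p \<in> hom_polys d" "d > 0"
  shows "p 0 = 0"
proof -
  have "monomial \<gamma> (0 :: complex^'k) = 0" if "\<gamma> \<in> exponents d" for \<gamma> :: "'k \<Rightarrow> nat"
  proof -
    have "sum \<gamma> UNIV \<noteq> 0" using that assms(2) by (simp add: exponents_def)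
    then obtain j where "\<gamma> j \<noteq> 0" by (meson sum.not_neutral_contains_not_neutral)
    then show ?thesis unfolding monomial_def by (intro prod_zero) auto
  qed
  then show ?thesis using assms(1) by (auto simp: hom_polys_def)
qed

lemma hom_polys_coordinate_mult:
  assumes "p \<in> hom_polys d"
  shows "(\<lambda>x. x $ j * p x) \<in> hom_polys (Suc d)"
proof -
  obtain a where "p = (\<lambda>x. \<Sum>\<gamma>\<in>exponents d. a \<gamma> * monomial \<gamma> x)"
    using assms by (auto simp: hom_polys_def)
  then have "(\<lambda>x. x $ j * p x) = (\<lambda>x. \<Sum>\<gamma>\<in>exponents d. a \<gamma> * monomial (raise_exp j \<gamma>) x)"
    by (simp add: sum_distrib_left monomial_raise mult_ac)
  then show ?thesis
    by (auto intro!: hom_polys_sum hom_polys_scale monomial_in_hom_polys simp: raise_exp_exponents)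
qed

text \<open>
  In the Gaussian inner product multiplication by a coordinate is adjoint to differentiation with
  respect to it. The function \<open>\<phi> \<gamma>\<close> is the difference between multiplying the monomial by the
  conjugate of the coordinate and differentiating it. Its squared norm is that of multiplication
  minus that of differentiation, and by the canonical commutation relation this is the squared norm
  of the monomial itself.
\<close>
lemma monomial_diff_integrals:
  fixes j :: "'k::finite"
  defines "\<phi> \<equiv> \<lambda>\<gamma> x. cnj (x $ j) * monomial \<gamma> x - complex_of_real (\<gamma> j) * monomial (lower_exp j \<gamma>) x"
  shows "\<phi> \<gamma> \<in> borel_measurable borel"
    and "integrable gaussian (\<lambda>x. \<phi> \<alpha> x * cnj (\<phi> \<beta> x))"
    and "(\<integral>x. \<phi> \<alpha> x * cnj (\<phi> \<beta> x) \<partial>gaussian) = (if \<alpha> = \<beta> then complex_of_real (mfact \<alpha>) else 0)"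
proof -
  show "\<phi> \<gamma> \<in> borel_measurable borel"
    unfolding \<phi>_def monomial_def by (intro borel_measurable_continuous_onI continuous_intros)
  let ?a = "complex_of_real (\<alpha> j)" and ?b = "complex_of_real (\<beta> j)"
  have cancel: "complex_of_real (\<delta> j) * (x $ j * monomial (lower_exp j \<delta>) x)
      = complex_of_real (\<delta> j) * monomial \<delta> x" for \<delta> x
    by (cases "\<delta> j = 0") (simp_all add: monomial_raise[symmetric] raise_lower_exp)
  have exp: "\<phi> \<alpha> x * cnj (\<phi> \<beta> x)
      = monomial (raise_exp j \<alpha>) x * cnj (monomial (raise_exp j \<beta>) x)
        - ?b * (monomial \<alpha> x * cnj (monomial \<beta> x))
        - ?a * (monomial \<alpha> x * cnj (monomial \<beta> x))
        + (?a * ?b) * (monomial (lower_exp j \<alpha>) x * cnj (monomial (lower_exp j \<beta>) x))" for x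
  proof -
    have "\<phi> \<alpha> x * cnj (\<phi> \<beta> x)
      = (x $ j * monomial \<alpha> x) * cnj (x $ j * monomial \<beta> x)
        - monomial \<alpha> x * cnj (?b * (x $ j * monomial (lower_exp j \<beta>) x))
        - (?a * (x $ j * monomial (lower_exp j \<alpha>) x)) * cnj (monomial \<beta> x)
        + (?a * ?b) * (monomial (lower_exp j \<alpha>) x * cnj (monomial (lower_exp j \<beta>) x))"
      unfolding \<phi>_def by (simp add: algebra_simps)
    then show ?thesis unfolding cancel monomial_raise by (simp add: algebra_simps)
  qed
  show "integrable gaussian (\<lambda>x. \<phi> \<alpha> x * cnj (\<phi> \<beta> x))"
    unfolding exp by (intro Bochner_Integration.integrable_add Bochner_Integration.integrable_diff
      integrable_mult_right gaussian_moment(1))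
  note i1 = gaussian_moment(1)[of "raise_exp j \<alpha>" "raise_exp j \<beta>"]
    and i2 = integrable_mult_right[OF gaussian_moment(1)[of \<alpha> \<beta>], of ?b]
    and i3 = integrable_mult_right[OF gaussian_moment(1)[of \<alpha> \<beta>], of ?a]
    and i4 = integrable_mult_right[OF gaussian_moment(1)[of "lower_exp j \<alpha>" "lower_exp j \<beta>"], of "?a * ?b"]
  have "(\<integral>x. \<phi> \<alpha> x * cnj (\<phi> \<beta> x) \<partial>gaussian)
      = (if raise_exp j \<alpha> = raise_exp j \<beta> then complex_of_real (mfact (raise_exp j \<alpha>)) else 0)
        - ?b * (if \<alpha> = \<beta> then complex_of_real (mfact \<alpha>) else 0)
        - ?a * (if \<alpha> = \<beta> then complex_of_real (mfact \<alpha>) else 0)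
        + (?a * ?b) * (if lower_exp j \<alpha> = lower_exp j \<beta> then complex_of_real (mfact (lower_exp j \<alpha>)) else 0)"
    unfolding exp
    by (simp only: Bochner_Integration.integral_add[OF Bochner_Integration.integrable_diff[OF Bochner_Integration.integrable_diff[OF i1 i2] i3] i4]
      Bochner_Integration.integral_diff[OF Bochner_Integration.integrable_diff[OF i1 i2] i3]
      Bochner_Integration.integral_diff[OF i1 i2] integral_mult_right_zero gaussian_moment(2))
  also have "\<dots> = (if \<alpha> = \<beta> then complex_of_real (mfact \<alpha>) else 0)"
  proof (cases "\<alpha> = \<beta>")
    case True
    have "?a * ?a * mfact (lower_exp j \<alpha>) = ?a * mfact \<alpha>"
    proof (cases "\<alpha> j = 0")
      case False
      then have "lower_exp j \<alpha> j + 1 = \<alpha> j" by (simp add: lower_exp_def)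
      then have "mfact \<alpha> = real (\<alpha> j) * mfact (lower_exp j \<alpha>)"
        using mfact_raise[of j "lower_exp j \<alpha>"] raise_lower_exp[of \<alpha> j] False by simp
      then show ?thesis by simp
    qed simp
    then show ?thesis using True by (simp add: mfact_raise algebra_simps)
  next
    case False
    have "?a * ?b * (if lower_exp j \<alpha> = lower_exp j \<beta> then complex_of_real (mfact (lower_exp j \<alpha>)) else 0) = 0"
    proof (cases "\<alpha> j = 0 \<or> \<beta> j = 0")
      case nz: False
      then have "lower_exp j \<alpha> \<noteq> lower_exp j \<beta>"
        using raise_lower_exp[of \<alpha> j] raise_lower_exp[of \<beta> j] False by auto
      then show ?thesis by simp
    qed auto
    then show ?thesis using False by simp
  qed
  finally show "(\<integral>x. \<phi> \<alpha> x * cnj (\<phi> \<beta> x) \<partial>gaussian) = (if \<alpha> = \<beta> then complex_of_real (mfact \<alpha>) else 0)" .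
qed

text \<open>
  On the sphere coordinates have size one and not \<open>sqrt d\<close>. The error below is to be divided by \<open>sqrt d\<close>
  accordingly and is then small compared with \<open>p\<close>.
\<close>
lemma conj_coordinate_approx_derivative:
  fixes p :: "complex^'k \<Rightarrow> complex"
  assumes "p \<in> hom_polys d"
  shows "\<exists>q\<in>hom_polys (d - 1). sq_norm (\<lambda>x. cnj (x $ j) * p x - q x) = sq_norm p
    \<and> square_integrable (\<lambda>x. cnj (x $ j) * p x - q x)"
proof -
  obtain c where p: "p = (\<lambda>x. \<Sum>\<gamma>\<in>exponents d. c \<gamma> * monomial \<gamma> x)"
    using assms by (auto simp: hom_polys_def)
  define q where "q = (\<lambda>x :: complex^'k. \<Sum>\<gamma>\<in>exponents d. c \<gamma> * (complex_of_real (\<gamma> j) * monomial (lower_exp j \<gamma>) x))"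
  have "(\<lambda>x. complex_of_real (\<gamma> j) * monomial (lower_exp j \<gamma>) x) \<in> hom_polys (d - 1)"
    if "\<gamma> \<in> exponents d" for \<gamma>
  proof (cases "\<gamma> j = 0")
    case True
    then show ?thesis by (simp add: hom_polys_zero)
  next
    case False
    then show ?thesis
      by (intro hom_polys_scale monomial_in_hom_polys exponents_lower(1) that) simp
  qed
  then have "q \<in> hom_polys (d - 1)"
    unfolding q_def by (intro hom_polys_sum hom_polys_scale[of _ _ "c _"] finite_exponents)
  moreover have eq: "(\<lambda>x. cnj (x $ j) * p x - q x) = (\<lambda>x. \<Sum>\<gamma>\<in>exponents d.
      c \<gamma> * (cnj (x $ j) * monomial \<gamma> x - complex_of_real (\<gamma> j) * monomial (lower_exp j \<gamma>) x))"
    unfolding p q_def sum_distrib_left sum_subtractf[symmetric]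
    by (intro ext sum.cong refl) (simp add: algebra_simps)
  moreover have "sq_norm (\<lambda>x. cnj (x $ j) * p x - q x) = sq_norm p"
    unfolding eq unfolding p
    unfolding sq_norm_orthogonal_sum(2)[OF finite_exponents monomial_diff_integrals]
    by (simp only: hom_polys_sq_norm(2)[OF finite_exponents])
  moreover have "square_integrable (\<lambda>x. cnj (x $ j) * p x - q x)"
    unfolding eq
    by (rule sq_norm_orthogonal_sum(1)[OF finite_exponents monomial_diff_integrals])
  ultimately show ?thesis by blast
qed

text \<open>
  Multiplication by the squared norm of \<open>x\<close> raises one exponent and sums over the variables, and raising \<open>\<gamma> j\<close>
  multiplies the squared norm of the monomial by \<open>\<gamma> j + 1\<close>.
\<close>
lemma norm_sq_moments:
  fixes \<alpha> \<beta> :: "'k::finite \<Rightarrow> nat"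
  defines "N \<equiv> real CARD('k)"
  assumes "\<alpha> \<in> exponents d"
  shows "integrable gaussian (\<lambda>x. complex_of_real ((norm x)\<^sup>2) * (monomial \<alpha> x * cnj (monomial \<beta> x)))"
    and "(\<integral>x. complex_of_real ((norm x)\<^sup>2) * (monomial \<alpha> x * cnj (monomial \<beta> x)) \<partial>gaussian)
       = (if \<alpha> = \<beta> then complex_of_real ((d + N) * mfact \<alpha>) else 0)"
    and "integrable gaussian (\<lambda>x. complex_of_real ((norm x)\<^sup>2) * (complex_of_real ((norm x)\<^sup>2) * (monomial \<alpha> x * cnj (monomial \<beta> x))))"
    and "(\<integral>x. complex_of_real ((norm x)\<^sup>2) * (complex_of_real ((norm x)\<^sup>2) * (monomial \<alpha> x * cnj (monomial \<beta> x))) \<partial>gaussian)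
       = (if \<alpha> = \<beta> then complex_of_real ((d + N) * (d + N + 1) * mfact \<alpha>) else 0)"
proof -
  have exp1: "complex_of_real ((norm x)\<^sup>2) * (monomial \<alpha> x * cnj (monomial \<beta> x))
      = (\<Sum>j\<in>UNIV. monomial (raise_exp j \<alpha>) x * cnj (monomial (raise_exp j \<beta>) x))"
    for x and \<alpha> \<beta> :: "'k \<Rightarrow> nat"
    unfolding norm_vec_sq_complex monomial_raise sum_distrib_right
    by (intro sum.cong) (simp_all add: mult_ac)
  have mf: "(\<Sum>j\<in>UNIV. complex_of_real (mfact (raise_exp j \<alpha>))) = complex_of_real ((d + N) * mfact \<alpha>)"
    if "\<alpha> \<in> exponents d" for \<alpha> :: "'k \<Rightarrow> nat" and d
  proof -
    have "real (\<Sum>j\<in>UNIV. \<alpha> j) = d" using that by (simp add: exponents_def)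
    then have "(\<Sum>j\<in>UNIV. mfact (raise_exp j \<alpha>)) = (d + N) * mfact \<alpha>"
      unfolding mfact_raise N_def by (simp add: sum_distrib_right[symmetric] sum.distrib)
    then show ?thesis by (simp flip: of_real_sum)
  qed
  have int1: "integrable gaussian (\<lambda>x. complex_of_real ((norm x)\<^sup>2) * (monomial \<alpha> x * cnj (monomial \<beta> x)))"
    for \<alpha> \<beta> :: "'k \<Rightarrow> nat"
    unfolding exp1 by (intro Bochner_Integration.integrable_sum gaussian_moment(1))
  have val1: "(\<integral>x. complex_of_real ((norm x)\<^sup>2) * (monomial \<alpha> x * cnj (monomial \<beta> x)) \<partial>gaussian)
       = (if \<alpha> = \<beta> then complex_of_real ((d + N) * mfact \<alpha>) else 0)"
    if "\<alpha> \<in> exponents d" for \<alpha> \<beta> :: "'k \<Rightarrow> nat" and d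
    unfolding exp1
    by (subst Bochner_Integration.integral_sum) (use that in \<open>auto simp: gaussian_moment mf simp del: of_real_mult\<close>)
  show "integrable gaussian (\<lambda>x. complex_of_real ((norm x)\<^sup>2) * (monomial \<alpha> x * cnj (monomial \<beta> x)))"
    by (rule int1)
  show "(\<integral>x. complex_of_real ((norm x)\<^sup>2) * (monomial \<alpha> x * cnj (monomial \<beta> x)) \<partial>gaussian)
       = (if \<alpha> = \<beta> then complex_of_real ((d + N) * mfact \<alpha>) else 0)"
    by (rule val1) fact
  have exp2: "complex_of_real ((norm x)\<^sup>2) * (complex_of_real ((norm x)\<^sup>2) * (monomial \<alpha> x * cnj (monomial \<beta> x)))
      = (\<Sum>j\<in>UNIV. complex_of_real ((norm x)\<^sup>2) * (monomial (raise_exp j \<alpha>) x * cnj (monomial (raise_exp j \<beta>) x)))" for x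
    unfolding exp1[of x \<alpha> \<beta>] by (simp add: sum_distrib_left)
  show "integrable gaussian (\<lambda>x. complex_of_real ((norm x)\<^sup>2) * (complex_of_real ((norm x)\<^sup>2) * (monomial \<alpha> x * cnj (monomial \<beta> x))))"
    unfolding exp2 by (intro Bochner_Integration.integrable_sum int1)
  have "(\<integral>x. complex_of_real ((norm x)\<^sup>2) * (complex_of_real ((norm x)\<^sup>2) * (monomial \<alpha> x * cnj (monomial \<beta> x))) \<partial>gaussian)
      = (\<Sum>j\<in>UNIV. if \<alpha> = \<beta> then complex_of_real ((Suc d + N) * mfact (raise_exp j \<alpha>)) else 0)"
    unfolding exp2
    by (subst Bochner_Integration.integral_sum)
      (simp_all add: int1 val1[OF raise_exp_exponents[THEN iffD2, OF assms(2)]] del: of_real_mult of_real_power)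
  also have "\<dots> = (if \<alpha> = \<beta> then complex_of_real ((d + N) * (d + N + 1) * mfact \<alpha>) else 0)"
  proof (cases "\<alpha> = \<beta>")
    case True
    have "(\<Sum>j\<in>UNIV. complex_of_real ((Suc d + N) * mfact (raise_exp j \<alpha>)))
       = complex_of_real (Suc d + N) * complex_of_real ((d + N) * mfact \<alpha>)"
      unfolding mf[OF assms(2), symmetric] by (simp add: sum_distrib_left)
    with True show ?thesis by (simp add: algebra_simps)
  qed simp
  finally show "(\<integral>x. complex_of_real ((norm x)\<^sup>2) * (complex_of_real ((norm x)\<^sup>2) * (monomial \<alpha> x * cnj (monomial \<beta> x))) \<partial>gaussian)
       = (if \<alpha> = \<beta> then complex_of_real ((d + N) * (d + N + 1) * mfact \<alpha>) else 0)" .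
qed

text \<open>
  Weighted with a homogeneous polynomial of degree \<open>d\<close>, the Gaussian measure is concentrated where the
  squared norm of \<open>x\<close> is about \<open>d\<close>, with relative variance of the order of \<open>1 / d\<close>. This allows the functions
  \<open>x $ j / norm x\<close> of the sphere to be exchanged for \<open>x $ j / sqrt d\<close>.
\<close>
lemma norm_sq_concentration:
  fixes p :: "complex^'k \<Rightarrow> complex"
  assumes "p \<in> hom_polys d" "d > 0"
  defines "N \<equiv> real CARD('k)"
  shows "square_integrable (\<lambda>x. complex_of_real (1 - (norm x)\<^sup>2 / d) * p x)"
    and "sq_norm (\<lambda>x. complex_of_real (1 - (norm x)\<^sup>2 / d) * p x) \<le> (1 + N + N\<^sup>2) / d * sq_norm p"
proof -
  obtain c where p: "p = (\<lambda>x. \<Sum>\<gamma>\<in>exponents d. c \<gamma> * monomial \<gamma> x)"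
    using assms by (auto simp: hom_polys_def)
  define \<psi> where "\<psi> = (\<lambda>\<gamma> (x :: complex^'k). complex_of_real (1 - (norm x)\<^sup>2 / d) * monomial \<gamma> x)"
  define w where "w = (1 - 2 * (d + N) / d + (d + N) * (d + N + 1) / d\<^sup>2)"
  let ?m = "\<lambda>\<alpha> \<beta> x. monomial \<alpha> (x :: complex^'k) * cnj (monomial \<beta> x)"
  let ?r = "\<lambda>x :: complex^'k. complex_of_real ((norm x)\<^sup>2)"
  have exp: "\<psi> \<alpha> x * cnj (\<psi> \<beta> x) = ?m \<alpha> \<beta> x - complex_of_real (2 / d) * (?r x * ?m \<alpha> \<beta> x)
      + complex_of_real (1 / d\<^sup>2) * (?r x * (?r x * ?m \<alpha> \<beta> x))" for \<alpha> \<beta> x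
  proof -
    have "\<psi> \<alpha> x * cnj (\<psi> \<beta> x) = complex_of_real (1 - (norm x)\<^sup>2 / d) * complex_of_real (1 - (norm x)\<^sup>2 / d) * ?m \<alpha> \<beta> x"
      unfolding \<psi>_def by simp
    also have "complex_of_real (1 - (norm x)\<^sup>2 / d) * complex_of_real (1 - (norm x)\<^sup>2 / d)
        = 1 - complex_of_real (2 / d) * ?r x + complex_of_real (1 / d\<^sup>2) * (?r x * ?r x)"
      using assms(2) by (simp add: power2_eq_square field_simps)
    finally show ?thesis by (simp only: ring_distribs mult_1 mult.assoc)
  qed
  have int: "integrable gaussian (\<lambda>x. \<psi> \<alpha> x * cnj (\<psi> \<beta> x))" if "\<alpha> \<in> exponents d" for \<alpha> \<beta>
    unfolding exp
    by (intro Bochner_Integration.integrable_add Bochner_Integration.integrable_diff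
      integrable_mult_right gaussian_moment(1) norm_sq_moments[OF that])
  have val: "(\<integral>x. \<psi> \<alpha> x * cnj (\<psi> \<beta> x) \<partial>gaussian) = (if \<alpha> = \<beta> then complex_of_real (w * mfact \<alpha>) else 0)"
    if "\<alpha> \<in> exponents d" for \<alpha> \<beta>
  proof -
    note i1 = gaussian_moment(1)[of \<alpha> \<beta>]
      and i2 = integrable_mult_right[OF norm_sq_moments(1)[OF that, of \<beta>], of "complex_of_real (2 / d)"]
      and i3 = integrable_mult_right[OF norm_sq_moments(3)[OF that, of \<beta>], of "complex_of_real (1 / d\<^sup>2)"]
    have "(\<integral>x. \<psi> \<alpha> x * cnj (\<psi> \<beta> x) \<partial>gaussian) = (\<integral>x. ?m \<alpha> \<beta> x \<partial>gaussian)
        - complex_of_real (2 / d) * (\<integral>x. ?r x * ?m \<alpha> \<beta> x \<partial>gaussian)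
        + complex_of_real (1 / d\<^sup>2) * (\<integral>x. ?r x * (?r x * ?m \<alpha> \<beta> x) \<partial>gaussian)"
      unfolding exp
      by (simp only: Bochner_Integration.integral_add[OF Bochner_Integration.integrable_diff[OF i1 i2] i3]
        Bochner_Integration.integral_diff[OF i1 i2] integral_mult_right_zero)
    also have "\<dots> = (if \<alpha> = \<beta> then complex_of_real (w * mfact \<alpha>) else 0)"
      unfolding norm_sq_moments(2,4)[OF that] gaussian_moment(2) w_def N_def
      by (simp add: algebra_simps)
    finally show ?thesis .
  qed
  have meas: "\<psi> \<gamma> \<in> borel_measurable borel" for \<gamma>
    unfolding \<psi>_def by measurable
  have eq: "(\<lambda>x. complex_of_real (1 - (norm x)\<^sup>2 / d) * p x) = (\<lambda>x. \<Sum>\<gamma>\<in>exponents d. c \<gamma> * \<psi> \<gamma> x)"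
    unfolding p \<psi>_def sum_distrib_left by (simp add: mult_ac)
  note orth = sq_norm_orthogonal_sum[OF finite_exponents meas int val, where c = c]
  show "square_integrable (\<lambda>x. complex_of_real (1 - (norm x)\<^sup>2 / d) * p x)"
    unfolding eq by (rule orth(1))
  have "sq_norm (\<lambda>x. complex_of_real (1 - (norm x)\<^sup>2 / d) * p x)
      = (\<Sum>\<gamma>\<in>exponents d. (cmod (c \<gamma>))\<^sup>2 * (w * mfact \<gamma>))"
    unfolding eq by (rule orth(2))
  also have "\<dots> = w * sq_norm p"
    unfolding p hom_polys_sq_norm(2)[OF finite_exponents] by (simp add: sum_distrib_left mult_ac)
  also have "\<dots> \<le> (1 + N + N\<^sup>2) / d * sq_norm p"
  proof (rule mult_right_mono[OF _ sq_norm_nonneg])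
    have "w = (d + N + N\<^sup>2) / d\<^sup>2"
      unfolding w_def using assms(2) by (simp add: field_simps power2_eq_square)
    also have "\<dots> \<le> (d + d * N + d * N\<^sup>2) / d\<^sup>2"
      using assms(2) by (intro divide_right_mono add_mono) (auto simp: N_def mult_le_cancel_right1)
    also have "\<dots> = (1 + N + N\<^sup>2) / d"
      using assms(2) by (simp add: power2_eq_square field_simps)
    finally show "w \<le> (1 + N + N\<^sup>2) / d" .
  qed
  finally show "sq_norm (\<lambda>x. complex_of_real (1 - (norm x)\<^sup>2 / d) * p x) \<le> (1 + N + N\<^sup>2) / d * sq_norm p" .
qed

section \<open>Multiplication operators that almost preserve polynomials\<close>

text \<open>
  Multiplication by \<open>f\<close> takes polynomials of degree \<open>d\<close> to polynomials of degree \<open>d + a\<close> up to a relative error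
  that vanishes as \<open>d\<close> grows; in other words, Toeplitz compressions of \<open>f\<close> lose asymptotically nothing.
  The truncation by \<open>nat\<close> is harmless since only large \<open>d\<close> matter.
\<close>
definition asymptotically_toeplitz :: "int \<Rightarrow> (complex^'k \<Rightarrow> complex) \<Rightarrow> bool"
  where "asymptotically_toeplitz a f \<longleftrightarrow>
    f \<in> borel_measurable borel \<and> (\<exists>B. \<forall>x. cmod (f x) \<le> B) \<and>
    (\<forall>e>0. \<exists>K. \<forall>d\<ge>K. \<forall>p\<in>hom_polys d. \<exists>q\<in>hom_polys (nat (int d + a)).
        sq_norm (\<lambda>x. f x * p x - q x) \<le> e * sq_norm p)"

lemma asymptotically_toeplitzD:
  assumes "asymptotically_toeplitz a f" "e > 0"
  shows "\<exists>K. \<forall>d\<ge>K. \<forall>p\<in>hom_polys d. \<exists>q\<in>hom_polys (nat (int d + a)).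
        sq_norm (\<lambda>x. f x * p x - q x) \<le> e * sq_norm p"
  using assms unfolding asymptotically_toeplitz_def by blast

lemma asymptotically_toeplitz_bound:
  assumes "asymptotically_toeplitz a f"
  obtains B where "B > 0" "\<And>x. cmod (f x) \<le> B"
proof -
  obtain B where B: "\<And>x. cmod (f x) \<le> B" using assms by (auto simp: asymptotically_toeplitz_def)
  have "0 \<le> B" using norm_ge_zero B by (rule order_trans)
  moreover have "cmod (f x) \<le> B + 1" for x using B[of x] by simp
  ultimately show ?thesis using that[of "B + 1"] by simp
qed

lemma bounded_mult_square_integrable:
  assumes "f \<in> borel_measurable borel" "\<And>x. cmod (f x) \<le> B" "square_integrable p"
  shows "square_integrable (\<lambda>x. f x * p x)" "sq_norm (\<lambda>x. f x * p x) \<le> B\<^sup>2 * sq_norm p"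
proof -
  have m: "(\<lambda>x. f x * p x) \<in> borel_measurable borel"
    using assms(1) square_integrable_measurable[OF assms(3)] by measurable
  have "cmod (f x * p x) \<le> B * cmod (p x)" for x
    by (simp add: norm_mult mult_right_mono assms(2))
  from square_integrable_dominated[OF assms(3) m this]
  show "square_integrable (\<lambda>x. f x * p x)" "sq_norm (\<lambda>x. f x * p x) \<le> B\<^sup>2 * sq_norm p" by auto
qed

lemma asymptotically_toeplitz_zero: "asymptotically_toeplitz a (\<lambda>x. 0)"
  unfolding asymptotically_toeplitz_def
proof (intro conjI allI impI exI[of _ "0 :: nat"] ballI)
  show "\<exists>B. \<forall>x :: complex^'k. cmod 0 \<le> B" by auto
  fix e :: real and d :: nat and p :: "complex^'k \<Rightarrow> complex" assume "e > 0"
  then show "\<exists>q\<in>hom_polys (nat (int d + a)). sq_norm (\<lambda>x. 0 * p x - q x) \<le> e * sq_norm p"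
    by (intro bexI[OF _ hom_polys_zero]) (auto simp: sq_norm_nonneg, simp add: sq_norm_def)
qed auto

lemma asymptotically_toeplitz_const: "asymptotically_toeplitz 0 (\<lambda>x. c)"
  unfolding asymptotically_toeplitz_def
proof (intro conjI allI impI exI[of _ "0 :: nat"] ballI)
  show "\<exists>B. \<forall>x :: complex^'k. cmod c \<le> B" by auto
  fix e :: real and d :: nat and p :: "complex^'k \<Rightarrow> complex"
  assume e: "e > 0" and p: "p \<in> hom_polys d"
  have "sq_norm (\<lambda>x. c * p x - c * p x) \<le> e * sq_norm p"
    using e mult_nonneg_nonneg[of e "sq_norm p"] sq_norm_nonneg[of p] by (simp add: sq_norm_def)
  then show "\<exists>q\<in>hom_polys (nat (int d + 0)). sq_norm (\<lambda>x. c * p x - q x) \<le> e * sq_norm p"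
    using hom_polys_scale[OF p, of c] by (intro bexI[of _ "\<lambda>x. c * p x"]) simp_all
qed auto

lemma asymptotically_toeplitz_add:
  fixes f g :: "complex^'k \<Rightarrow> complex"
  assumes f: "asymptotically_toeplitz a f" and g: "asymptotically_toeplitz a g"
  shows "asymptotically_toeplitz a (\<lambda>x. f x + g x)"
  unfolding asymptotically_toeplitz_def
proof (intro conjI allI impI)
  note [measurable] = f[unfolded asymptotically_toeplitz_def, THEN conjunct1]
    g[unfolded asymptotically_toeplitz_def, THEN conjunct1]
  show "(\<lambda>x. f x + g x) \<in> borel_measurable borel" by measurable
  obtain B where B: "\<And>x. cmod (f x) \<le> B" using asymptotically_toeplitz_bound[OF f] by blast
  obtain C where C: "\<And>x. cmod (g x) \<le> C" using asymptotically_toeplitz_bound[OF g] by blast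
  show "\<exists>B. \<forall>x. cmod (f x + g x) \<le> B"
    using B C by (meson add_mono norm_triangle_le)
  fix e :: real assume "e > 0"
  then have e4: "e / 4 > 0" by simp
  obtain K where K: "\<forall>d\<ge>K. \<forall>p\<in>hom_polys d. \<exists>q\<in>hom_polys (nat (int d + a)). sq_norm (\<lambda>x. f x * p x - q x) \<le> e/4 * sq_norm p"
    using asymptotically_toeplitzD[OF f e4] by (elim exE)
  obtain L where L: "\<forall>d\<ge>L. \<forall>p\<in>hom_polys d. \<exists>q\<in>hom_polys (nat (int d + a)). sq_norm (\<lambda>x. g x * p x - q x) \<le> e/4 * sq_norm p"
    using asymptotically_toeplitzD[OF g e4] by (elim exE)
  show "\<exists>K. \<forall>d\<ge>K. \<forall>p\<in>hom_polys d. \<exists>q\<in>hom_polys (nat (int d + a)).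
      sq_norm (\<lambda>x. (f x + g x) * p x - q x) \<le> e * sq_norm p"
  proof (intro exI[of _ "max K L"] allI impI ballI)
    fix d and p :: "complex^'k \<Rightarrow> complex" assume d: "max K L \<le> d" and p: "p \<in> hom_polys d"
    obtain q r where q: "q \<in> hom_polys (nat (int d + a))" "sq_norm (\<lambda>x. f x * p x - q x) \<le> e/4 * sq_norm p"
      and r: "r \<in> hom_polys (nat (int d + a))" "sq_norm (\<lambda>x. g x * p x - r x) \<le> e/4 * sq_norm p"
      using K[rule_format, OF _ p] L[rule_format, OF _ p] d by (meson max.bounded_iff)
    note sp = hom_polys_square_integrable[OF p]
    have "square_integrable (\<lambda>x. f x * p x)"
      by (rule bounded_mult_square_integrable[of f B p]; use B sp in simp)
    note sf = square_integrable_diff(1)[OF this hom_polys_square_integrable[OF q(1)]]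
    have "square_integrable (\<lambda>x. g x * p x)"
      by (rule bounded_mult_square_integrable[of g C p]; use C sp in simp)
    note sg = square_integrable_diff(1)[OF this hom_polys_square_integrable[OF r(1)]]
    have "sq_norm (\<lambda>x. (f x * p x - q x) + (g x * p x - r x)) \<le> e * sq_norm p"
      using square_integrable_add(2)[OF sf sg] q(2) r(2) by linarith
    also have "(\<lambda>x. (f x * p x - q x) + (g x * p x - r x)) = (\<lambda>x. (f x + g x) * p x - (q x + r x))"
      by (simp add: algebra_simps)
    finally show "\<exists>q\<in>hom_polys (nat (int d + a)). sq_norm (\<lambda>x. (f x + g x) * p x - q x) \<le> e * sq_norm p"
      using hom_polys_add[OF q(1) r(1)] by (rule bexI)
  qed
qed

text \<open>
  Approximate first the product with \<open>g\<close> and then the product of the result with \<open>f\<close>. Boundedness of \<open>f\<close>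
  keeps the first error small, boundedness of \<open>g\<close> keeps the norm of the intermediate polynomial under
  control.
\<close>
lemma asymptotically_toeplitz_mult:
  fixes f g :: "complex^'k \<Rightarrow> complex"
  assumes f: "asymptotically_toeplitz a f" and g: "asymptotically_toeplitz b g"
  shows "asymptotically_toeplitz (a + b) (\<lambda>x. f x * g x)"
  unfolding asymptotically_toeplitz_def
proof (intro conjI allI impI)
  note [measurable] = f[unfolded asymptotically_toeplitz_def, THEN conjunct1]
    g[unfolded asymptotically_toeplitz_def, THEN conjunct1]
  show "(\<lambda>x. f x * g x) \<in> borel_measurable borel" by measurable
  obtain B where B0: "B > 0" and B: "\<And>x. cmod (f x) \<le> B" using asymptotically_toeplitz_bound[OF f] by blast
  obtain C where C0: "C > 0" and C: "\<And>x. cmod (g x) \<le> C" using asymptotically_toeplitz_bound[OF g] by blast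
  show "\<exists>B. \<forall>x. cmod (f x * g x) \<le> B"
    using B C B0 by (auto simp: norm_mult intro!: exI[of _ "B * C"] mult_mono)
  fix e :: real assume e: "e > 0"
  \<comment> \<open>The intermediate polynomial has squared norm at most \<open>2 * C\<^sup>2 + 2\<close> times that of \<open>p\<close>.\<close>
  define u where "u = e / (2 * (2 * C\<^sup>2 + 2))"
  define v where "v = min 1 (e / (4 * B\<^sup>2))"
  have pos: "2 * C\<^sup>2 + 2 > 0" by (simp add: add_nonneg_pos)
  have u: "u > 0" unfolding u_def using e pos by simp
  have v: "v > 0" unfolding v_def using e B0 by simp
  obtain K where K: "\<forall>d\<ge>K. \<forall>p\<in>hom_polys d. \<exists>q\<in>hom_polys (nat (int d + a)). sq_norm (\<lambda>x. f x * p x - q x) \<le> u/2 * sq_norm p"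
    using asymptotically_toeplitzD[OF f half_gt_zero[OF u]] by (elim exE)
  obtain L where L: "\<forall>d\<ge>L. \<forall>p\<in>hom_polys d. \<exists>q\<in>hom_polys (nat (int d + b)). sq_norm (\<lambda>x. g x * p x - q x) \<le> v * sq_norm p"
    using asymptotically_toeplitzD[OF g v] by (elim exE)
  show "\<exists>K. \<forall>d\<ge>K. \<forall>p\<in>hom_polys d. \<exists>q\<in>hom_polys (nat (int d + (a + b))).
      sq_norm (\<lambda>x. f x * g x * p x - q x) \<le> e * sq_norm p"
  proof (intro exI[of _ "max L (K + nat \<bar>b\<bar>)"] allI impI ballI)
    fix d and p :: "complex^'k \<Rightarrow> complex" assume d: "max L (K + nat \<bar>b\<bar>) \<le> d" and p: "p \<in> hom_polys d"
    obtain q where q: "q \<in> hom_polys (nat (int d + b))" "sq_norm (\<lambda>x. g x * p x - q x) \<le> v * sq_norm p"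
      using L[rule_format, OF _ p] d by (meson max.bounded_iff)
    have dK: "nat (int d + b) \<ge> K" and deg: "int (nat (int d + b)) + a = int d + (a + b)" using d by auto
    obtain r where r: "r \<in> hom_polys (nat (int d + (a + b)))" "sq_norm (\<lambda>x. f x * q x - r x) \<le> u/2 * sq_norm q"
      using K[rule_format, OF dK q(1)] unfolding deg by (elim bexE)
    note sp = hom_polys_square_integrable[OF p] and sq = hom_polys_square_integrable[OF q(1)]
      and sr = hom_polys_square_integrable[OF r(1)]
    have sgp: "square_integrable (\<lambda>x. g x * p x)" and ngp: "sq_norm (\<lambda>x. g x * p x) \<le> C\<^sup>2 * sq_norm p"
      by (rule bounded_mult_square_integrable[of g C p]; use C sp in simp)+
    have s1: "square_integrable (\<lambda>x. g x * p x - q x)" by (rule square_integrable_diff[OF sgp sq])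
    have sfq: "square_integrable (\<lambda>x. f x * q x)"
      by (rule bounded_mult_square_integrable[of f B q]; use B sq in simp)
    have s2: "square_integrable (\<lambda>x. f x * q x - r x)" by (rule square_integrable_diff[OF sfq sr])
    have s3: "square_integrable (\<lambda>x. f x * (g x * p x - q x))"
      and n3: "sq_norm (\<lambda>x. f x * (g x * p x - q x)) \<le> B\<^sup>2 * sq_norm (\<lambda>x. g x * p x - q x)"
      by (rule bounded_mult_square_integrable[of f B "\<lambda>x. g x * p x - q x"]; use B s1 in simp)+
    have "sq_norm (\<lambda>x. g x * p x - (g x * p x - q x)) \<le> 2 * sq_norm (\<lambda>x. g x * p x) + 2 * sq_norm (\<lambda>x. g x * p x - q x)"
      by (rule square_integrable_diff[OF sgp s1])
    also have "\<dots> \<le> 2 * (C\<^sup>2 * sq_norm p) + 2 * (v * sq_norm p)"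
      using ngp q(2) by simp
    also have "\<dots> \<le> (2 * C\<^sup>2 + 2) * sq_norm p"
      using mult_right_mono[of v 1 "sq_norm p"] sq_norm_nonneg[of p] by (simp add: v_def algebra_simps)
    finally have nq: "sq_norm q \<le> (2 * C\<^sup>2 + 2) * sq_norm p" by simp
    have "u * sq_norm q \<le> u * ((2 * C\<^sup>2 + 2) * sq_norm p)"
      using nq u by (intro mult_left_mono) auto
    also have "\<dots> = e / 2 * sq_norm p"
    proof -
      have "u * (2 * C\<^sup>2 + 2) = e / 2" unfolding u_def using pos by (simp add: field_simps)
      then show ?thesis by (metis mult.assoc)
    qed
    finally have n4: "u * sq_norm q \<le> e / 2 * sq_norm p" .
    have "2 * B\<^sup>2 * sq_norm (\<lambda>x. g x * p x - q x) \<le> 2 * B\<^sup>2 * (v * sq_norm p)"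
      using q(2) by (intro mult_left_mono) auto
    also have "\<dots> = (2 * B\<^sup>2 * v) * sq_norm p" by simp
    also have "\<dots> \<le> e / 2 * sq_norm p"
    proof (rule mult_right_mono[OF _ sq_norm_nonneg])
      have "2 * B\<^sup>2 * v \<le> 2 * B\<^sup>2 * (e / (4 * B\<^sup>2))" by (intro mult_left_mono) (auto simp: v_def)
      also have "\<dots> = e / 2" using B0 by (simp add: field_simps)
      finally show "2 * B\<^sup>2 * v \<le> e / 2" .
    qed
    finally have n5: "2 * B\<^sup>2 * sq_norm (\<lambda>x. g x * p x - q x) \<le> e / 2 * sq_norm p" .
    have "sq_norm (\<lambda>x. f x * (g x * p x - q x) + (f x * q x - r x)) \<le> e * sq_norm p"
      using square_integrable_add(2)[OF s3 s2] n3 r(2) n4 n5 by linarith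
    also have "(\<lambda>x. f x * (g x * p x - q x) + (f x * q x - r x)) = (\<lambda>x. f x * g x * p x - r x)"
      by (simp add: algebra_simps)
    finally show "\<exists>q\<in>hom_polys (nat (int d + (a + b))). sq_norm (\<lambda>x. f x * g x * p x - q x) \<le> e * sq_norm p"
      using r(1) by blast
  qed
qed

text \<open>
  Closeness at the origin is not demanded: in positive degree the polynomials vanish there. This matters
  for functions of \<open>sgn x\<close>, which are only controlled on the sphere.
\<close>
lemma asymptotically_toeplitz_limit:
  fixes f :: "complex^'k \<Rightarrow> complex"
  assumes f [measurable]: "f \<in> borel_measurable borel" and B: "\<And>x. cmod (f x) \<le> B"
    and approx: "\<And>e. e > 0 \<Longrightarrow> \<exists>g. asymptotically_toeplitz a g \<and> (\<forall>x. x \<noteq> 0 \<longrightarrow> cmod (f x - g x) \<le> e)"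
  shows "asymptotically_toeplitz a f"
  unfolding asymptotically_toeplitz_def
proof (intro conjI allI impI)
  show "\<exists>B. \<forall>x. cmod (f x) \<le> B" using B by blast
  fix e :: real assume e: "e > 0"
  define u where "u = sqrt (e / 4)"
  have u: "u > 0" "u\<^sup>2 = e / 4" using e by (auto simp: u_def)
  obtain g where g: "asymptotically_toeplitz a g" and fg: "\<And>x. x \<noteq> 0 \<Longrightarrow> cmod (f x - g x) \<le> u"
    using approx[OF u(1)] by blast
  note [measurable] = g[unfolded asymptotically_toeplitz_def, THEN conjunct1]
  obtain C where C: "\<And>x. cmod (g x) \<le> C" using asymptotically_toeplitz_bound[OF g] by blast
  have e4: "e / 4 > 0" using e by simp
  obtain K where K: "\<forall>d\<ge>K. \<forall>p\<in>hom_polys d. \<exists>q\<in>hom_polys (nat (int d + a)). sq_norm (\<lambda>x. g x * p x - q x) \<le> e/4 * sq_norm p"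
    using asymptotically_toeplitzD[OF g e4] by (elim exE)
  show "\<exists>K. \<forall>d\<ge>K. \<forall>p\<in>hom_polys d. \<exists>q\<in>hom_polys (nat (int d + a)). sq_norm (\<lambda>x. f x * p x - q x) \<le> e * sq_norm p"
  proof (intro exI[of _ "max 1 K"] allI impI ballI)
    fix d and p :: "complex^'k \<Rightarrow> complex" assume d: "max 1 K \<le> d" and p: "p \<in> hom_polys d"
    obtain q where q: "q \<in> hom_polys (nat (int d + a))" "sq_norm (\<lambda>x. g x * p x - q x) \<le> e/4 * sq_norm p"
      using K[rule_format, OF _ p] d by (meson max.bounded_iff)
    note sp = hom_polys_square_integrable[OF p]
    note [measurable] = square_integrable_measurable[OF sp]
    have p0: "p 0 = 0" by (rule hom_polys_at_zero[OF p]) (use d in simp)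
    have le: "cmod ((f x - g x) * p x) \<le> u * cmod (p x)" for x
      using fg[of x] p0 by (cases "x = 0") (auto simp: norm_mult intro: mult_right_mono)
    have m: "(\<lambda>x. (f x - g x) * p x) \<in> borel_measurable borel" by measurable
    note s1 = square_integrable_dominated[OF sp m le]
    have sgp: "square_integrable (\<lambda>x. g x * p x)"
      by (rule bounded_mult_square_integrable[of g C p]; use C sp in simp)
    have s2: "square_integrable (\<lambda>x. g x * p x - q x)"
      by (rule square_integrable_diff[OF sgp hom_polys_square_integrable[OF q(1)]])
    have "sq_norm (\<lambda>x. (f x - g x) * p x + (g x * p x - q x)) \<le> e * sq_norm p"
      using square_integrable_add(2)[OF s1(1) s2] s1(2) q(2) unfolding u(2) by linarith
    also have "(\<lambda>x. (f x - g x) * p x + (g x * p x - q x)) = (\<lambda>x. f x * p x - q x)"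
      by (simp add: algebra_simps)
    finally show "\<exists>q\<in>hom_polys (nat (int d + a)). sq_norm (\<lambda>x. f x * p x - q x) \<le> e * sq_norm p"
      using q(1) by blast
  qed
qed fact

lemma borel_measurable_vec_coordinate [measurable]:
  "(\<lambda>x :: complex^'k. x $ j) \<in> borel_measurable borel"
  by (intro borel_measurable_continuous_onI continuous_intros)

lemma borel_measurable_sgn_coordinate [measurable]:
  "(\<lambda>x :: complex^'k. sgn x $ j) \<in> borel_measurable borel"
proof (rule borel_measurable_continuous_countable_exceptions[of "{0}"])
  show "continuous_on (- {0}) (\<lambda>x :: complex^'k. sgn x $ j)"
    by (intro continuous_on_component continuous_on_sgn continuous_on_id) auto
qed auto

lemma norm_sgn_coordinate_le: "cmod (sgn x $ j) \<le> 1"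
  by (rule order_trans[OF Finite_Cartesian_Product.norm_nth_le]) (simp add: norm_sgn)

lemma sgn_coordinate_error:
  fixes x :: "complex^'k" and d :: nat
  assumes "d > 0"
  shows "cmod (sgn x $ j - x $ j / sqrt d) \<le> \<bar>1 - (norm x)\<^sup>2 / d\<bar>"
proof (cases "x = 0")
  case False
  define t where "t = norm x / sqrt d"
  have t: "t \<ge> 0" "t\<^sup>2 = (norm x)\<^sup>2 / d" using assms by (auto simp: t_def power_divide)
  have "x $ j = complex_of_real (norm x) * sgn x $ j"
    using False by (simp add: sgn_div_norm scaleR_conv_of_real[symmetric])
  then have "sgn x $ j - x $ j / sqrt d = complex_of_real (1 - t) * (sgn x $ j)"
    unfolding t_def by (simp add: algebra_simps)
  then have "cmod (sgn x $ j - x $ j / sqrt d) = \<bar>1 - t\<bar> * cmod (sgn x $ j)"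
    by (simp only: norm_mult norm_of_real)
  also have "\<dots> \<le> \<bar>1 - t\<bar> * 1" by (intro mult_left_mono norm_sgn_coordinate_le) auto
  also have "\<dots> \<le> \<bar>1 - t\<bar> * \<bar>1 + t\<bar>" using t(1) by (intro mult_left_mono) auto
  also have "\<dots> = \<bar>1 - (norm x)\<^sup>2 / d\<bar>"
    unfolding abs_mult[symmetric] t(2)[symmetric] by (simp add: power2_eq_square algebra_simps)
  finally show ?thesis .
qed simp

lemma asymptotically_toeplitz_of_rate:
  fixes f :: "complex^'k \<Rightarrow> complex"
  assumes "f \<in> borel_measurable borel" "\<And>x. cmod (f x) \<le> B" "C \<ge> 0"
    and rate: "\<And>d p. d > 0 \<Longrightarrow> p \<in> hom_polys d \<Longrightarrow>
      \<exists>q\<in>hom_polys (nat (int d + a)). sq_norm (\<lambda>x. f x * p x - q x) \<le> C / real d * sq_norm p"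
  shows "asymptotically_toeplitz a f"
  unfolding asymptotically_toeplitz_def
proof (intro conjI allI impI)
  show "\<exists>B. \<forall>x. cmod (f x) \<le> B" using assms(2) by blast
  fix e :: real assume e: "e > 0"
  obtain K :: nat where K: "C / e < K" using reals_Archimedean2 by blast
  show "\<exists>K. \<forall>d\<ge>K. \<forall>p\<in>hom_polys d. \<exists>q\<in>hom_polys (nat (int d + a)). sq_norm (\<lambda>x. f x * p x - q x) \<le> e * sq_norm p"
  proof (intro exI[of _ "max 1 K"] allI impI ballI)
    fix d and p :: "complex^'k \<Rightarrow> complex" assume d: "max 1 K \<le> d" and p: "p \<in> hom_polys d"
    have "d > 0" using d by simp
    have "C / e \<le> d" using K d by linarith
    then have "C / d \<le> e" using d e by (simp add: field_simps)
    then have "C / d * sq_norm p \<le> e * sq_norm p" by (intro mult_right_mono sq_norm_nonneg)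
    then show "\<exists>q\<in>hom_polys (nat (int d + a)). sq_norm (\<lambda>x. f x * p x - q x) \<le> e * sq_norm p"
      using rate[OF \<open>d > 0\<close> p] by (meson order_trans)
  qed
qed fact

text \<open>
  A common form for a coordinate and its conjugate: \<open>h\<close> is the identity or the conjugation.
\<close>
lemma sgn_coordinate_replacement:
  fixes p :: "complex^'k \<Rightarrow> complex"
  assumes p: "p \<in> hom_polys d" and d: "d > 0" and h: "\<And>z. cmod (h z) = cmod z"
    "\<And>y z. h y - h z = h (y - z)" "continuous_on UNIV h"
  shows "square_integrable (\<lambda>x. (h (sgn x $ j) - h (x $ j / sqrt d)) * p x)"
    and "sq_norm (\<lambda>x. (h (sgn x $ j) - h (x $ j / sqrt d)) * p x)
        \<le> (1 + CARD('k) + (real CARD('k))\<^sup>2) / d * sq_norm p"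
proof -
  note conc = norm_sq_concentration[OF p d]
  note [measurable] = square_integrable_measurable[OF hom_polys_square_integrable[OF p]]
    borel_measurable_continuous_onI[OF h(3)]
  have le: "cmod ((h (sgn x $ j) - h (x $ j / sqrt d)) * p x) \<le> 1 * cmod (complex_of_real (1 - (norm x)\<^sup>2 / d) * p x)" for x
    using mult_right_mono[OF sgn_coordinate_error[OF d, of x j], of "cmod (p x)"]
    unfolding norm_mult h(2) h(1) norm_of_real mult_1 by simp
  have m: "(\<lambda>x. (h (sgn x $ j) - h (x $ j / sqrt d)) * p x) \<in> borel_measurable borel" by measurable
  note dom = square_integrable_dominated[OF conc(1) m le]
  show "square_integrable (\<lambda>x. (h (sgn x $ j) - h (x $ j / sqrt d)) * p x)" by (rule dom)
  show "sq_norm (\<lambda>x. (h (sgn x $ j) - h (x $ j / sqrt d)) * p x)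
        \<le> (1 + CARD('k) + (real CARD('k))\<^sup>2) / d * sq_norm p"
    using dom(2) conc(2) by simp
qed

lemma asymptotically_toeplitz_coordinate: "asymptotically_toeplitz 1 (\<lambda>x :: complex^'k. sgn x $ j)"
proof (rule asymptotically_toeplitz_of_rate[OF _ norm_sgn_coordinate_le, where C = "1 + CARD('k) + (real CARD('k))\<^sup>2"])
  fix d and p :: "complex^'k \<Rightarrow> complex" assume d: "d > 0" and p: "p \<in> hom_polys d"
  define q where "q = (\<lambda>x. complex_of_real (1 / sqrt d) * (x $ j * p x))"
  have q: "q \<in> hom_polys (nat (int d + 1))"
    using hom_polys_scale[OF hom_polys_coordinate_mult[OF p]] unfolding q_def by (simp add: nat_add_distrib del: of_real_divide)
  have "(\<lambda>x. sgn x $ j * p x - q x) = (\<lambda>x. (sgn x $ j - x $ j / sqrt d) * p x)"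
    unfolding q_def by (simp add: algebra_simps)
  with sgn_coordinate_replacement(2)[OF p d, of "\<lambda>z. z" j] q
  show "\<exists>q\<in>hom_polys (nat (int d + 1)). sq_norm (\<lambda>x. sgn x $ j * p x - q x) \<le> (1 + CARD('k) + (real CARD('k))\<^sup>2) / d * sq_norm p"
    by (intro bexI[of _ q]) auto
qed (auto intro: add_nonneg_nonneg)

lemma asymptotically_toeplitz_conj_coordinate: "asymptotically_toeplitz (- 1) (\<lambda>x :: complex^'k. cnj (sgn x $ j))"
proof (rule asymptotically_toeplitz_of_rate[where B = 1 and C = "2 * (1 + CARD('k) + (real CARD('k))\<^sup>2) + 2"])
  let ?N = "1 + CARD('k) + (real CARD('k))\<^sup>2"
  show "cmod (cnj (sgn x $ j)) \<le> 1" for x :: "complex^'k" using norm_sgn_coordinate_le by simp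
  fix d and p :: "complex^'k \<Rightarrow> complex" assume d: "d > 0" and p: "p \<in> hom_polys d"
  obtain r where r: "r \<in> hom_polys (d - 1)" and nr: "sq_norm (\<lambda>x. cnj (x $ j) * p x - r x) = sq_norm p"
    and sr: "square_integrable (\<lambda>x. cnj (x $ j) * p x - r x)"
    using conj_coordinate_approx_derivative[OF p] by blast
  define q where "q = (\<lambda>x. complex_of_real (1 / sqrt d) * r x)"
  have q: "q \<in> hom_polys (nat (int d + - 1))"
    using hom_polys_scale[OF r] d unfolding q_def by (simp add: nat_diff_distrib del: of_real_divide)
  let ?F = "\<lambda>x. (cnj (sgn x $ j) - cnj (x $ j / sqrt d)) * p x"
  let ?G = "\<lambda>x. complex_of_real (1 / sqrt d) * (cnj (x $ j) * p x - r x)"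
  have "square_integrable ?F" "sq_norm ?F \<le> ?N / d * sq_norm p"
    by (rule sgn_coordinate_replacement[OF p d]; auto intro: continuous_intros)+
  moreover have "square_integrable ?G" "sq_norm ?G = 1 / d * sq_norm p"
    using square_integrable_scale[OF sr, of "complex_of_real (1 / sqrt d)"] d
    by (simp_all add: nr norm_divide power_divide)
  ultimately have "sq_norm (\<lambda>x. ?F x + ?G x) \<le> 2 * (?N / d * sq_norm p) + 2 * (1 / d * sq_norm p)"
    using square_integrable_add(2)[of ?F ?G] by linarith
  also have "\<dots> = (2 * ?N + 2) / d * sq_norm p" by (simp add: add_divide_distrib distrib_right)
  also have "(\<lambda>x. ?F x + ?G x) = (\<lambda>x. cnj (sgn x $ j) * p x - q x)"
    unfolding q_def by (simp add: algebra_simps)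
  finally show "\<exists>q\<in>hom_polys (nat (int d + - 1)). sq_norm (\<lambda>x. cnj (sgn x $ j) * p x - q x) \<le> (2 * ?N + 2) / d * sq_norm p"
    using q by blast
qed (auto intro: add_nonneg_nonneg)

section \<open>Functions of a given weight under scalar rotation\<close>

text \<open>
  Polynomials in the coordinates and their conjugates that are multiplied by the \<open>a\<close>-th power of \<open>z\<close>
  when their argument is multiplied by \<open>z\<close> of modulus one.
\<close>
inductive weighted_poly :: "int \<Rightarrow> (complex^'k \<Rightarrow> complex) \<Rightarrow> bool"
  where
    zero: "weighted_poly a (\<lambda>x. 0)"
  | const: "weighted_poly 0 (\<lambda>x. c)"
  | coordinate: "weighted_poly 1 (\<lambda>x. x $ j)"
  | conj_coordinate: "weighted_poly (- 1) (\<lambda>x. cnj (x $ j))"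
  | add: "weighted_poly a f \<Longrightarrow> weighted_poly a g \<Longrightarrow> weighted_poly a (\<lambda>x. f x + g x)"
  | mult: "weighted_poly a f \<Longrightarrow> weighted_poly b g \<Longrightarrow> weighted_poly (a + b) (\<lambda>x. f x * g x)"

lemma weighted_poly_rotate:
  assumes "weighted_poly a f" "cmod z = 1"
  shows "f (z *s x) = z powi a * f x"
  using assms(1)
proof induction
  case (conj_coordinate j)
  have "z * cnj z = 1" using assms(2) by (simp add: complex_norm_square[symmetric])
  then have "cnj z = inverse z" by (metis inverse_unique)
  then show ?case by simp
next
  case (mult a f b g)
  have "z \<noteq> 0" using assms(2) by auto
  then show ?case using mult by (simp add: power_int_add)
qed (auto simp: algebra_simps)

lemma weighted_poly_asymptotically_toeplitz:
  "weighted_poly a f \<Longrightarrow> asymptotically_toeplitz a (\<lambda>x. f (sgn x))"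
  by (induction rule: weighted_poly.induct)
    (intro asymptotically_toeplitz_zero asymptotically_toeplitz_const asymptotically_toeplitz_coordinate
      asymptotically_toeplitz_conj_coordinate asymptotically_toeplitz_add asymptotically_toeplitz_mult; assumption)+

lemma weighted_poly_sum:
  "finite I \<Longrightarrow> (\<And>i. i \<in> I \<Longrightarrow> weighted_poly a (f i)) \<Longrightarrow> weighted_poly a (\<lambda>x. \<Sum>i\<in>I. f i x)"
  by (induction I rule: finite_induct) (auto intro: weighted_poly.zero weighted_poly.add)

text \<open>
  A finite decomposition of \<open>h\<close> into weights, indexed by all integers so that sums and products of
  decompositions are given by the usual formulas for Laurent polynomials.
\<close>
definition weight_components :: "int set \<Rightarrow> (int \<Rightarrow> complex^'k \<Rightarrow> complex) \<Rightarrow> (complex^'k \<Rightarrow> complex) \<Rightarrow> bool"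
  where "weight_components A F h \<longleftrightarrow> finite A \<and> (\<forall>a. weighted_poly a (F a)) \<and>
    (\<forall>a. a \<notin> A \<longrightarrow> F a = (\<lambda>x. 0)) \<and> (\<forall>x. h x = (\<Sum>a\<in>A. F a x))"

lemma weight_components_weighted_poly:
  assumes "weighted_poly a f"
  shows "weight_components {a} (\<lambda>b. if b = a then f else (\<lambda>x. 0)) f"
  using assms weighted_poly.zero by (auto simp: weight_components_def)

lemma weight_components_superset:
  assumes "weight_components A F h" "A \<subseteq> B" "finite B"
  shows "h x = (\<Sum>a\<in>B. F a x)"
proof -
  have "(\<Sum>a\<in>A. F a x) = (\<Sum>a\<in>B. F a x)"
    using assms by (intro sum.mono_neutral_left) (auto simp: weight_components_def)
  then show ?thesis using assms(1) by (simp add: weight_components_def)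
qed

lemma weight_components_add:
  assumes "weight_components A F h" "weight_components B G k"
  shows "weight_components (A \<union> B) (\<lambda>a x. F a x + G a x) (\<lambda>x. h x + k x)"
proof -
  have fin: "finite (A \<union> B)" using assms by (auto simp: weight_components_def)
  have "h x + k x = (\<Sum>a\<in>A \<union> B. F a x + G a x)" for x
    using weight_components_superset[OF assms(1) _ fin] weight_components_superset[OF assms(2) _ fin]
    by (simp add: sum.distrib)
  then show ?thesis
    using assms fin unfolding weight_components_def by (auto intro: weighted_poly.add)
qed

lemma weight_components_mult:
  assumes F: "weight_components A F h" and G: "weight_components B G k"
  shows "weight_components ((\<lambda>(a, b). a + b) ` (A \<times> B)) (\<lambda>c x. \<Sum>a\<in>A. F a x * G (c - a) x) (\<lambda>x. h x * k x)"
proof -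
  let ?C = "(\<lambda>(a, b). a + b) ` (A \<times> B)"
  have fin: "finite A" "finite B" "finite ?C" using F G by (auto simp: weight_components_def)
  have wp: "weighted_poly c (\<lambda>x. \<Sum>a\<in>A. F a x * G (c - a) x)" for c
  proof (rule weighted_poly_sum[OF fin(1)])
    fix a
    have "weighted_poly (a + (c - a)) (\<lambda>x. F a x * G (c - a) x)"
      using F G by (intro weighted_poly.mult) (auto simp: weight_components_def)
    then show "weighted_poly c (\<lambda>x. F a x * G (c - a) x)" by simp
  qed
  have out: "(\<lambda>x. \<Sum>a\<in>A. F a x * G (c - a) x) = (\<lambda>x. 0)" if c: "c \<notin> ?C" for c
  proof -
    have "c - a \<notin> B" if "a \<in> A" for a
    proof
      assume "c - a \<in> B"
      then have "(\<lambda>(a, b). a + b) (a, c - a) \<in> ?C" using that by blast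
      with c show False by simp
    qed
    then have "G (c - a) = (\<lambda>x. 0)" if "a \<in> A" for a
      using G that by (simp add: weight_components_def)
    then show ?thesis by (auto intro!: sum.neutral)
  qed
  have val: "h x * k x = (\<Sum>c\<in>?C. \<Sum>a\<in>A. F a x * G (c - a) x)" for x
  proof -
    have "(\<Sum>c\<in>?C. G (c - a) x) = k x" if a: "a \<in> A" for a
    proof -
      have "(\<Sum>c\<in>?C. G (c - a) x) = (\<Sum>b\<in>(\<lambda>c. c - a) ` ?C. G b x)"
        by (subst sum.reindex) (auto simp: inj_on_def)
      moreover have "B \<subseteq> (\<lambda>c. c - a) ` ?C"
      proof
        fix b assume "b \<in> B"
        then have "a + b \<in> ?C" using a by force
        then show "b \<in> (\<lambda>c. c - a) ` ?C" by (intro image_eqI[of _ _ "a + b"]) auto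
      qed
      ultimately show ?thesis
        using weight_components_superset[OF G, of "(\<lambda>c. c - a) ` ?C" x] fin by simp
    qed
    then have "(\<Sum>a\<in>A. F a x * (\<Sum>c\<in>?C. G (c - a) x)) = (\<Sum>a\<in>A. F a x * k x)"
      by simp
    also have "\<dots> = h x * k x"
      using F by (simp add: weight_components_def sum_distrib_right)
    finally show ?thesis
      by (simp add: sum_distrib_left sum.swap[of _ ?C A])
  qed
  show ?thesis unfolding weight_components_def using fin wp out val by blast
qed

lemma weight_components_sum:
  "finite I \<Longrightarrow> (\<And>i. i \<in> I \<Longrightarrow> \<exists>A F. weight_components A F (h i)) \<Longrightarrow>
    \<exists>A F. weight_components A F (\<lambda>x. \<Sum>i\<in>I. h i x)"
proof (induction I rule: finite_induct)
  case empty
  then show ?case using weight_components_weighted_poly[OF weighted_poly.zero[of 0]] by auto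
next
  case (insert i I)
  then obtain A F B G where "weight_components A F (h i)" "weight_components B G (\<lambda>x. \<Sum>i\<in>I. h i x)"
    by (metis insertCI)
  from weight_components_add[OF this] insert(1,2) show ?case by auto
qed

text \<open>
  The only case with content is a real-linear function: expressed through real and imaginary parts of
  the coordinates it is a combination of coordinates, of weight one, and of their conjugates, of weight
  minus one.
\<close>
lemma real_polynomial_function_weight_components:
  fixes p :: "complex^'k \<Rightarrow> real"
  assumes "real_polynomial_function p"
  shows "\<exists>A F. weight_components A F (\<lambda>x. complex_of_real (p x))"
  using assms
proof induction
  case (linear f)
  interpret bounded_linear f by fact
  have expand: "complex_of_real (f x) = (\<Sum>j\<in>UNIV.
      complex_of_real (f (axis j 1)) / 2 * (x $ j) + complex_of_real (f (axis j 1)) / 2 * cnj (x $ j)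
      + (complex_of_real (f (axis j \<i>)) / (2 * \<i>) * (x $ j) + - (complex_of_real (f (axis j \<i>)) / (2 * \<i>)) * cnj (x $ j)))" for x
  proof -
    have "x = (\<Sum>j\<in>UNIV. Re (x $ j) *\<^sub>R axis j 1 + Im (x $ j) *\<^sub>R axis j \<i>)"
    proof (intro vec_eq_iff[THEN iffD2] allI)
      fix i
      have "(\<Sum>j\<in>UNIV. Re (x $ j) *\<^sub>R axis j 1 + Im (x $ j) *\<^sub>R axis j \<i>) $ i
          = (\<Sum>j\<in>UNIV. if j = i then complex_of_real (Re (x $ j)) + \<i> * complex_of_real (Im (x $ j)) else 0)"
        unfolding sum_component
        by (intro sum.cong) (auto simp: axis_def complex_eq_iff)
      then show "x $ i = (\<Sum>j\<in>UNIV. Re (x $ j) *\<^sub>R axis j 1 + Im (x $ j) *\<^sub>R axis j \<i>) $ i"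
        by (simp add: complex_eq[symmetric])
    qed
    then have "f x = f (\<Sum>j\<in>UNIV. Re (x $ j) *\<^sub>R axis j 1 + Im (x $ j) *\<^sub>R axis j \<i>)" by simp
    also have "\<dots> = (\<Sum>j\<in>UNIV. Re (x $ j) * f (axis j 1) + Im (x $ j) * f (axis j \<i>))"
      by (simp add: sum add scaleR)
    finally have "complex_of_real (f x) = (\<Sum>j\<in>UNIV. complex_of_real (Re (x $ j)) * complex_of_real (f (axis j 1))
        + complex_of_real (Im (x $ j)) * complex_of_real (f (axis j \<i>)))" by simp
    also have "\<dots> = (\<Sum>j\<in>UNIV.
      complex_of_real (f (axis j 1)) / 2 * (x $ j) + complex_of_real (f (axis j 1)) / 2 * cnj (x $ j)
      + (complex_of_real (f (axis j \<i>)) / (2 * \<i>) * (x $ j) + - (complex_of_real (f (axis j \<i>)) / (2 * \<i>)) * cnj (x $ j)))"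
      by (intro sum.cong refl) (simp add: complex_eq_iff)
    finally show ?thesis .
  qed
  have c: "\<exists>A F. weight_components A F (\<lambda>x :: complex^'k. c * (x $ j))" for c j
    using weight_components_mult[OF weight_components_weighted_poly[OF weighted_poly.const]
      weight_components_weighted_poly[OF weighted_poly.coordinate]] by blast
  have cc: "\<exists>A F. weight_components A F (\<lambda>x :: complex^'k. c * cnj (x $ j))" for c j
    using weight_components_mult[OF weight_components_weighted_poly[OF weighted_poly.const]
      weight_components_weighted_poly[OF weighted_poly.conj_coordinate]] by blast
  have s: "\<exists>A F. weight_components A F (\<lambda>x. h x + k x)"
    if "\<exists>A F. weight_components A F h" "\<exists>A F. weight_components A F k" for h k :: "complex^'k \<Rightarrow> complex"
    using that by (elim exE) (intro exI, rule weight_components_add)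
  have "\<exists>A F. weight_components A F (\<lambda>x. \<Sum>j\<in>UNIV.
      complex_of_real (f (axis j 1)) / 2 * (x $ j) + complex_of_real (f (axis j 1)) / 2 * cnj (x $ j)
      + (complex_of_real (f (axis j \<i>)) / (2 * \<i>) * (x $ j) + - (complex_of_real (f (axis j \<i>)) / (2 * \<i>)) * cnj (x $ j)))"
    by (intro weight_components_sum[OF finite] s c cc)
  then show ?case by (subst ext[OF expand])
next
  case (const c)
  show ?case by (intro exI) (rule weight_components_weighted_poly[OF weighted_poly.const])
next
  case (add f g)
  then show ?case
    unfolding of_real_add by (elim exE) (intro exI, rule weight_components_add)
next
  case (mult f g)
  then show ?case
    unfolding of_real_mult by (elim exE) (intro exI, rule weight_components_mult)
qed

lemma sum_roots_of_unity_power: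
  fixes c :: int and N :: nat
  assumes "\<bar>c\<bar> < int N"
  shows "(\<Sum>l<N. cis (2 * pi * real l / real N) powi c) = (if c = 0 then of_nat N else 0)"
proof (cases "c = 0")
  case False
  have N: "N > 0" using assms by auto
  define r where "r = cis (2 * pi * c / N)"
  have pow: "cis (2 * pi * real l / real N) powi c = r ^ l" for l
    unfolding r_def by (simp add: cis_power_int Complex.DeMoivre mult_ac)
  have "r ^ N = cis (2 * pi * c)"
    unfolding r_def using N by (simp add: Complex.DeMoivre)
  also have "\<dots> = 1" by (simp add: cis_multiple_2pi)
  finally have rN: "r ^ N = 1" .
  have "r \<noteq> 1"
  proof
    assume "r = 1"
    then have "cos (2 * pi * c / N) = 1" unfolding r_def by (simp add: complex_eq_iff)
    then obtain n :: int where "2 * pi * c / N = real_of_int n * 2 * pi" using cos_one_2pi_int by blast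
    then have "real_of_int c = n * N" using N by (simp add: field_simps)
    then have "c = n * int N" by (metis of_int_eq_iff of_int_mult of_int_of_nat_eq)
    then have "int N dvd c" by simp
    then have "int N \<le> \<bar>c\<bar>" using dvd_imp_le_int[OF False, of "int N"] by simp
    then show False using assms by simp
  qed
  then show ?thesis unfolding pow using geometric_sum[of r N] rN False by simp
qed simp

text \<open>
  The weight \<open>a\<close> component of \<open>h\<close> is the average of the functions \<open>x \<mapsto> z\<^bsup>-a\<^esup> h (z x)\<close> over the circle, an
  averaging that fixes \<open>f\<close> and does not increase the supremum norm. Roots of unity of an order
  larger than all differences of weights do the same with a finite sum.
\<close>
lemma weight_component_close:
  fixes f :: "complex^'k \<Rightarrow> complex"
  assumes F: "weight_components A F h"
    and f: "\<And>x z. norm x = 1 \<Longrightarrow> cmod z = 1 \<Longrightarrow> f (z *s x) = z powi a * f x"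
    and close: "\<And>x. norm x = 1 \<Longrightarrow> cmod (f x - h x) \<le> e"
    and x: "norm x = 1"
  shows "cmod (f x - F a x) \<le> e"
proof -
  have fin: "finite (insert a A)" using F by (simp add: weight_components_def)
  define N where "N = Suc (nat (\<Sum>b\<in>A. \<bar>b - a\<bar>))"
  have small: "\<bar>b - a\<bar> < int N" if "b \<in> insert a A" for b
  proof (cases "b = a")
    case False
    then have "\<bar>b - a\<bar> \<le> (\<Sum>b\<in>A. \<bar>b - a\<bar>)" using that fin by (intro member_le_sum) auto
    then show ?thesis unfolding N_def by linarith
  qed (simp add: N_def add_pos_nonneg sum_nonneg)
  define z where "z = (\<lambda>l. cis (2 * pi * real l / real N))"
  have z: "cmod (z l) = 1" "z l \<noteq> 0" for l by (auto simp: z_def)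
  have zx: "norm (z l *s x) = 1" for l
  proof -
    have "(norm (z l *s x))\<^sup>2 = (norm x)\<^sup>2" unfolding norm_vec_sq by (simp add: norm_mult z)
    then show ?thesis using x by (simp add: power2_eq_1_iff) (metis norm_ge_zero not_one_le_zero neg_0_le_iff_le)
  qed
  have "(\<Sum>l<N. z l powi (- a) * h (z l *s x)) = (\<Sum>l<N. \<Sum>b\<in>insert a A. z l powi (b - a) * F b x)"
  proof (intro sum.cong refl)
    fix l
    have "h (z l *s x) = (\<Sum>b\<in>insert a A. z l powi b * F b x)"
      using weight_components_superset[OF F _ fin, of "z l *s x"] F z
      by (subst weight_components_superset[OF F _ fin])
        (auto simp: weight_components_def weighted_poly_rotate intro!: sum.cong)
    then show "z l powi (- a) * h (z l *s x) = (\<Sum>b\<in>insert a A. z l powi (b - a) * F b x)"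
      using z by (simp only: sum_distrib_left mult.assoc[symmetric] power_int_add[symmetric, OF disjI1[OF z(2)]]) simp
  qed
  also have "\<dots> = (\<Sum>b\<in>insert a A. (\<Sum>l<N. z l powi (b - a)) * F b x)"
    by (subst sum.swap) (simp add: sum_distrib_right)
  also have "\<dots> = (\<Sum>b\<in>insert a A. (if b = a then of_nat N else 0) * F b x)"
    unfolding z_def using small by (intro sum.cong refl arg_cong2[where f = "(*)"]) (simp add: sum_roots_of_unity_power)
  also have "\<dots> = of_nat N * F a x"
    using fin by (simp add: if_distrib[of "\<lambda>c. c * _"] cong: if_cong)
  finally have avg: "of_nat N * F a x = (\<Sum>l<N. z l powi (- a) * h (z l *s x))" by simp
  have "z l powi (- a) * f (z l *s x) = f x" for l
    unfolding f[OF x z(1)] power_int_minus using z(2) by simp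
  then have "of_nat N * f x = (\<Sum>l<N. z l powi (- a) * f (z l *s x))" by simp
  with avg have "of_nat N * (f x - F a x) = (\<Sum>l<N. z l powi (- a) * (f (z l *s x) - h (z l *s x)))"
    by (simp only: sum_subtractf right_diff_distrib)
  then have "cmod (of_nat N * (f x - F a x)) \<le> (\<Sum>l<N. cmod (z l powi (- a) * (f (z l *s x) - h (z l *s x))))"
    by (simp only: norm_sum)
  also have "\<dots> \<le> (\<Sum>l<N. e)"
    using close[OF zx] by (intro sum_mono) (simp add: norm_mult norm_power_int z)
  finally have "real N * cmod (f x - F a x) \<le> real N * e" by (simp add: norm_mult)
  moreover have "N > 0" by (simp add: N_def)
  ultimately show ?thesis by simp
qed

text \<open>
  By Stone-Weierstrass \<open>f\<close> is a uniform limit of polynomials in the coordinates and their conjugates on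
  the sphere, and by averaging these may be taken of weight \<open>a\<close>.
\<close>
theorem continuous_weight_asymptotically_toeplitz:
  fixes f :: "complex^'k \<Rightarrow> complex"
  assumes cont: "continuous_on (sphere 0 1) f"
    and f: "\<And>x z. norm x = 1 \<Longrightarrow> cmod z = 1 \<Longrightarrow> f (z *s x) = z powi a * f x"
  shows "asymptotically_toeplitz a (\<lambda>x. f (sgn x))"
proof -
  have "compact (f ` sphere 0 1)" by (intro compact_continuous_image cont) simp
  then have "bounded (f ` sphere 0 1)" by (rule compact_imp_bounded)
  then obtain B where "\<forall>y\<in>f ` sphere 0 1. cmod y \<le> B"
    unfolding bounded_iff by (elim exE)
  then have B: "cmod (f x) \<le> B" if "norm x = 1" for x
    using that by simp
  show ?thesis
  proof (rule asymptotically_toeplitz_limit[where B = "max B (cmod (f 0))"])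
    show "(\<lambda>x. f (sgn x)) \<in> borel_measurable borel"
    proof (rule borel_measurable_continuous_countable_exceptions[of "{0}"])
      show "continuous_on (- {0}) (\<lambda>x. f (sgn x))"
        by (rule continuous_on_compose2[OF cont]) (auto intro!: continuous_intros simp: norm_sgn split: if_splits)
    qed auto
    show "cmod (f (sgn x)) \<le> max B (cmod (f 0))" for x
      using B[of "sgn x"] by (cases "x = 0") (auto simp: norm_sgn)
    fix e :: real assume e: "e > 0"
    have "continuous_on (sphere 0 1) (\<lambda>x. Re (f x))" "continuous_on (sphere 0 1) (\<lambda>x. Im (f x))"
      by (intro continuous_intros cont)+
    note parts = this and e2 = half_gt_zero[OF e]
    obtain p where p: "real_polynomial_function p" "\<And>x. x \<in> sphere 0 1 \<Longrightarrow> \<bar>Re (f x) - p x\<bar> < e/2"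
      by (rule Stone_Weierstrass_real_polynomial_function[OF compact_sphere parts(1) e2]) (rule that)
    obtain q where q: "real_polynomial_function q" "\<And>x. x \<in> sphere 0 1 \<Longrightarrow> \<bar>Im (f x) - q x\<bar> < e/2"
      by (rule Stone_Weierstrass_real_polynomial_function[OF compact_sphere parts(2) e2]) (rule that)
    obtain A F where A: "weight_components A F (\<lambda>x. complex_of_real (p x))"
      using real_polynomial_function_weight_components[OF p(1)] by (elim exE)
    obtain B G where B: "weight_components B G (\<lambda>x. complex_of_real (q x))"
      using real_polynomial_function_weight_components[OF q(1)] by (elim exE)
    note comp = weight_components_add[OF A weight_components_mult[OF
        weight_components_weighted_poly[OF weighted_poly.const[of \<i>]] B]]
    obtain C H where C: "weight_components C H (\<lambda>x. complex_of_real (p x) + \<i> * complex_of_real (q x))"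
      by (rule that[OF comp])
    have close: "cmod (f x - (complex_of_real (p x) + \<i> * complex_of_real (q x))) \<le> e" if "norm x = 1" for x
    proof -
      have "cmod (f x - (complex_of_real (p x) + \<i> * complex_of_real (q x))) \<le> \<bar>Re (f x) - p x\<bar> + \<bar>Im (f x) - q x\<bar>"
        by (rule order_trans[OF cmod_le]) simp
      then show ?thesis using p(2)[of x] q(2)[of x] that by simp
    qed
    have "cmod (f (sgn x) - H a (sgn x)) \<le> e" if "x \<noteq> 0" for x
      by (rule weight_component_close[OF C f close]) (use that in \<open>auto simp: norm_sgn\<close>)
    moreover have "asymptotically_toeplitz a (\<lambda>x. H a (sgn x))"
      using C by (intro weighted_poly_asymptotically_toeplitz) (auto simp: weight_components_def)
    ultimately show "\<exists>g. asymptotically_toeplitz a g \<and> (\<forall>x. x \<noteq> 0 \<longrightarrow> cmod (f (sgn x) - g x) \<le> e)"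
      by blast
  qed
qed

section \<open>An equivariant unitary frame has weight zero\<close>

text \<open>
  Suppose that the sum on the left were larger. Linear algebra then gives a nonzero tuple of
  polynomials \<open>p\<^sub>i\<close> of degree \<open>d - a\<^sub>i\<close> such that \<open>U p\<close> is orthogonal to all tuples of polynomials of degree
  \<open>d\<close>. But some tuple of such polynomials has squared distance at most half the squared norm of \<open>p\<close> from
  \<open>U p\<close>, and this norm is also that of \<open>U p\<close> because \<open>U\<close> is isometric. So both vanish.
\<close>
theorem equivariant_isometry_dimension_le:
  fixes U :: "complex^'k \<Rightarrow> complex^'n^'n" and a :: "'n \<Rightarrow> int"
  assumes cont: "continuous_on (sphere 0 1) U"
    and weight: "\<And>x z r i. norm x = 1 \<Longrightarrow> cmod z = 1 \<Longrightarrow> U (z *s x) $ r $ i = z powi a i * U x $ r $ i"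
    and isometry: "\<And>x v. norm x = 1 \<Longrightarrow> norm (U x *v v) = norm v"
  shows "\<exists>K. \<forall>d\<ge>K. (\<Sum>i\<in>UNIV. card (exponents (nat (int d - a i)) :: ('k \<Rightarrow> nat) set))
      \<le> CARD('n) * card (exponents d :: ('k \<Rightarrow> nat) set)"
proof -
  define N where "N = real CARD('n)"
  have N: "N > 0" by (simp add: N_def)
  define u where "u = (\<lambda>r i (x :: complex^'k). U (sgn x) $ r $ i)"
  have toep: "asymptotically_toeplitz (a i) (u r i)" for r i
    unfolding u_def using weight
    by (intro continuous_weight_asymptotically_toeplitz[of "\<lambda>x. U x $ r $ i"] continuous_intros cont) auto
  \<comment> \<open>With this bound for each of the \<open>n\<^sup>2\<close> entries, the total squared error is at most half the squared norm.\<close>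
  define e where "e = 1 / (2 * N\<^sup>2)"
  have e: "e > 0" using N by (simp add: e_def)
  define K where "K = (\<lambda>r i. SOME K. \<forall>d\<ge>K. \<forall>p\<in>hom_polys d. \<exists>q\<in>hom_polys (nat (int d + a i)).
        sq_norm (\<lambda>x. u r i x * p x - q x) \<le> e * sq_norm p)"
  have K: "\<forall>d\<ge>K r i. \<forall>p\<in>hom_polys d. \<exists>q\<in>hom_polys (nat (int d + a i)).
        sq_norm (\<lambda>x. u r i x * p x - q x) \<le> e * sq_norm p" for r i
    unfolding K_def by (rule someI_ex[OF asymptotically_toeplitzD[OF toep e]])
  define L where "L = (\<Sum>r\<in>UNIV. \<Sum>i\<in>UNIV. K r i) + nat (\<Sum>i\<in>UNIV. \<bar>a i\<bar>) + 1"
  show ?thesis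
  proof (intro exI[of _ L] allI impI)
    fix d assume d: "L \<le> d"
    define D where "D = (\<lambda>i. nat (int d - a i))"
    have abs_le: "\<bar>a i\<bar> \<le> (\<Sum>i\<in>UNIV. \<bar>a i\<bar>)" for i by (intro member_le_sum) auto
    have K_le: "K r i \<le> (\<Sum>r\<in>UNIV. \<Sum>i\<in>UNIV. K r i)" for r i
      by (rule order_trans[OF member_le_sum[of i UNIV "K r"] member_le_sum[of r UNIV "\<lambda>r. \<Sum>i\<in>UNIV. K r i"]]) auto
    have DK: "D i \<ge> K r i" and D0: "D i > 0" and Dd: "nat (int (D i) + a i) = d" for r i
      using d abs_le[of i] K_le[of r i] unfolding D_def L_def by linarith+
    show "(\<Sum>i\<in>UNIV. card (exponents (nat (int d - a i)) :: ('k \<Rightarrow> nat) set))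
      \<le> CARD('n) * card (exponents d :: ('k \<Rightarrow> nat) set)"
    proof (rule ccontr)
      assume neg: "\<not> ?thesis"
      define I where "I = Sigma (UNIV :: 'n set) (\<lambda>i. exponents (D i) :: ('k \<Rightarrow> nat) set)"
      define J where "J = (UNIV :: 'n set) \<times> (exponents d :: ('k \<Rightarrow> nat) set)"
      have "card J < card I" unfolding I_def J_def D_def
        using neg by (simp add: card_cartesian_product)
      moreover have "finite I" "finite J" by (auto simp: I_def J_def)
      ultimately have "\<exists>c. (\<exists>i\<in>I. c i \<noteq> 0) \<and> (\<forall>j\<in>J.
          (\<Sum>i\<in>I. (\<integral>x. u (fst j) (fst i) x * monomial (snd i) x * cnj (monomial (snd j) x) \<partial>gaussian) * c i) = 0)"
        by (intro underdetermined_system_has_nonzero_solution)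
      then obtain c where c: "\<exists>i\<in>I. c i \<noteq> 0" and sys: "\<forall>j\<in>J.
          (\<Sum>i\<in>I. (\<integral>x. u (fst j) (fst i) x * monomial (snd i) x * cnj (monomial (snd j) x) \<partial>gaussian) * c i) = 0"
        by (elim exE conjE)
      define p where "p = (\<lambda>i (x :: complex^'k). \<Sum>\<gamma>\<in>exponents (D i). c (i, \<gamma>) * monomial \<gamma> x)"
      have p: "p i \<in> hom_polys (D i)" for i by (rule hom_polysI) (simp add: p_def)
      note sp = hom_polys_square_integrable[OF p]
      have bm: "square_integrable (\<lambda>x. u r i x * h x)" if "square_integrable h" for r i h
      proof -
        have "u r i \<in> borel_measurable borel"
          using toep[of i r] unfolding asymptotically_toeplitz_def by (elim conjE)
        moreover obtain B where "\<And>x. cmod (u r i x) \<le> B"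
          by (rule asymptotically_toeplitz_bound[OF toep[of i r]]) (rule that)
        ultimately show ?thesis using that by (rule bounded_mult_square_integrable)
      qed
      define g where "g = (\<lambda>r x. \<Sum>i\<in>UNIV. u r i x * p i x)"
      have sg: "square_integrable (g r)" for r
        unfolding g_def by (intro square_integrable_sum bm sp) auto
      have smon: "square_integrable (monomial \<gamma>)" for \<gamma> :: "'k \<Rightarrow> nat"
        using monomial_in_hom_polys[of \<gamma> "sum \<gamma> UNIV"] hom_polys_square_integrable by (auto simp: exponents_def)
      have orth_mon: "(\<integral>x. g r x * cnj (monomial \<delta> x) \<partial>gaussian) = 0" if "\<delta> \<in> exponents d" for r \<delta>
      proof -
        have int: "integrable gaussian (\<lambda>x. u r i x * monomial \<gamma> x * cnj (monomial \<delta> x))" for i and \<gamma> :: "'k \<Rightarrow> nat"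
          by (rule square_integrable_mult_cnj[OF bm[OF smon] smon])
        have "g r x * cnj (monomial \<delta> x) = (\<Sum>s\<in>I. (u r (fst s) x * monomial (snd s) x * cnj (monomial \<delta> x)) * c s)" for x
        proof -
          have "g r x * cnj (monomial \<delta> x) = (\<Sum>i\<in>UNIV. \<Sum>\<gamma>\<in>exponents (D i).
              (u r i x * monomial \<gamma> x * cnj (monomial \<delta> x)) * c (i, \<gamma>))"
            unfolding g_def p_def sum_distrib_left sum_distrib_right by (simp only: mult_ac)
          then show ?thesis
            unfolding I_def by (subst (asm) sum.Sigma) (auto simp: case_prod_unfold)
        qed
        then have "(\<integral>x. g r x * cnj (monomial \<delta> x) \<partial>gaussian)
           = (\<Sum>s\<in>I. (\<integral>x. u r (fst s) x * monomial (snd s) x * cnj (monomial \<delta> x) \<partial>gaussian) * c s)"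
          using int by (simp add: Bochner_Integration.integral_sum)
        also have "\<dots> = 0" using bspec[OF sys, of "(r, \<delta>)"] that by (simp add: J_def)
        finally show ?thesis .
      qed
      have orth: "(\<integral>x. g r x * cnj (q x) \<partial>gaussian) = 0" if qd: "q \<in> hom_polys d" for r q
      proof -
        obtain b where q: "q = (\<lambda>x. \<Sum>\<gamma>\<in>exponents d. b \<gamma> * monomial \<gamma> x)"
          using qd by (auto simp: hom_polys_def)
        have "g r x * cnj (q x) = (\<Sum>\<gamma>\<in>exponents d. cnj (b \<gamma>) * (g r x * cnj (monomial \<gamma> x)))" for x
          unfolding q by (simp add: sum_distrib_left mult_ac)
        then show ?thesis
          using square_integrable_mult_cnj[OF sg smon] orth_mon by (simp add: Bochner_Integration.integral_sum)
      qed
      define T where "T = (\<Sum>i\<in>UNIV. sq_norm (p i))"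
      have ex: "\<exists>q. q \<in> hom_polys d \<and> sq_norm (\<lambda>x. u r i x * p i x - q x) \<le> e * sq_norm (p i)" for r i
        using K[rule_format, OF DK p] unfolding Dd Bex_def .
      define q where "q = (\<lambda>r i. SOME q. q \<in> hom_polys d \<and> sq_norm (\<lambda>x. u r i x * p i x - q x) \<le> e * sq_norm (p i))"
      have "q r i \<in> hom_polys d \<and> sq_norm (\<lambda>x. u r i x * p i x - q r i x) \<le> e * sq_norm (p i)" for r i
        unfolding q_def by (rule someI_ex[OF ex])
      note q = conjunct1[OF this] and qe = conjunct2[OF this]
      \<comment> \<open>As \<open>g r\<close> is orthogonal to all polynomials of degree \<open>d\<close>, its norm is at most its distance from any of them.\<close>
      have bound: "sq_norm (g r) \<le> N * (e * T)" for r
      proof -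
        let ?q = "\<lambda>x. \<Sum>i\<in>UNIV. q r i x"
        have Q: "?q \<in> hom_polys d" by (rule hom_polys_sum) (auto simp: q)
        have "sq_norm (g r) \<le> sq_norm (\<lambda>x. g r x - ?q x)"
          using pythagoras_orthogonal[OF sg hom_polys_square_integrable[OF Q] orth[OF Q]] sq_norm_nonneg by simp
        also have "(\<lambda>x. g r x - ?q x) = (\<lambda>x. \<Sum>i\<in>UNIV. u r i x * p i x - q r i x)"
          unfolding g_def by (simp add: sum_subtractf)
        also have "sq_norm \<dots> \<le> real CARD('n) * (\<Sum>i\<in>UNIV. sq_norm (\<lambda>x. u r i x * p i x - q r i x))"
          by (intro sq_norm_sum_le square_integrable_diff bm sp hom_polys_square_integrable[OF q]) auto
        also have "\<dots> \<le> N * (\<Sum>i\<in>UNIV. e * sq_norm (p i))"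
          unfolding N_def by (intro mult_left_mono sum_mono qe) auto
        finally show ?thesis by (simp add: T_def sum_distrib_left)
      qed
      have "(\<Sum>r\<in>UNIV. (cmod (g r x))\<^sup>2) = (\<Sum>i\<in>UNIV. (cmod (p i x))\<^sup>2)" for x
      proof (cases "x = 0")
        case True
        then show ?thesis using hom_polys_at_zero[OF p D0] by (simp add: g_def)
      next
        case False
        then have "norm (U (sgn x) *v (\<chi> i. p i x)) = norm (\<chi> i. p i x)"
          by (intro isometry) (simp add: norm_sgn)
        moreover have "U (sgn x) *v (\<chi> i. p i x) = (\<chi> r. g r x)"
          unfolding g_def u_def by (simp add: matrix_vector_mult_def)
        ultimately have "(norm (\<chi> r. g r x))\<^sup>2 = (norm (\<chi> i. p i x))\<^sup>2" by simp
        then show ?thesis unfolding norm_vec_sq by simp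
      qed
      then have "(\<integral>x. (\<Sum>r\<in>UNIV. (cmod (g r x))\<^sup>2) \<partial>gaussian) = (\<integral>x. (\<Sum>i\<in>UNIV. (cmod (p i x))\<^sup>2) \<partial>gaussian)"
        by simp
      then have "T = (\<Sum>r\<in>UNIV. sq_norm (g r))"
        unfolding T_def sq_norm_def
        using sg sp by (simp add: Bochner_Integration.integral_sum square_integrable_def)
      also have "\<dots> \<le> (\<Sum>r\<in>(UNIV :: 'n set). N * (e * T))" by (intro sum_mono bound)
      also have "\<dots> = T / 2" using N by (simp add: N_def[symmetric] e_def power2_eq_square)
      finally have "T \<le> 0" by simp
      obtain i \<gamma> where i: "\<gamma> \<in> exponents (D i)" "c (i, \<gamma>) \<noteq> 0" using c by (auto simp: I_def)
      have "0 < (cmod (c (i, \<gamma>)))\<^sup>2 * mfact \<gamma>" by (intro mult_pos_pos mfact_pos) (use i in simp)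
      also have "\<dots> \<le> (\<Sum>\<gamma>\<in>exponents (D i). (cmod (c (i, \<gamma>)))\<^sup>2 * mfact \<gamma>)"
        using i by (intro member_le_sum) (auto intro!: mult_nonneg_nonneg less_imp_le[OF mfact_pos])
      also have "\<dots> = sq_norm (p i)"
        unfolding p_def by (rule hom_polys_sq_norm(2)[OF finite_exponents, symmetric])
      also have "\<dots> \<le> T" unfolding T_def by (intro member_le_sum) (auto simp: sq_norm_nonneg)
      finally show False using \<open>T \<le> 0\<close> by simp
    qed
  qed
qed

text \<open>
  The conjugate of \<open>U\<close> is again isometric, with weights \<open>- a\<close>. Adding the two dimension bounds leaves no
  room for the strict convexity of the dimension at any nonzero weight.
\<close>
theorem equivariant_isometry_weights_zero:
  fixes U :: "complex^'k \<Rightarrow> complex^'n^'n" and a :: "'n \<Rightarrow> int"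
  assumes card: "CARD('k) > 2"
    and cont: "continuous_on (sphere 0 1) U"
    and weight: "\<And>x z r i. norm x = 1 \<Longrightarrow> cmod z = 1 \<Longrightarrow> U (z *s x) $ r $ i = z powi a i * U x $ r $ i"
    and isometry: "\<And>x v. norm x = 1 \<Longrightarrow> norm (U x *v v) = norm v"
  shows "a i = 0"
proof (rule ccontr)
  assume ai: "a i \<noteq> 0"
  define V where "V = (\<lambda>x. (\<chi> r i. cnj (U x $ r $ i)) :: complex^'n^'n)"
  have contV: "continuous_on (sphere 0 1) V"
    unfolding V_def by (intro continuous_intros cont continuous_on_vec_lambda)
  have weightV: "V (z *s x) $ r $ i = z powi (- a i) * V x $ r $ i" if "norm x = 1" "cmod z = 1" for x z r i
  proof -
    have "z * cnj z = 1" using that(2) by (simp add: complex_norm_square[symmetric])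
    then have "cnj z = inverse z" by (metis inverse_unique)
    then have "cnj (z powi a i) = z powi (- a i)"
      by (cases "a i \<ge> 0") (simp_all add: power_int_def power_inverse)
    then show ?thesis using weight[OF that] by (simp add: V_def)
  qed
  have isoV: "norm (V x *v v) = norm v" if "norm x = 1" for x v
  proof -
    have eq: "V x *v v = (\<chi> r. cnj ((U x *v (\<chi> i. cnj (v $ i))) $ r))"
      by (simp add: V_def matrix_vector_mult_def vec_eq_iff)
    have "norm (V x *v v) = norm (U x *v (\<chi> i. cnj (v $ i)))"
      unfolding eq norm_vec_def by simp
    also have "\<dots> = norm (\<chi> i. cnj (v $ i))" by (rule isometry[OF that])
    also have "\<dots> = norm v" by (simp add: norm_vec_def)
    finally show ?thesis .
  qed
  let ?E = "\<lambda>d. card (exponents d :: ('k \<Rightarrow> nat) set)"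
  obtain K where K: "\<And>d. d \<ge> K \<Longrightarrow> (\<Sum>i\<in>UNIV. ?E (nat (int d - a i))) \<le> CARD('n) * ?E d"
    using equivariant_isometry_dimension_le[OF cont weight isometry] by blast
  obtain L where L: "\<And>d. d \<ge> L \<Longrightarrow> (\<Sum>i\<in>UNIV. ?E (nat (int d - - a i))) \<le> CARD('n) * ?E d"
    using equivariant_isometry_dimension_le[OF contV weightV isoV] by blast
  define d where "d = K + L + nat (\<Sum>i\<in>UNIV. \<bar>a i\<bar>)"
  have abs_le: "nat \<bar>a i\<bar> \<le> d" for i
    using member_le_sum[of i UNIV "\<lambda>i. \<bar>a i\<bar>"] unfolding d_def by simp
  have pair: "?E (nat (int d - a i)) + ?E (nat (int d - - a i)) = ?E (d + nat \<bar>a i\<bar>) + ?E (d - nat \<bar>a i\<bar>)" for i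
  proof (cases "a i \<ge> 0")
    case True
    then have "nat (int d - a i) = d - nat \<bar>a i\<bar>" "nat (int d - - a i) = d + nat \<bar>a i\<bar>"
      using abs_le[of i] by auto
    then show ?thesis by simp
  next
    case False
    then have "nat (int d - a i) = d + nat \<bar>a i\<bar>" "nat (int d - - a i) = d - nat \<bar>a i\<bar>"
      using abs_le[of i] by auto
    then show ?thesis by simp
  qed
  have conv: "2 * ?E d < ?E (d + nat \<bar>a i\<bar>) + ?E (d - nat \<bar>a i\<bar>)" if "a i \<noteq> 0" for i
    using that abs_le by (intro card_exponents_strictly_convex card) auto
  have "(\<Sum>i\<in>(UNIV :: 'n set). 2 * ?E d) < (\<Sum>i\<in>UNIV. ?E (nat (int d - a i)) + ?E (nat (int d - - a i)))"
  proof (rule sum_strict_mono_ex1)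
    show "\<forall>i\<in>UNIV. 2 * ?E d \<le> ?E (nat (int d - a i)) + ?E (nat (int d - - a i))"
    proof
      fix i show "2 * ?E d \<le> ?E (nat (int d - a i)) + ?E (nat (int d - - a i))"
        using conv[of i] by (cases "a i = 0") (auto simp del: diff_minus_eq_add simp: pair)
    qed
    show "\<exists>i\<in>UNIV. 2 * ?E d < ?E (nat (int d - a i)) + ?E (nat (int d - - a i))"
      using conv[OF ai] unfolding pair by blast
  qed simp
  also have "\<dots> \<le> CARD('n) * ?E d + CARD('n) * ?E d"
    unfolding sum.distrib by (intro add_mono K L) (auto simp: d_def)
  finally show False by simp
qed

section \<open>Eigenvectors of normal matrices\<close>

definition hinner :: "complex^'n \<Rightarrow> complex^'n \<Rightarrow> complex"
  where "hinner v w = (\<Sum>i\<in>UNIV. v $ i * cnj (w $ i))"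

lemma hinner_self: "hinner v v = complex_of_real ((norm v)\<^sup>2)"
  unfolding hinner_def norm_vec_sq_complex ..

lemma hinner_diff_left: "hinner (u - v) w = hinner u w - hinner v w"
  by (simp add: hinner_def algebra_simps sum_subtractf)

lemma hinner_diff_right: "hinner u (v - w) = hinner u v - hinner u w"
  by (simp add: hinner_def algebra_simps sum_subtractf)

lemma hinner_scale_left: "hinner (c *s u) w = c * hinner u w"
  by (simp add: hinner_def algebra_simps sum_distrib_left)

lemma hinner_scale_right: "hinner u (c *s w) = cnj c * hinner u w"
  by (simp add: hinner_def algebra_simps sum_distrib_left)

lemma hinner_adjoint: "hinner (M *v v) w = hinner v (conj_transpose M *v w)"
  unfolding hinner_def matrix_vector_mult_def conj_transpose_def
  by (simp add: sum_distrib_left sum_distrib_right) (subst sum.swap, simp add: mult_ac)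

lemma conj_transpose_conj_transpose [simp]: "conj_transpose (conj_transpose M) = M"
  by (simp add: conj_transpose_def vec_eq_iff)

lemma norm_scale_vec: "norm (c *s (v :: complex^'n)) = cmod c * norm v"
proof -
  have "(norm (c *s v))\<^sup>2 = (cmod c * norm v)\<^sup>2"
    by (simp add: norm_vec_sq power_mult_distrib norm_mult sum_distrib_left)
  then show ?thesis by (simp add: power2_eq_iff_nonneg)
qed

lemma norm_matrix_vector_le:
  fixes A :: "complex^'n^'m"
  shows "norm (A *v x) \<le> norm A * norm x"
proof -
  have "(norm (A *v x))\<^sup>2 = (\<Sum>r\<in>UNIV. (cmod (\<Sum>i\<in>UNIV. A $ r $ i * x $ i))\<^sup>2)"
    unfolding norm_vec_sq by (simp add: matrix_vector_mult_def)
  also have "\<dots> \<le> (\<Sum>r\<in>UNIV. (\<Sum>i\<in>UNIV. cmod (A $ r $ i) * cmod (x $ i))\<^sup>2)"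
    by (intro sum_mono power_mono order_trans[OF norm_sum]) (auto simp: norm_mult)
  also have "\<dots> \<le> (\<Sum>r\<in>UNIV. (\<Sum>i\<in>UNIV. (cmod (A $ r $ i))\<^sup>2) * (\<Sum>i\<in>UNIV. (cmod (x $ i))\<^sup>2))"
    by (intro sum_mono Cauchy_Schwarz_ineq_sum)
  also have "\<dots> = (norm A)\<^sup>2 * (norm x)\<^sup>2"
    by (simp add: norm_vec_def L2_set_def sum_nonneg sum_distrib_right)
  finally have "(norm (A *v x))\<^sup>2 \<le> (norm A * norm x)\<^sup>2" by (simp add: power_mult_distrib)
  then show ?thesis by (rule power2_le_imp_le) simp
qed

text \<open>
  For normal \<open>M\<close> the vectors \<open>(M - c) v\<close> and \<open>(M - c)\<^sup>* v\<close> have the same norm.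
\<close>
lemma normal_eigenvector_adjoint:
  assumes normal: "M ** conj_transpose M = conj_transpose M ** M" and ev: "M *v v = c *s v"
  shows "conj_transpose M *v v = cnj c *s v"
proof -
  have 1: "hinner (conj_transpose M *v v) (conj_transpose M *v v) = c * cnj c * hinner v v"
  proof -
    have "hinner (conj_transpose M *v v) (conj_transpose M *v v) = hinner v (M *v (conj_transpose M *v v))"
      using hinner_adjoint[of "conj_transpose M" v "conj_transpose M *v v"] by simp
    also have "\<dots> = hinner v (conj_transpose M *v (M *v v))"
      by (simp add: matrix_vector_mul_assoc normal)
    also have "\<dots> = hinner (M *v v) (M *v v)" by (simp add: hinner_adjoint)
    finally show ?thesis by (simp add: ev hinner_scale_left hinner_scale_right)
  qed
  have 2: "hinner (conj_transpose M *v v) v = cnj c * hinner v v"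
    using hinner_adjoint[of "conj_transpose M" v v] by (simp add: ev hinner_scale_right)
  have 3: "hinner v (conj_transpose M *v v) = c * hinner v v"
    using hinner_adjoint[of M v v] by (simp add: ev hinner_scale_left)
  have "hinner (conj_transpose M *v v - cnj c *s v) (conj_transpose M *v v - cnj c *s v) = 0"
    unfolding hinner_diff_left hinner_diff_right hinner_scale_left hinner_scale_right 1 2 3
    by (simp add: algebra_simps)
  then show ?thesis by (simp add: hinner_self)
qed

lemma normal_eigenvectors_orthogonal:
  assumes normal: "M ** conj_transpose M = conj_transpose M ** M"
    and "M *v v = c *s v" "M *v w = d *s w" "c \<noteq> d"
  shows "hinner v w = 0"
proof -
  have "c * hinner v w = hinner (M *v v) w" by (simp add: assms hinner_scale_left)
  also have "\<dots> = d * hinner v w"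
    by (simp add: hinner_adjoint normal_eigenvector_adjoint[OF normal assms(3)] hinner_scale_right)
  finally show ?thesis using assms(4) by simp
qed

definition column_matrix :: "('n \<Rightarrow> complex^'n) \<Rightarrow> complex^'n^'n"
  where "column_matrix v = (\<chi> r i. v i $ r)"

lemma column_matrix_gram: "(conj_transpose (column_matrix v) ** column_matrix v) $ i $ j = hinner (v j) (v i)"
  by (simp add: column_matrix_def conj_transpose_def matrix_matrix_mult_def hinner_def mult_ac)

lemma orthonormal_column_matrix_unitary:
  fixes v :: "'n::finite \<Rightarrow> complex^'n"
  assumes "\<And>i j. hinner (v i) (v j) = (if i = j then 1 else 0)"
  shows "conj_transpose (column_matrix v) ** column_matrix v = mat 1"
    and "column_matrix v ** conj_transpose (column_matrix v) = mat 1"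
proof -
  show *: "conj_transpose (column_matrix v) ** column_matrix v = mat 1"
    by (simp add: vec_eq_iff column_matrix_gram assms mat_def)
  then show "column_matrix v ** conj_transpose (column_matrix v) = mat 1"
    by (simp add: matrix_left_right_inverse)
qed

lemma isometry_of_gram:
  assumes "conj_transpose U ** U = mat 1"
  shows "norm (U *v v) = norm v"
proof -
  have "hinner (U *v v) (U *v v) = hinner v v"
    unfolding hinner_adjoint matrix_vector_mul_assoc assms by simp
  then have "(norm (U *v v))\<^sup>2 = (norm v)\<^sup>2" unfolding hinner_self of_real_eq_iff .
  then show ?thesis by (simp add: power2_eq_iff_nonneg)
qed

lemma orthonormal_coefficients:
  "(conj_transpose (column_matrix v) *v w) $ i = hinner w (v i)"
  by (simp add: column_matrix_def conj_transpose_def matrix_vector_mult_def hinner_def mult_ac)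

lemma orthonormal_parseval:
  fixes v :: "'n::finite \<Rightarrow> complex^'n"
  assumes "\<And>i j. hinner (v i) (v j) = (if i = j then 1 else 0)"
  shows "(norm w)\<^sup>2 = (\<Sum>i\<in>UNIV. (cmod (hinner w (v i)))\<^sup>2)"
proof -
  have "norm (conj_transpose (column_matrix v) *v w) = norm w"
    by (rule isometry_of_gram) (simp add: orthonormal_column_matrix_unitary(2)[OF assms])
  then show ?thesis using norm_vec_sq[of "conj_transpose (column_matrix v) *v w"]
    by (simp add: orthonormal_coefficients)
qed

lemma orthonormal_eq_iff:
  fixes v :: "'n::finite \<Rightarrow> complex^'n"
  assumes "\<And>i j. hinner (v i) (v j) = (if i = j then 1 else 0)" and "\<And>i. hinner x (v i) = hinner y (v i)"
  shows "x = y"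
proof -
  have "(norm (x - y))\<^sup>2 = 0"
    unfolding orthonormal_parseval[OF assms(1), of "x - y"] by (simp add: hinner_diff_left assms(2))
  then show ?thesis by simp
qed

lemma normal_eigenbasis_of_enumeration:
  fixes M :: "complex^'n^'n" and l :: "'n \<Rightarrow> complex"
  assumes normal: "M ** conj_transpose M = conj_transpose M ** M"
    and inj: "inj l" and ran: "range l = eigenvalues M"
  obtains v where "\<And>i. M *v v i = l i *s v i" "\<And>i j. hinner (v i) (v j) = (if i = j then 1 else 0)"
proof -
  have "\<exists>v. M *v v = l i *s v \<and> norm v = 1" for i
  proof -
    have "l i \<in> eigenvalues M" using ran by blast
    then obtain w where w: "w \<noteq> 0" "M *v w = l i *s w" by (auto simp: eigenvalues_def)
    let ?v = "complex_of_real (1 / norm w) *s w"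
    have "M *v ?v = l i *s ?v" using w by (simp add: vector_scalar_commute mult_ac)
    moreover have "norm ?v = 1" using w by (simp add: norm_scale_vec norm_divide)
    ultimately show ?thesis by blast
  qed
  then obtain v where v: "\<And>i. M *v v i = l i *s v i" "\<And>i. norm (v i) = 1" by metis
  have "hinner (v i) (v j) = (if i = j then 1 else 0)" for i j
  proof (cases "i = j")
    case True then show ?thesis by (simp add: hinner_self v)
  next
    case False
    then have "l i \<noteq> l j" using inj by (auto dest: injD)
    then show ?thesis using normal_eigenvectors_orthogonal[OF normal v(1) v(1)] False by simp
  qed
  with v(1) that show ?thesis by blast
qed

lemma normal_multiplicity_free_eigenbasis:
  fixes M :: "complex^'n^'n"
  assumes normal: "M ** conj_transpose M = conj_transpose M ** M"
    and card: "card (eigenvalues M) = CARD('n)"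
  obtains l :: "'n \<Rightarrow> complex" and v where "inj l" "range l = eigenvalues M"
    "\<And>i. M *v v i = l i *s v i" "\<And>i j. hinner (v i) (v j) = (if i = j then 1 else 0)"
proof -
  have "finite (eigenvalues M)" using card by (simp add: card_ge_0_finite)
  then obtain l :: "'n \<Rightarrow> complex" where "bij_betw l UNIV (eigenvalues M)"
    using card finite_same_card_bij[of "UNIV :: 'n set" "eigenvalues M"] by auto
  then have l: "inj l" "range l = eigenvalues M" by (auto simp: bij_betw_def)
  obtain v where "\<And>i. M *v v i = l i *s v i" "\<And>i j. hinner (v i) (v j) = (if i = j then 1 else 0)"
    using normal_eigenbasis_of_enumeration[OF normal l] by blast
  with l that show ?thesis by blast
qed

text \<open>
  The Bauer-Fike bound: in an orthonormal eigenbasis \<open>M - c\<close> multiplies each coefficient of \<open>w\<close> by the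
  distance of an eigenvalue from \<open>c\<close>.
\<close>
lemma normal_near_eigenvalue:
  fixes M :: "complex^'n^'n"
  assumes normal: "M ** conj_transpose M = conj_transpose M ** M"
    and card: "card (eigenvalues M) = CARD('n)"
    and w: "norm w = 1"
  shows "\<exists>d\<in>eigenvalues M. cmod (d - c) \<le> norm (M *v w - c *s w)"
proof (rule ccontr)
  assume neg: "\<not> ?thesis"
  obtain l :: "'n \<Rightarrow> complex" and v where "inj l" and lv: "range l = eigenvalues M"
    "\<And>i. M *v v i = l i *s v i" "\<And>i j. hinner (v i) (v j) = (if i = j then 1 else 0)"
    using normal_multiplicity_free_eigenbasis[OF normal card] by blast
  let ?t = "norm (M *v w - c *s w)"
  have big: "?t < cmod (l i - c)" for i
  proof -
    have "l i \<in> eigenvalues M" using lv(1) by blast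
    then show ?thesis using neg by (auto simp: not_le)
  qed
  have coeff: "hinner (M *v w - c *s w) (v i) = (l i - c) * hinner w (v i)" for i
    by (simp add: hinner_diff_left hinner_scale_left hinner_adjoint hinner_scale_right
      normal_eigenvector_adjoint[OF normal lv(2)] algebra_simps)
  have one: "(\<Sum>i\<in>UNIV. (cmod (hinner w (v i)))\<^sup>2) = 1"
    using orthonormal_parseval[OF lv(3), of w] w by simp
  have "?t\<^sup>2 = (\<Sum>i\<in>UNIV. ?t\<^sup>2 * (cmod (hinner w (v i)))\<^sup>2)"
    using one by (simp add: sum_distrib_left[symmetric])
  also have "\<dots> < (\<Sum>i\<in>UNIV. (cmod (l i - c))\<^sup>2 * (cmod (hinner w (v i)))\<^sup>2)"
  proof (rule sum_strict_mono_ex1)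
    have sq: "?t\<^sup>2 < (cmod (l i - c))\<^sup>2" for i
      using big[of i] by (intro power_strict_mono) auto
    show "\<forall>i\<in>UNIV. ?t\<^sup>2 * (cmod (hinner w (v i)))\<^sup>2 \<le> (cmod (l i - c))\<^sup>2 * (cmod (hinner w (v i)))\<^sup>2"
      by (intro ballI mult_right_mono less_imp_le[OF sq]) auto
    have "\<exists>i. hinner w (v i) \<noteq> 0"
    proof (rule ccontr)
      assume "\<not> ?thesis" then show False using one by simp
    qed
    then obtain i where "hinner w (v i) \<noteq> 0" by blast
    then show "\<exists>i\<in>UNIV. ?t\<^sup>2 * (cmod (hinner w (v i)))\<^sup>2 < (cmod (l i - c))\<^sup>2 * (cmod (hinner w (v i)))\<^sup>2"
      by (intro bexI[of _ i] mult_strict_right_mono sq) auto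
  qed simp
  also have "\<dots> = ?t\<^sup>2"
    unfolding orthonormal_parseval[OF lv(3), of "M *v w - c *s w"] coeff by (simp add: norm_mult power_mult_distrib)
  finally show False by simp
qed

section \<open>Continuous eigenvalue functions\<close>

definition normal_multiplicity_free :: "complex^'n^'n \<Rightarrow> bool"
  where "normal_multiplicity_free M \<longleftrightarrow>
    M ** conj_transpose M = conj_transpose M ** M \<and> card (eigenvalues M) = CARD('n)"

text \<open>
  A unit eigenvector of \<open>B y\<close> is an approximate eigenvector of \<open>B x\<close> for \<open>x\<close> near \<open>y\<close>.
\<close>
lemma eigenvalue_persists:
  fixes B :: "'a::metric_space \<Rightarrow> complex^'n^'n"
  assumes cont: "continuous_on S B" and B: "\<And>x. x \<in> S \<Longrightarrow> normal_multiplicity_free (B x)"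
    and y: "y \<in> S" and c: "c \<in> eigenvalues (B y)" and e: "e > 0"
  shows "\<exists>T. openin (top_of_set S) T \<and> y \<in> T \<and> (\<forall>x\<in>T. \<exists>d\<in>eigenvalues (B x). cmod (d - c) < e)"
proof -
  obtain w0 where w0: "w0 \<noteq> 0" "B y *v w0 = c *s w0" using c by (auto simp: eigenvalues_def)
  define w where "w = complex_of_real (1 / norm w0) *s w0"
  have w: "norm w = 1" "B y *v w = c *s w"
    unfolding w_def using w0 by (simp_all add: norm_scale_vec norm_divide vector_scalar_commute mult_ac)
  let ?T = "{x \<in> S. norm (B x *v w - c *s w) < e}"
  have "continuous_on S (\<lambda>x. norm (B x *v w - c *s w))"
    unfolding matrix_vector_mult_def by (intro continuous_intros cont continuous_on_vec_lambda)
  then have "openin (top_of_set S) (S \<inter> (\<lambda>x. norm (B x *v w - c *s w)) -` {..<e})"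
    by (rule continuous_openin_preimage_gen) simp
  moreover have "S \<inter> (\<lambda>x. norm (B x *v w - c *s w)) -` {..<e} = ?T" by auto
  ultimately have "openin (top_of_set S) ?T" by simp
  moreover have "y \<in> ?T" using y w e by simp
  moreover have "\<exists>d\<in>eigenvalues (B x). cmod (d - c) < e" if "x \<in> ?T" for x
    using normal_near_eigenvalue[OF _ _ w(1), of "B x" c] B[of x] that
    unfolding normal_multiplicity_free_def by (auto intro: order_le_less_trans)
  ultimately show ?thesis by blast
qed

text \<open>
  Surround the eigenvalues of \<open>B y\<close> by disjoint discs. For \<open>x\<close> near \<open>y\<close> each of these \<open>n\<close> discs contains at least
  one of the \<open>n\<close> eigenvalues of \<open>B x\<close>, hence exactly one, and this eigenvalue depends continuously on \<open>x\<close>.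
\<close>
lemma eigenvalue_sheets:
  fixes B :: "'a::metric_space \<Rightarrow> complex^'n^'n"
  assumes cont: "continuous_on S B" and B: "\<And>x. x \<in> S \<Longrightarrow> normal_multiplicity_free (B x)"
    and y: "y \<in> S"
  obtains T and \<mu> :: "'n \<Rightarrow> 'a \<Rightarrow> complex" and l :: "'n \<Rightarrow> complex" and d where
    "openin (top_of_set S) T" "y \<in> T" "\<And>i. continuous_on T (\<mu> i)"
    "\<And>x c. x \<in> T \<Longrightarrow> c \<in> eigenvalues (B x) \<Longrightarrow> \<exists>i. cmod (c - l i) < d"
    "\<And>x i c. x \<in> T \<Longrightarrow> c \<in> eigenvalues (B x) \<and> cmod (c - l i) < d \<longleftrightarrow> c = \<mu> i x"
    "\<And>i j c. cmod (c - l i) < d \<Longrightarrow> cmod (c - l j) < d \<Longrightarrow> i = j"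
proof -
  have nm: "B x ** conj_transpose (B x) = conj_transpose (B x) ** B x" "card (eigenvalues (B x)) = CARD('n)"
    if "x \<in> S" for x using B[OF that] by (auto simp: normal_multiplicity_free_def)
  obtain l :: "'n \<Rightarrow> complex" and v where l: "inj l" "range l = eigenvalues (B y)"
    "\<And>i. B y *v v i = l i *s v i" "\<And>i j. hinner (v i) (v j) = (if i = j then 1 else 0)"
    using normal_multiplicity_free_eigenbasis[OF nm[OF y]] by blast
  \<comment> \<open>At most half the minimal distance of two eigenvalues; the \<open>1\<close> covers the case of a single one.\<close>
  define D where "D = insert 1 ((\<lambda>(i, j). cmod (l i - l j) / 2) ` {(i, j). i \<noteq> j})"
  have finD: "finite D" unfolding D_def by auto
  define d where "d = Min D"
  have "\<forall>t\<in>D. t > 0" unfolding D_def using l(1) by (auto dest: injD)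
  then have d: "d > 0" unfolding d_def using finD by (simp add: D_def)
  have sep: "i = j" if "cmod (c - l i) < d" "cmod (c - l j) < d" for i j c
  proof (rule ccontr)
    assume "i \<noteq> j"
    then have "cmod (l i - l j) / 2 \<in> D" unfolding D_def by auto
    then have "d \<le> cmod (l i - l j) / 2" unfolding d_def by (rule Min_le[OF finD])
    moreover have "cmod (l i - l j) \<le> cmod (c - l i) + cmod (c - l j)"
      by (rule norm_diff_triangle_le[of _ c]) (auto simp: norm_minus_commute)
    ultimately show False using that by linarith
  qed
  have "\<exists>T. openin (top_of_set S) T \<and> y \<in> T \<and> (\<forall>x\<in>T. \<exists>c\<in>eigenvalues (B x). cmod (c - l i) < d)" for i
    by (rule eigenvalue_persists[OF cont B y _ d]) (use l(2) in auto)
  then obtain V where V: "\<And>i. openin (top_of_set S) (V i)" "\<And>i. y \<in> V i"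
    "\<And>i x. x \<in> V i \<Longrightarrow> \<exists>c\<in>eigenvalues (B x). cmod (c - l i) < d" by metis
  define T where "T = (\<Inter>i. V i)"
  have T: "openin (top_of_set S) T" "y \<in> T" unfolding T_def using V by (auto intro!: openin_INT2)
  have TS: "T \<subseteq> S" using T(1) by (auto dest: openin_imp_subset)
  have ex: "\<exists>c\<in>eigenvalues (B x). cmod (c - l i) < d" if "x \<in> T" for x i
    using V(3) that by (auto simp: T_def)
  define \<mu> where "\<mu> = (\<lambda>i x. SOME c. c \<in> eigenvalues (B x) \<and> cmod (c - l i) < d)"
  have \<mu>: "\<mu> i x \<in> eigenvalues (B x) \<and> cmod (\<mu> i x - l i) < d" if "x \<in> T" for i x
    unfolding \<mu>_def by (rule someI_ex) (use ex[OF that, of i] in blast)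
  have all: "range (\<lambda>i. \<mu> i x) = eigenvalues (B x)" if x: "x \<in> T" for x
  proof -
    have "x \<in> S" using x TS by blast
    have fin: "finite (eigenvalues (B x))" using nm(2)[OF \<open>x \<in> S\<close>] by (simp add: card_ge_0_finite)
    have "inj (\<lambda>i. \<mu> i x)"
    proof (rule injI)
      fix i j assume "\<mu> i x = \<mu> j x"
      then show "i = j" using \<mu>[OF x, of i] \<mu>[OF x, of j] sep by metis
    qed
    then have "card (range (\<lambda>i. \<mu> i x)) = card (eigenvalues (B x))"
      using nm(2)[OF \<open>x \<in> S\<close>] by (simp add: card_image)
    then show ?thesis using \<mu>[OF x] by (intro card_subset_eq fin) auto
  qed
  have char: "c \<in> eigenvalues (B x) \<and> cmod (c - l i) < d \<longleftrightarrow> c = \<mu> i x" if x: "x \<in> T" for x i c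
  proof
    assume c: "c \<in> eigenvalues (B x) \<and> cmod (c - l i) < d"
    then obtain j where j: "c = \<mu> j x" using all[OF x] by auto
    then have "j = i" using c \<mu>[OF x, of j] sep by blast
    then show "c = \<mu> i x" using j by simp
  qed (use \<mu>[OF x] in simp)
  have cont\<mu>: "continuous_on T (\<mu> i)" for i
    unfolding continuous_on_iff
  proof (intro ballI allI impI)
    fix x and e :: real assume x: "x \<in> T" and e: "e > 0"
    define e' where "e' = min e (d - cmod (\<mu> i x - l i))"
    have e': "e' > 0" unfolding e'_def using e \<mu>[OF x, of i] by simp
    obtain W where W: "openin (top_of_set S) W" "x \<in> W" "\<forall>z\<in>W. \<exists>c\<in>eigenvalues (B z). cmod (c - \<mu> i x) < e'"
      using eigenvalue_persists[OF cont B _ conjunct1[OF \<mu>[OF x]] e'] x TS by blast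
    obtain r where r: "r > 0" "ball x r \<inter> S \<subseteq> W"
      using W(1,2) by (auto simp: openin_contains_ball)
    show "\<exists>r>0. \<forall>z\<in>T. dist z x < r \<longrightarrow> dist (\<mu> i z) (\<mu> i x) < e"
    proof (intro exI[of _ r] conjI r ballI impI)
      fix z assume z: "z \<in> T" "dist z x < r"
      then have "z \<in> W" using r(2) TS by (auto simp: dist_commute)
      then obtain c where c: "c \<in> eigenvalues (B z)" "cmod (c - \<mu> i x) < e'" using W(3) by blast
      have "cmod (c - l i) \<le> cmod (c - \<mu> i x) + cmod (\<mu> i x - l i)"
        by (rule norm_diff_triangle_le[of _ "\<mu> i x"]) auto
      then have "cmod (c - l i) < d" using c(2) by (simp add: e'_def)
      then have "c = \<mu> i z" using char[OF z(1)] c(1) by blast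
      then show "dist (\<mu> i z) (\<mu> i x) < e" using c(2) by (simp add: e'_def dist_norm)
    qed
  qed
  have cover: "\<exists>i. cmod (c - l i) < d" if xc: "x \<in> T" "c \<in> eigenvalues (B x)" for x c
  proof -
    obtain i where "c = \<mu> i x" using all[OF xc(1)] xc(2) by auto
    then show ?thesis using \<mu>[OF xc(1), of i] by blast
  qed
  show ?thesis by (rule that[OF T cont\<mu> cover char sep])
qed

lemma eigenvalue_covering:
  fixes B :: "'a::real_normed_vector \<Rightarrow> complex^'n^'n"
  assumes cont: "continuous_on S B" and B: "\<And>x. x \<in> S \<Longrightarrow> normal_multiplicity_free (B x)"
  shows "covering_space {(x, c). x \<in> S \<and> c \<in> eigenvalues (B x)} fst S"
proof
  let ?C = "{(x, c). x \<in> S \<and> c \<in> eigenvalues (B x)}"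
  show "continuous_on ?C fst" by (intro continuous_intros)
  show "fst ` ?C = S"
  proof (intro equalityI subsetI)
    fix x assume x: "x \<in> S"
    have "card (eigenvalues (B x)) > 0" using B[OF x] by (simp add: normal_multiplicity_free_def)
    then obtain c where "c \<in> eigenvalues (B x)" by (metis card.empty ex_in_conv less_irrefl)
    then show "x \<in> fst ` ?C" using x by force
  qed auto
  fix y assume y: "y \<in> S"
  obtain T and \<mu> :: "'n \<Rightarrow> 'a \<Rightarrow> complex" and l :: "'n \<Rightarrow> complex" and d where
    T: "openin (top_of_set S) T" "y \<in> T" and \<mu>: "\<And>i. continuous_on T (\<mu> i)" and
    cover: "\<And>x c. x \<in> T \<Longrightarrow> c \<in> eigenvalues (B x) \<Longrightarrow> \<exists>i. cmod (c - l i) < d" and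
    char: "\<And>x i c. x \<in> T \<Longrightarrow> c \<in> eigenvalues (B x) \<and> cmod (c - l i) < d \<longleftrightarrow> c = \<mu> i x" and
    sep: "\<And>i j c. cmod (c - l i) < d \<Longrightarrow> cmod (c - l j) < d \<Longrightarrow> i = j"
    by (rule eigenvalue_sheets[OF cont B y]) blast+
  have TS: "T \<subseteq> S" using T(1) by (auto dest: openin_imp_subset)
  define u where "u = (\<lambda>i. {(x, c) \<in> ?C. x \<in> T \<and> cmod (c - l i) < d})"
  have open_u: "openin (top_of_set ?C) (u i)" for i
  proof -
    obtain W where W: "open W" "T = S \<inter> W" using T(1) by (auto simp: openin_open)
    have "u i = ?C \<inter> (W \<times> ball (l i) d)"
      unfolding u_def W(2) by (auto simp: dist_norm norm_minus_commute)
    then show ?thesis using W(1) by (auto simp: openin_open intro!: exI[of _ "W \<times> ball (l i) d"] open_Times)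
  qed
  have homeo: "homeomorphism (u i) T fst (\<lambda>x. (x, \<mu> i x))" for i
  proof (rule homeomorphismI)
    show "continuous_on (u i) fst" by (intro continuous_intros)
    show "continuous_on T (\<lambda>x. (x, \<mu> i x))" by (intro continuous_intros \<mu>)
    show "fst ` u i \<subseteq> T" by (auto simp: u_def)
    show "(\<lambda>x. (x, \<mu> i x)) ` T \<subseteq> u i" using char TS by (auto simp: u_def)
    show "(fst p, \<mu> i (fst p)) = p" if "p \<in> u i" for p
      using that char[of "fst p" "snd p" i] by (auto simp: u_def)
  qed auto
  show "\<exists>T. y \<in> T \<and> openin (top_of_set S) T \<and> (\<exists>v. \<Union>v = ?C \<inter> fst -` T \<and>
    (\<forall>u\<in>v. openin (top_of_set ?C) u) \<and> pairwise disjnt v \<and> (\<forall>u\<in>v. \<exists>q. homeomorphism u T fst q))"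
  proof (intro exI[of _ T] conjI T exI[of _ "range u"])
    show "\<Union> (range u) = ?C \<inter> fst -` T" using cover by (fastforce simp: u_def)
    show "\<forall>u\<in>range u. openin (top_of_set ?C) u" using open_u by blast
    show "pairwise disjnt (range u)"
    proof (rule pairwiseI)
      fix a b assume "a \<in> range u" "b \<in> range u" "a \<noteq> b"
      then obtain i j where ij: "a = u i" "b = u j" "i \<noteq> j" by blast
      then show "disjnt a b" unfolding disjnt_iff u_def using sep by blast
    qed
    show "\<forall>u\<in>range u. \<exists>q. homeomorphism u T fst q" using homeo by blast
  qed
qed

text \<open>
  Sections of the covering by eigenvalues, one for each eigenvalue at a base point. By uniqueness of
  lifts they stay distinct everywhere, and so they exhaust the spectrum.
\<close>
theorem continuous_eigenvalue_branches:
  fixes B :: "'a::real_normed_vector \<Rightarrow> complex^'n^'n"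
  assumes cont: "continuous_on S B" and B: "\<And>x. x \<in> S \<Longrightarrow> normal_multiplicity_free (B x)"
    and S: "simply_connected S" "locally path_connected S" "S \<noteq> {}"
  obtains l :: "'n \<Rightarrow> 'a \<Rightarrow> complex" where "\<And>i. continuous_on S (l i)"
    "\<And>x. x \<in> S \<Longrightarrow> inj (\<lambda>i. l i x)" "\<And>x. x \<in> S \<Longrightarrow> range (\<lambda>i. l i x) = eigenvalues (B x)"
proof -
  let ?C = "{(x, c). x \<in> S \<and> c \<in> eigenvalues (B x)}"
  note cov = eigenvalue_covering[OF cont B]
  obtain z where z: "z \<in> S" using S(3) by blast
  obtain l0 :: "'n \<Rightarrow> complex" and v where l0: "inj l0" "range l0 = eigenvalues (B z)"
    "\<And>i. B z *v v i = l0 i *s v i" "\<And>i j. hinner (v i) (v j) = (if i = j then 1 else 0)"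
    using normal_multiplicity_free_eigenbasis[of "B z"] B[OF z] unfolding normal_multiplicity_free_def by blast
  have "\<exists>g. continuous_on S g \<and> g \<in> S \<rightarrow> ?C \<and> g z = (z, l0 i) \<and> (\<forall>y\<in>S. fst (g y) = y)" for i
  proof -
    have "(z, l0 i) \<in> ?C" using z l0(2) by auto
    then obtain g where "continuous_on S g" "g \<in> S \<rightarrow> ?C" "g z = (z, l0 i)" "\<And>y. y \<in> S \<Longrightarrow> fst (g y) = y"
      using covering_space_lift_strong[OF cov _ z S(1,2) continuous_on_id, of "(z, l0 i)"] by auto
    then show ?thesis by (intro exI[of _ g] conjI ballI) auto
  qed
  then have "\<forall>i. \<exists>g. continuous_on S g \<and> g \<in> S \<rightarrow> ?C \<and> g z = (z, l0 i) \<and> (\<forall>y\<in>S. fst (g y) = y)" ..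
  from choice[OF this] obtain g where g0: "\<forall>i. continuous_on S (g i) \<and> g i \<in> S \<rightarrow> ?C
      \<and> g i z = (z, l0 i) \<and> (\<forall>y\<in>S. fst (g i y) = y)" by (elim exE)
  have g: "continuous_on S (g i)" "g i \<in> S \<rightarrow> ?C" "g i z = (z, l0 i)" for i
    using spec[OF g0, of i] by simp_all
  have g4: "fst (g i y) = y" if "y \<in> S" for i y
    using spec[OF g0, of i] that by simp
  define l where "l = (\<lambda>i x. snd (g i x))"
  have gl: "g i x = (x, l i x)" if "x \<in> S" for i x using g4[OF that, of i] by (metis l_def prod.collapse)
  have contl: "continuous_on S (l i)" for i unfolding l_def by (intro continuous_intros g)
  have inj: "inj (\<lambda>i. l i x)" if x: "x \<in> S" for x
  proof (rule injI)
    fix i j assume eq: "l i x = l j x"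
    have "g i z = g j z"
      by (rule covering_space_lift_unique[OF cov, of "g i" x "g j" S "\<lambda>x. x" z])
        (simp_all add: eq x gl g g4 z continuous_on_id continuous_on_Pair contl simply_connected_imp_connected[OF S(1)] del: mem_Collect_eq)
    then show "i = j" using l0(1) by (simp add: g(3) inj_eq)
  qed
  have mem: "l i x \<in> eigenvalues (B x)" if "x \<in> S" for i x
    using g(2)[of i] that gl[OF that, of i] by (auto simp: Pi_iff)
  have "range (\<lambda>i. l i x) = eigenvalues (B x)" if x: "x \<in> S" for x
  proof (rule card_subset_eq)
    have card: "card (eigenvalues (B x)) = CARD('n)" using B[OF x] by (simp add: normal_multiplicity_free_def)
    then show "finite (eigenvalues (B x))" by (simp add: card_ge_0_finite)
    show "card (range (\<lambda>i. l i x)) = card (eigenvalues (B x))" using inj[OF x] card by (simp add: card_image)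
  qed (use mem[OF x] in auto)
  with contl inj show ?thesis by (rule that)
qed

section \<open>Sections of line fields\<close>

text \<open>
  The orthogonal projections onto complex lines. A line field is given by its projections because these,
  unlike unit vectors in the lines, involve no choice of a phase.
\<close>
definition line_projection :: "complex^'n^'n \<Rightarrow> bool"
  where "line_projection Q \<longleftrightarrow> (\<exists>v. norm v = 1 \<and> (\<forall>w. Q *v w = hinner w v *s v))"

lemma line_projection_idem:
  assumes "line_projection Q"
  shows "Q *v (Q *v w) = Q *v w"
  using assms by (auto simp: line_projection_def hinner_scale_left hinner_self)

lemma line_projection_eq_hinner:
  assumes Q: "line_projection Q" and u: "norm u = 1" "Q *v u = u"
  shows "Q *v w = hinner w u *s u"
proof -
  obtain v where v: "norm v = 1" "\<And>w. Q *v w = hinner w v *s v"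
    using Q by (auto simp: line_projection_def)
  define c where "c = hinner u v"
  have uv: "u = c *s v" using u(2) v(2)[of u] by (simp add: c_def)
  then have "cmod c = 1" using u(1) v(1) by (simp add: norm_scale_vec)
  then have "c * cnj c = 1" by (simp add: complex_norm_square[symmetric])
  then show ?thesis by (simp add: uv v(2) hinner_scale_right mult_ac)
qed

lemma continuous_on_matrix_vector:
  fixes Q :: "'a::topological_space \<Rightarrow> complex^'n^'m"
  assumes "continuous_on S Q" "continuous_on S u"
  shows "continuous_on S (\<lambda>x. Q x *v u x)"
  unfolding matrix_vector_mult_def using assms by (intro continuous_intros continuous_on_vec_lambda)

lemma continuous_on_hinner:
  fixes u v :: "'a::topological_space \<Rightarrow> complex^'n"
  assumes "continuous_on S u" "continuous_on S v"
  shows "continuous_on S (\<lambda>x. hinner (u x) (v x))"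
  unfolding hinner_def using assms by (intro continuous_intros)

lemma continuous_on_scale_vec:
  fixes v :: "'a::topological_space \<Rightarrow> complex^'n"
  assumes "continuous_on S c" "continuous_on S v"
  shows "continuous_on S (\<lambda>x. c x *s v x)"
  unfolding vector_scalar_mult_def using assms by (intro continuous_intros continuous_on_vec_lambda)

text \<open>
  Along a fine subdivision of the interval, project the section found at one time to the line of the next
  time. Consecutive projections differ by less than one in norm, uniformly by compactness, so
  the projected vectors do not vanish and can be normalized.
\<close>
lemma line_field_section_homotopy:
  fixes Q :: "real \<times> 'a::metric_space \<Rightarrow> complex^'n^'n"
  assumes K: "compact K" and cont: "continuous_on ({0..1} \<times> K) Q"
    and Q: "\<And>p. p \<in> {0..1} \<times> K \<Longrightarrow> line_projection (Q p)"
    and start: "\<And>x. x \<in> K \<Longrightarrow> Q (0, x) = Q0"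
  shows "\<exists>u. continuous_on K u \<and> (\<forall>x\<in>K. norm (u x) = 1 \<and> Q (1, x) *v u x = u x)"
proof (cases "K = {}")
  case False
  have "uniformly_continuous_on ({0..1} \<times> K) Q"
    by (intro compact_uniformly_continuous cont compact_Times K compact_Icc)
  then obtain d where d: "d > 0"
    "\<And>p q. p \<in> {0..1} \<times> K \<Longrightarrow> q \<in> {0..1} \<times> K \<Longrightarrow> dist q p < d \<Longrightarrow> dist (Q q) (Q p) < 1"
    unfolding uniformly_continuous_on_def by (metis zero_less_one)
  obtain N :: nat where N: "1 / d < N" using reals_Archimedean2 by blast
  have N0: "N > 0" using N d(1) by (metis less_trans of_nat_0_less_iff zero_less_divide_1_iff)
  have step: "1 / N < d" using N d(1) N0 by (simp add: field_simps)
  have "n \<le> N \<Longrightarrow> \<exists>u. continuous_on K u \<and> (\<forall>x\<in>K. norm (u x) = 1 \<and> Q (n / N, x) *v u x = u x)" for n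
  proof (induction n)
    case 0
    obtain x0 where x0: "x0 \<in> K" using False by blast
    then have "line_projection Q0" using Q[of "(0, x0)"] start by simp
    then obtain v where v: "norm v = 1" "\<And>w. Q0 *v w = hinner w v *s v" by (auto simp: line_projection_def)
    then have "Q0 *v v = v" by (simp add: hinner_self)
    then show ?case using v(1) start by (intro exI[of _ "\<lambda>_. v"]) auto
  next
    case (Suc n)
    then obtain u where u: "continuous_on K u" "\<And>x. x \<in> K \<Longrightarrow> norm (u x) = 1 \<and> Q (n / N, x) *v u x = u x"
      by auto
    let ?t = "real (Suc n) / N"
    define y where "y = (\<lambda>x. Q (?t, x) *v u x)"
    have t: "?t \<in> {0..1}" "n / N \<in> {0..1}" using Suc.prems N0 by (auto simp: field_simps)
    have cont_y: "continuous_on K y" unfolding y_def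
      by (intro continuous_on_matrix_vector u(1) continuous_on_compose2[OF cont])
        (use t in \<open>auto intro!: continuous_intros\<close>)
    have nz: "y x \<noteq> 0" if x: "x \<in> K" for x
    proof
      assume "y x = 0"
      have "?t - n / N = 1 / N" using N0 by (simp add: field_simps)
      then have "dist (?t, x) (n / N, x) = 1 / N" by (simp add: dist_Pair_Pair dist_real_def del: of_nat_Suc)
      then have "dist (Q (?t, x)) (Q (n / N, x)) < 1" using d(2) step t x by simp
      moreover have "norm ((Q (n / N, x) - Q (?t, x)) *v u x) \<le> norm (Q (n / N, x) - Q (?t, x)) * norm (u x)"
        by (rule norm_matrix_vector_le)
      moreover have "(Q (n / N, x) - Q (?t, x)) *v u x = u x"
        using u(2)[OF x] \<open>y x = 0\<close> by (simp add: matrix_vector_mult_diff_rdistrib y_def)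
      ultimately show False using u(2)[OF x] by (simp add: dist_norm norm_minus_commute)
    qed
    have fixy: "Q (?t, x) *v y x = y x" if "x \<in> K" for x
      unfolding y_def by (rule line_projection_idem[OF Q]) (use t that in auto)
    define w where "w = (\<lambda>x. complex_of_real (1 / norm (y x)) *s y x)"
    have "continuous_on K w" unfolding w_def
      by (intro continuous_on_scale_vec cont_y continuous_intros) (use nz in auto)
    moreover have "norm (w x) = 1 \<and> Q (?t, x) *v w x = w x" if "x \<in> K" for x
      unfolding w_def vector_scalar_commute fixy[OF that]
      using nz[OF that] by (simp add: norm_scale_vec norm_divide)
    ultimately show ?case by blast
  qed
  from this[of N] N0 show ?thesis by auto
qed auto

text \<open>
  The hemisphere contracts to its pole \<open>e\<close> along great circles.
\<close>
lemma line_field_section_hemisphere: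
  fixes P :: "'a::euclidean_space \<Rightarrow> complex^'n^'n"
  assumes cont: "continuous_on (sphere 0 1) P" and P: "\<And>x. norm x = 1 \<Longrightarrow> line_projection (P x)"
    and e: "norm e = 1"
  shows "\<exists>u. continuous_on {x \<in> sphere 0 1. e \<bullet> x \<ge> 0} u \<and>
    (\<forall>x\<in>{x \<in> sphere 0 1. e \<bullet> x \<ge> 0}. norm (u x) = 1 \<and> P x *v u x = u x)"
proof -
  let ?K = "{x \<in> sphere 0 1. e \<bullet> x \<ge> 0}"
  define h where "h = (\<lambda>(t, x). (1 - t) *\<^sub>R e + t *\<^sub>R x)"
  have ee: "e \<bullet> e = 1" using e by (simp add: dot_square_norm)
  have nz: "h p \<noteq> 0" if "p \<in> {0..1} \<times> ?K" for p
  proof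
    assume "h p = 0"
    obtain t x where p: "p = (t, x)" "0 \<le> t" "t \<le> 1" "norm x = 1" "e \<bullet> x \<ge> 0" using \<open>p \<in> _\<close> by auto
    have "e \<bullet> h p = (1 - t) + t * (e \<bullet> x)" unfolding h_def p by (simp add: inner_add_right ee)
    then have "(1 - t) + t * (e \<bullet> x) = 0" using \<open>h p = 0\<close> by simp
    moreover have "t * (e \<bullet> x) \<ge> 0" using p by simp
    ultimately have "t = 1" using p by linarith
    then show False using \<open>h p = 0\<close> p by (simp add: h_def)
  qed
  have K: "compact ?K"
  proof -
    have "?K = sphere 0 1 \<inter> {x. e \<bullet> x \<ge> 0}" by auto
    then show ?thesis by (metis compact_Int_closed compact_sphere closed_halfspace_ge)
  qed
  have cont_h: "continuous_on ({0..1} \<times> ?K) (\<lambda>p. sgn (h p))"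
    by (intro continuous_on_sgn) (use nz in \<open>auto simp: h_def case_prod_unfold intro!: continuous_intros\<close>)
  have "\<exists>u. continuous_on ?K u \<and> (\<forall>x\<in>?K. norm (u x) = 1 \<and> (\<lambda>p. P (sgn (h p))) (1, x) *v u x = u x)"
  proof (rule line_field_section_homotopy[OF K])
    show "continuous_on ({0..1} \<times> ?K) (\<lambda>p. P (sgn (h p)))"
      by (rule continuous_on_compose2[OF cont cont_h]) (use nz in \<open>auto simp: norm_sgn\<close>)
    show "line_projection (P (sgn (h p)))" if "p \<in> {0..1} \<times> ?K" for p
      by (rule P) (use nz[OF that] in \<open>simp add: norm_sgn\<close>)
    show "P (sgn (h (0, x))) = P (sgn e)" for x by (simp add: h_def)
  qed
  moreover have "sgn (h (1, x)) = x" if "x \<in> ?K" for x using that by (simp add: h_def sgn_div_norm)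
  ultimately show ?thesis by auto
qed

text \<open>
  Two sections over opposite hemispheres differ on the equator by a phase. The equator is
  simply connected in this dimension, so the phase has a continuous logarithm, which extends to the
  lower hemisphere and corrects the section there.
\<close>
lemma line_field_section_sphere:
  fixes P :: "'a::euclidean_space \<Rightarrow> complex^'n^'n"
  assumes cont: "continuous_on (sphere 0 1) P" and P: "\<And>x. norm x = 1 \<Longrightarrow> line_projection (P x)"
    and dim: "DIM('a) \<ge> 4"
  shows "\<exists>u. continuous_on (sphere 0 1) u \<and> (\<forall>x. norm x = 1 \<longrightarrow> norm (u x) = 1 \<and> P x *v u x = u x)"
proof -
  obtain e :: 'a where e: "e \<in> Basis" using nonempty_Basis by blast
  have ne: "norm e = 1" "norm (- e) = 1" "e \<noteq> 0" using e by auto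
  let ?U = "{x \<in> sphere 0 1. e \<bullet> x \<ge> 0}" and ?L = "{x \<in> sphere 0 1. - e \<bullet> x \<ge> 0}"
  obtain u where u: "continuous_on ?U u" "\<And>x. x \<in> ?U \<Longrightarrow> norm (u x) = 1 \<and> P x *v u x = u x"
    using line_field_section_hemisphere[OF cont P ne(1)] by blast
  obtain v where v: "continuous_on ?L v" "\<And>x. x \<in> ?L \<Longrightarrow> norm (v x) = 1 \<and> P x *v v x = v x"
    using line_field_section_hemisphere[OF cont P ne(2)] by blast
  let ?H = "{x. e \<bullet> x = 0} - {0}" and ?E = "{x \<in> sphere 0 1. e \<bullet> x = 0}"
  have sgnH: "sgn x \<in> ?U \<and> sgn x \<in> ?L" if "x \<in> ?H" for x using that by (simp add: norm_sgn sgn_div_norm)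
  define g where "g = (\<lambda>x. hinner (u (sgn x)) (v (sgn x)))"
  have trans: "u x = hinner (u x) (v x) *s v x \<and> cmod (hinner (u x) (v x)) = 1" if "x \<in> ?U" "x \<in> ?L" for x
  proof -
    have "u x = hinner (u x) (v x) *s v x"
      using line_projection_eq_hinner[of "P x" "v x" "u x"] P u(2)[OF that(1)] v(2)[OF that(2)] that by simp
    moreover from this have "norm (u x) = cmod (hinner (u x) (v x)) * norm (v x)" by (metis norm_scale_vec)
    ultimately show ?thesis using u(2)[OF that(1)] v(2)[OF that(2)] by simp
  qed
  have cont_g: "continuous_on ?H g" unfolding g_def
    by (intro continuous_on_hinner continuous_on_compose2[OF u(1)] continuous_on_compose2[OF v(1)] continuous_on_sgn continuous_on_id)
      (use sgnH in auto)
  have gnz: "g x \<noteq> 0" if "x \<in> ?H" for x using trans[of "sgn x"] sgnH[OF that] by (auto simp: g_def)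
  have sc: "simply_connected ?H"
  proof (rule simply_connected_punctured_convex[OF convex_hyperplane])
    show "3 \<le> aff_dim {x. e \<bullet> x = 0}" using ne(3) dim by simp
  qed
  have lp: "locally path_connected ?H"
    by (rule locally_open_subset[OF convex_imp_locally_path_connected[OF convex_hyperplane]])
      (auto simp: openin_open intro!: exI[of _ "- {0}"])
  obtain \<phi> where \<phi>: "continuous_on ?H \<phi>" "\<And>x. x \<in> ?H \<Longrightarrow> g x = exp (\<phi> x)"
    using continuous_logarithm_on_simply_connected[OF cont_g sc lp gnz] by blast
  have EH: "?E \<subseteq> ?H" by auto
  have cl: "closed ?E"
  proof -
    have "?E = sphere 0 1 \<inter> {x. e \<bullet> x = 0}" by auto
    then show ?thesis by (metis closed_Int closed_sphere closed_hyperplane)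
  qed
  have Eg: "g x = hinner (u x) (v x)" if "x \<in> ?E" for x using that by (simp add: g_def sgn_div_norm)
  \<comment> \<open>Tietze may produce a nonzero real part off the equator, so only \<open>Im \<psi>\<close> is used as the phase.\<close>
  obtain \<psi> where \<psi>: "continuous_on UNIV \<psi>" "\<And>x. x \<in> ?E \<Longrightarrow> \<psi> x = \<phi> x"
    using Tietze_unbounded[OF continuous_on_subset[OF \<phi>(1) EH], of UNIV] cl by (auto simp: closed_closedin[symmetric])
  have phase: "cis (Im (\<psi> x)) = hinner (u x) (v x)" if x: "x \<in> ?E" for x
  proof -
    have xs: "x \<in> ?U" "x \<in> ?L" using x by auto
    have "x \<in> ?H" using x EH by blast
    then have "exp (\<phi> x) = hinner (u x) (v x)" using Eg[OF x] \<phi>(2)[of x] by simp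
    then have "cmod (exp (\<phi> x)) = 1" using trans[OF xs] by simp
    then have "Re (\<phi> x) = 0" by simp
    then have "exp (\<phi> x) = cis (Im (\<phi> x))" by (simp add: exp_eq_polar)
    then show ?thesis using \<open>exp (\<phi> x) = hinner (u x) (v x)\<close> \<psi>(2)[OF x] by simp
  qed
  define w where "w = (\<lambda>x. cis (Im (\<psi> x)) *s v x)"
  have cont_w: "continuous_on ?L w" unfolding w_def
    by (intro continuous_on_scale_vec v(1) continuous_intros continuous_on_subset[OF \<psi>(1)]) auto
  have w: "norm (w x) = 1 \<and> P x *v w x = w x" if "x \<in> ?L" for x
    unfolding w_def using v(2)[OF that] by (simp add: norm_scale_vec vector_scalar_commute)
  have closed: "closed ?U" "closed ?L"
  proof -
    have "?U = sphere 0 1 \<inter> {x. e \<bullet> x \<ge> 0}" "?L = sphere 0 1 \<inter> {x. - e \<bullet> x \<ge> 0}" by auto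
    then show "closed ?U" "closed ?L" by (metis closed_Int closed_sphere closed_halfspace_ge)+
  qed
  have "continuous_on (?U \<union> ?L) (\<lambda>x. if e \<bullet> x \<ge> 0 then u x else w x)"
  proof (rule continuous_on_cases[OF closed u(1) cont_w])
    show "\<forall>x. x \<in> ?U \<and> \<not> 0 \<le> e \<bullet> x \<or> x \<in> ?L \<and> 0 \<le> e \<bullet> x \<longrightarrow> u x = w x"
    proof (intro allI impI)
      fix x assume "x \<in> ?U \<and> \<not> 0 \<le> e \<bullet> x \<or> x \<in> ?L \<and> 0 \<le> e \<bullet> x"
      then have "x \<in> ?E" "x \<in> ?U" "x \<in> ?L" by auto
      then show "u x = w x" unfolding w_def phase[OF \<open>x \<in> ?E\<close>] using trans by blast
    qed
  qed
  moreover have "?U \<union> ?L = sphere 0 1" by auto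
  ultimately have "continuous_on (sphere 0 1) (\<lambda>x. if e \<bullet> x \<ge> 0 then u x else w x)" by simp
  moreover have "norm (if e \<bullet> x \<ge> 0 then u x else w x) = 1 \<and>
      P x *v (if e \<bullet> x \<ge> 0 then u x else w x) = (if e \<bullet> x \<ge> 0 then u x else w x)" if "norm x = 1" for x
    using u(2)[of x] w[of x] that by auto
  ultimately show ?thesis by blast
qed

lemma cis_eq_1_imp_constant:
  fixes f :: "'a::topological_space \<Rightarrow> real"
  assumes S: "connected S" and cont: "continuous_on S f" and one: "\<And>x. x \<in> S \<Longrightarrow> cis (f x) = 1"
  shows "\<exists>n::int. \<forall>x\<in>S. f x = 2 * pi * n"
proof -
  have mult: "\<exists>n::int. f x = 2 * pi * n" if "x \<in> S" for x
  proof -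
    have "cos (f x) = 1" using arg_cong[OF one[OF that], of Re] by simp
    then obtain n :: int where "f x = real_of_int n * 2 * pi" using cos_one_2pi_int[of "f x"] by auto
    then show ?thesis by (intro exI[of _ n]) simp
  qed
  have "f constant_on S"
  proof (rule continuous_discrete_range_constant[OF S cont])
    fix x assume x: "x \<in> S"
    show "\<exists>e>0. \<forall>y. y \<in> S \<and> f y \<noteq> f x \<longrightarrow> e \<le> norm (f y - f x)"
    proof (intro exI[of _ "2 * pi"] conjI allI impI)
      fix y assume y: "y \<in> S \<and> f y \<noteq> f x"
      obtain m n :: int where mn: "f x = 2 * pi * m" "f y = 2 * pi * n" using mult[OF x] mult y by blast
      then have "n \<noteq> m" using y by auto
      then have "1 \<le> \<bar>real_of_int (n - m)\<bar>" by (metis of_int_1_le_iff of_int_abs zero_less_abs_iff right_minus_eq zless_imp_add1_zle add_0)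
      then have "2 * pi * 1 \<le> 2 * pi * \<bar>real_of_int (n - m)\<bar>" by (intro mult_left_mono) auto
      also have "\<dots> = norm (f y - f x)" unfolding mn by (simp add: abs_mult flip: right_diff_distrib)
      finally show "2 * pi \<le> norm (f y - f x)" by simp
    qed simp
  qed
  then obtain c where c: "\<And>x. x \<in> S \<Longrightarrow> f x = c" by (auto simp: constant_on_def)
  show ?thesis
  proof (cases "S = {}")
    case False
    then obtain x where "x \<in> S" by blast
    then show ?thesis using mult[of x] c by auto
  qed simp
qed

text \<open>
  The part of the period that is cut off at the left end returns at the right end.
\<close>
lemma integral_periodic_shift:
  fixes r :: "real \<Rightarrow> real"
  assumes cont: "continuous_on UNIV r" and per: "\<And>t. r (t + p) = r t" and "0 \<le> t" "t \<le> p"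
  shows "integral {0..p} (\<lambda>s. r (s + t)) = integral {0..p} r"
proof -
  have int: "r integrable_on {a..b}" for a b
    by (intro integrable_continuous_interval continuous_on_subset[OF cont]) auto
  have "integral {0..p} (\<lambda>s. r (s + t)) = integral {t..p + t} r"
    using integral_shift_real_ivl[of t t "p + t" r] by simp
  also have "\<dots> = integral {t..p} r + integral {p..p + t} r"
    using Henstock_Kurzweil_Integration.integral_combine[of t p "p + t" r] assms int by simp
  also have "integral {p..p + t} r = integral {0..t} (\<lambda>s. r (s + p))"
    using integral_shift_real_ivl[of p p "p + t" r] by simp
  also have "\<dots> = integral {0..t} r" by (simp add: per)
  also have "integral {t..p} r + integral {0..t} r = integral {0..p} r"
    using Henstock_Kurzweil_Integration.integral_combine[of 0 t p r] assms int by simp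
  finally show ?thesis .
qed

lemma of_real_scale_vec: "complex_of_real t *s (x :: complex^'k) = t *\<^sub>R x"
  by (simp add: vec_eq_iff complex_eq_iff)

text \<open>
  For a unit section \<open>u\<close> one has \<open>u (cis t x) = cis (h t x) u x\<close> with a continuous real function \<open>h\<close>, since
  the product of the line with the punctured space is simply connected. Normalized by \<open>h 0 x = 0\<close> it is an additive
  cocycle for the rotation, and its value after one turn is \<open>2\<pi>a\<close> with a constant integer \<open>a\<close>. Hence
  \<open>h s x - a s\<close> is periodic in \<open>s\<close>, and its mean \<open>m x\<close> is a phase correction that changes the cocycle into the
  linear one, \<open>a t\<close>.
\<close>
theorem equivariant_line_field_section:
  fixes P :: "complex^'k \<Rightarrow> complex^'n^'n"
  assumes card: "CARD('k) > 1" and cont: "continuous_on (- {0}) P"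
    and P: "\<And>x. x \<noteq> 0 \<Longrightarrow> line_projection (P x)"
    and inv: "\<And>x z. x \<noteq> 0 \<Longrightarrow> z \<noteq> 0 \<Longrightarrow> P (z *s x) = P x"
  shows "\<exists>u (a::int). continuous_on (- {0}) u \<and> (\<forall>x. x \<noteq> 0 \<longrightarrow> norm (u x) = 1 \<and> P x *v u x = u x) \<and>
    (\<forall>x z. x \<noteq> 0 \<longrightarrow> cmod z = 1 \<longrightarrow> u (z *s x) = (z powi a) *s u x)"
proof -
  have dim: "DIM(complex^'k) \<ge> 4" using card by simp
  obtain u0 where u0: "continuous_on (sphere 0 1) u0" "\<And>x. norm x = 1 \<Longrightarrow> norm (u0 x) = 1 \<and> P x *v u0 x = u0 x"
    using line_field_section_sphere[OF continuous_on_subset[OF cont] P dim] by force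
  define E where "E = - {0 :: complex^'k}"
  define u where "u = (\<lambda>x :: complex^'k. u0 (sgn x))"
  have sgnP: "P (sgn x) = P x" if "x \<noteq> 0" for x
  proof -
    have "sgn x = complex_of_real (1 / norm x) *s x"
      unfolding of_real_scale_vec sgn_div_norm by (simp add: inverse_eq_divide)
    then show ?thesis using inv[OF that, of "complex_of_real (1 / norm x)"] that by simp
  qed
  have cont_u: "continuous_on E u" unfolding u_def
    by (rule continuous_on_compose2[OF u0(1)]) (auto simp: E_def norm_sgn intro!: continuous_intros split: if_splits)
  have u: "norm (u x) = 1" "P x *v u x = u x" if "x \<in> E" for x
    using u0(2)[of "sgn x"] sgnP[of x] that by (auto simp: u_def norm_sgn E_def)
  have scale_E: "z *s x \<in> E" if "x \<in> E" "cmod z = 1" for x z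
  proof -
    have "norm (z *s x) = norm x" using that by (simp add: norm_scale_vec)
    then show ?thesis using that by (auto simp: E_def)
  qed
  define G where "G = (\<lambda>p :: real \<times> (complex^'k). hinner (u (cis (fst p) *s snd p)) (u (snd p)))"
  have uG: "u (cis t *s x) = G (t, x) *s u x" and G1: "cmod (G (t, x)) = 1" if x: "x \<in> E" for t x
  proof -
    have "P (cis t *s x) = P x" using inv[of x "cis t"] x by (simp add: E_def)
    then have "P x *v u (cis t *s x) = u (cis t *s x)" using u(2)[OF scale_E[OF x], of "cis t"] by simp
    then show eq: "u (cis t *s x) = G (t, x) *s u x"
      using line_projection_eq_hinner[OF P u[OF x], of "u (cis t *s x)"] x by (simp add: G_def E_def)
    have "norm (u (cis t *s x)) = 1" using u(1)[OF scale_E[OF x]] by simp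
    then show "cmod (G (t, x)) = 1" unfolding eq norm_scale_vec by (simp add: u(1)[OF x])
  qed
  let ?D = "(UNIV :: real set) \<times> E"
  have cont_G: "continuous_on ?D G" unfolding G_def
    by (intro continuous_on_hinner continuous_on_compose2[OF cont_u] continuous_on_scale_vec continuous_intros)
      (auto simp: scale_E)
  have sc_E: "simply_connected E" unfolding E_def by (rule simply_connected_punctured_universe) (use dim in simp)
  have "simply_connected ?D" by (intro simply_connected_Times sc_E convex_imp_simply_connected) simp
  moreover have "locally path_connected ?D"
    by (intro open_imp_locally_path_connected open_Times) (auto simp: E_def)
  moreover have "G p \<noteq> 0" if "p \<in> ?D" for p using G1[of "snd p" "fst p"] that by auto
  ultimately obtain \<Phi> where \<Phi>: "continuous_on ?D \<Phi>" "\<And>p. p \<in> ?D \<Longrightarrow> G p = exp (\<Phi> p)"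
    using continuous_logarithm_on_simply_connected[OF cont_G] by blast
  define h where "h = (\<lambda>t x. Im (\<Phi> (t, x)) - Im (\<Phi> (0, x)))"
  have G_cis: "G (t, x) = cis (Im (\<Phi> (t, x)))" if "x \<in> E" for t x
  proof -
    have eq: "G (t, x) = exp (\<Phi> (t, x))" using \<Phi>(2)[of "(t, x)"] that by simp
    then have "Re (\<Phi> (t, x)) = 0" using G1[OF that, of t] by simp
    then show ?thesis using eq by (simp add: exp_eq_polar)
  qed
  have G0: "G (0, x) = 1" if "x \<in> E" for x by (simp add: G_def hinner_self u(1)[OF that])
  have Gh: "G (t, x) = cis (h t x)" if "x \<in> E" for t x
    unfolding h_def using G_cis[OF that, of t] G_cis[OF that, of 0] G0[OF that] by (simp flip: cis_divide)
  have h0: "h 0 x = 0" for x by (simp add: h_def)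
  have cont_h: "continuous_on ?D (\<lambda>p. h (fst p) (snd p))" unfolding h_def
    by (intro continuous_intros continuous_on_compose2[OF \<Phi>(1)]) auto
  have cont_comp: "continuous_on T (\<lambda>y. h (f y) (g y))"
    if "continuous_on T f" "continuous_on T g" "g ` T \<subseteq> E" for T f g
  proof -
    have "continuous_on T (\<lambda>y. h (fst (f y, g y)) (snd (f y, g y)))"
      by (rule continuous_on_compose2[OF cont_h]) (use that in \<open>auto intro!: continuous_intros\<close>)
    then show ?thesis by simp
  qed
  have cocycle: "h (t + s) x = h t (cis s *s x) + h s x" if x: "x \<in> E" for t s x
  proof -
    \<comment> \<open>The cocycle identity holds modulo \<open>2\<pi>\<close>, and exactly at \<open>t = 0\<close>, hence exactly by continuity.\<close>
    let ?f = "\<lambda>t. h (t + s) x - h t (cis s *s x) - h s x"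
    note xs = scale_E[OF x, of "cis s", simplified]
    have "\<exists>n::int. \<forall>t\<in>UNIV. ?f t = 2 * pi * n"
    proof (rule cis_eq_1_imp_constant)
      show "continuous_on UNIV ?f"
        by (intro continuous_on_diff cont_comp continuous_intros) (use x xs in auto)
      show "cis (?f t) = 1" for t
      proof -
        have "G (t + s, x) *s u x = u (cis t *s (cis s *s x))"
          using uG[OF x, of "t + s"] by (simp add: cis_mult)
        also have "\<dots> = (G (t, cis s *s x) * G (s, x)) *s u x"
          using uG[OF xs, of t] uG[OF x, of s] by simp
        finally have "(G (t + s, x) - G (t, cis s *s x) * G (s, x)) *s u x = 0" by (simp add: vec_eq_iff algebra_simps)
        then have "cmod (G (t + s, x) - G (t, cis s *s x) * G (s, x)) = 0"
          using norm_scale_vec[of _ "u x"] u(1)[OF x] by (metis mult.right_neutral norm_zero)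
        then have "cis (h (t + s) x) = cis (h t (cis s *s x)) * cis (h s x)"
          using Gh[OF x] Gh[OF xs] by simp
        then show ?thesis by (simp flip: cis_divide)
      qed
    qed simp
    then obtain n :: int where n: "\<And>t. ?f t = 2 * pi * n" by auto
    have "?f 0 = 0" by (simp add: h0)
    then have "?f t = 0" using n[of 0] n[of t] by simp
    then show ?thesis by linarith
  qed
  have "\<exists>a::int. \<forall>x\<in>E. h (2 * pi) x = 2 * pi * a"
  proof (rule cis_eq_1_imp_constant)
    show "connected E" using sc_E by (rule simply_connected_imp_connected)
    show "continuous_on E (h (2 * pi))"
      by (rule cont_comp) (auto intro: continuous_intros)
    show "cis (h (2 * pi) x) = 1" if "x \<in> E" for x
      using Gh[OF that, of "2 * pi"] by (simp add: G_def hinner_self u(1)[OF that])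
  qed
  then obtain a :: int where a: "\<And>x. x \<in> E \<Longrightarrow> h (2 * pi) x = 2 * pi * a" by blast
  define m where "m = (\<lambda>x. integral {0..2*pi} (\<lambda>s :: real. h s x - a * s) / (2 * pi))"
  have cont_m: "continuous_on E m"
  proof -
    have "continuous_on E (\<lambda>x. integral (cbox 0 (2*pi)) (\<lambda>s. h s x - a * s))"
    proof (rule integral_continuous_on_param)
      have "continuous_on (E \<times> cbox 0 (2*pi)) (\<lambda>p. h (snd p) (fst p) - a * snd p)"
        by (intro continuous_on_diff cont_comp continuous_intros) auto
      then show "continuous_on (E \<times> cbox 0 (2*pi)) (\<lambda>(x, s). h s x - a * s)" by (simp add: case_prod_unfold)
    qed
    then show ?thesis unfolding m_def by (auto intro!: continuous_intros)
  qed
  have m_shift: "m (cis t *s x) = m x + a * t - h t x" if x: "x \<in> E" and t: "0 \<le> t" "t \<le> 2 * pi" for t :: real and x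
  proof -
    define r where "r = (\<lambda>s :: real. h s x - a * s)"
    have cont_r: "continuous_on UNIV r" unfolding r_def
      by (intro continuous_on_diff cont_comp continuous_intros) (use x in auto)
    have per: "r (s + 2 * pi) = r s" for s
    proof -
      have "h (s + 2 * pi) x = h s x + 2 * pi * a" using cocycle[OF x, of s "2 * pi"] a[OF x] by simp
      then show ?thesis unfolding r_def by (simp add: distrib_left)
    qed
    have "h s (cis t *s x) - a * s = r (s + t) + (a * t - h t x)" for s :: real
      unfolding r_def cocycle[OF x] by (simp add: algebra_simps)
    then have "integral {0..2*pi} (\<lambda>s :: real. h s (cis t *s x) - a * s) = integral {0..2*pi} (\<lambda>s. r (s + t) + (a * t - h t x))"
      by simp
    also have "\<dots> = integral {0..2*pi} (\<lambda>s. r (s + t)) + integral {0..2*pi} (\<lambda>s. a * t - h t x)"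
    proof (rule Henstock_Kurzweil_Integration.integral_add)
      show "(\<lambda>s. r (s + t)) integrable_on {0..2*pi}"
        by (intro integrable_continuous_interval continuous_on_compose2[OF cont_r] continuous_intros) auto
    qed (intro integrable_continuous_interval continuous_intros)
    also have "\<dots> = integral {0..2*pi} r + 2 * pi * (a * t - h t x)"
      unfolding integral_periodic_shift[OF cont_r per t] by simp
    finally show ?thesis unfolding m_def r_def by (simp add: field_simps)
  qed
  define v where "v = (\<lambda>x. cis (m x) *s u x)"
  have "continuous_on E v" unfolding v_def
    by (intro continuous_on_scale_vec cont_u continuous_intros cont_m)
  moreover have "norm (v x) = 1 \<and> P x *v v x = v x" if "x \<in> E" for x
    unfolding v_def using u[OF that] by (simp add: norm_scale_vec vector_scalar_commute)
  moreover have "v (z *s x) = (z powi a) *s v x" if x: "x \<in> E" and z: "cmod z = 1" for x z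
  proof -
    obtain t where t: "0 \<le> t" "t < 2 * pi" "z = cis t" using complex_norm_eq_1_exp[of z] z by (metis Arg2pi_ge_0 Arg2pi_lt_2pi cis_conv_exp)
    have "v (z *s x) = (cis (m (cis t *s x)) * G (t, x)) *s u x"
      unfolding v_def t(3) uG[OF x] by simp
    also have "cis (m (cis t *s x)) * G (t, x) = cis (m x + a * t)"
      unfolding Gh[OF x] m_shift[OF x t(1) less_imp_le[OF t(2)]] by (simp add: cis_mult)
    also have "\<dots> = (z powi a) * cis (m x)"
      unfolding t(3) by (simp add: cis_power_int cis_mult add.commute)
    finally show ?thesis by (simp add: v_def)
  qed
  ultimately show ?thesis unfolding E_def by blast
qed

section \<open>Equivariant eigenvector frames\<close>

text \<open>
  The Lagrange interpolation polynomial that is one at \<open>c\<close> and zero on the list, evaluated at the matrix.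
  When \<open>c\<close> is an eigenvalue and the list consists of the other ones, it is the spectral projection, and
  it visibly depends continuously on the matrix and the eigenvalues.
\<close>
primrec lagrange_matrix :: "complex^'n^'n \<Rightarrow> complex \<Rightarrow> complex list \<Rightarrow> complex^'n^'n"
  where
    "lagrange_matrix M c [] = mat 1"
  | "lagrange_matrix M c (d # ds) =
      (\<chi> r s. ((M ** lagrange_matrix M c ds) $ r $ s - d * lagrange_matrix M c ds $ r $ s) / (c - d))"

lemma lagrange_matrix_Cons_mult:
  "lagrange_matrix M c (d # ds) *v w
   = (1 / (c - d)) *s (M *v (lagrange_matrix M c ds *v w) - d *s (lagrange_matrix M c ds *v w))"
  unfolding matrix_vector_mul_assoc
  by (simp add: vec_eq_iff matrix_vector_mult_def sum_subtractf sum_distrib_left algebra_simps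
    diff_divide_distrib sum_divide_distrib)

lemma hinner_lagrange_matrix:
  assumes normal: "M ** conj_transpose M = conj_transpose M ** M" and v: "M *v v = k *s v"
  shows "hinner (lagrange_matrix M c ds *v w) v = prod_list (map (\<lambda>d. (k - d) / (c - d)) ds) * hinner w v"
proof (induction ds)
  case (Cons d ds)
  have "hinner (lagrange_matrix M c (d # ds) *v w) v
      = (k - d) / (c - d) * hinner (lagrange_matrix M c ds *v w) v"
    unfolding lagrange_matrix_Cons_mult
    by (simp add: hinner_scale_left hinner_diff_left hinner_adjoint[of M] normal_eigenvector_adjoint[OF normal v]
      hinner_scale_right left_diff_distrib diff_divide_distrib)
  then show ?case using Cons by simp
qed simp

lemma lagrange_matrix_eigenprojection:
  fixes M :: "complex^'n^'n" and l :: "'n \<Rightarrow> complex"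
  assumes normal: "M ** conj_transpose M = conj_transpose M ** M"
    and inj: "inj l" and ran: "range l = eigenvalues M" and js: "set js = UNIV - {i}"
  shows "line_projection (lagrange_matrix M (l i) (map l js))"
    and "lagrange_matrix M (l i) (map l js) *v u = u \<Longrightarrow> M *v u = l i *s u"
proof -
  let ?P = "lagrange_matrix M (l i) (map l js)"
  obtain v where v: "\<And>i. M *v v i = l i *s v i" "\<And>i j. hinner (v i) (v j) = (if i = j then 1 else 0)"
    using normal_eigenbasis_of_enumeration[OF normal inj ran] by blast
  have P: "?P *v w = hinner w (v i) *s v i" for w
  proof (rule orthonormal_eq_iff[OF v(2)])
    fix k
    have "prod_list (map (\<lambda>d. (l k - d) / (l i - d)) (map l js)) = (if k = i then 1 else 0)"
    proof (cases "k = i")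
      case True
      have "l i \<noteq> l j" if "j \<in> set js" for j using that js inj by (auto dest: injD)
      then have "map (\<lambda>d. (l i - d) / (l i - d)) (map l js) = map (\<lambda>_. 1) js" by simp
      then show ?thesis using True by (simp add: map_replicate_const)
    next
      case False
      then have "k \<in> set js" using js by simp
      then have "0 \<in> set (map (\<lambda>d. (l k - d) / (l i - d)) (map l js))" by (auto intro!: rev_image_eqI)
      then show ?thesis using False by (simp add: prod_list_zero_iff)
    qed
    then show "hinner (?P *v w) (v k) = hinner (hinner w (v i) *s v i) (v k)"
      unfolding hinner_lagrange_matrix[OF normal v(1)] by (simp add: hinner_scale_left v(2))
  qed
  have "(norm (v i))\<^sup>2 = 1" using v(2)[of i i] unfolding hinner_self by (simp del: of_real_power)
  then have "norm (v i) = 1" by (simp add: power2_eq_1_iff) (smt (verit) norm_ge_zero)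
  then show "line_projection ?P" unfolding line_projection_def using P by blast
  show "M *v u = l i *s u" if "?P *v u = u"
  proof -
    have "u = hinner u (v i) *s v i" using P[of u] that by simp
    then show ?thesis by (metis v(1) vector_scalar_commute vector_smult_assoc mult.commute)
  qed
qed

lemma continuous_on_lagrange_matrix:
  fixes B :: "'a::topological_space \<Rightarrow> complex^'n^'n"
  assumes "continuous_on S B" and "\<And>j. continuous_on S (l j)"
    and "\<And>x j. x \<in> S \<Longrightarrow> j \<in> set js \<Longrightarrow> l i x \<noteq> l j x"
  shows "continuous_on S (\<lambda>x. lagrange_matrix (B x) (l i x) (map (\<lambda>j. l j x) js))"
  using assms(3)
proof (induction js)
  case (Cons j js)
  then have "continuous_on S (\<lambda>x. lagrange_matrix (B x) (l i x) (map (\<lambda>j. l j x) js))" by simp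
  with Cons.prems show ?case unfolding list.map lagrange_matrix.simps matrix_matrix_mult_def vec_lambda_beta
    by (intro continuous_on_vec_lambda continuous_intros assms) auto
qed (simp add: continuous_on_const)

text \<open>
  On a complex line the eigenvalue functions are continuous with values in a fixed finite set and thus
  constant, so the spectral projections are invariant under nonzero scalars.
\<close>
lemma equivariant_eigensections:
  fixes B :: "complex^'k \<Rightarrow> complex^'n^'n"
  assumes card: "CARD('k) > 1" and cont: "continuous_on (- {0}) B"
    and B: "\<And>x. x \<noteq> 0 \<Longrightarrow> normal_multiplicity_free (B x)"
    and inv: "\<And>x z. x \<noteq> 0 \<Longrightarrow> z \<noteq> 0 \<Longrightarrow> B (z *s x) = B x"
  obtains l :: "'n \<Rightarrow> complex^'k \<Rightarrow> complex" and u and a :: "'n \<Rightarrow> int" where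
    "\<And>x. x \<noteq> 0 \<Longrightarrow> inj (\<lambda>i. l i x)"
    "\<And>i. continuous_on (- {0}) (u i)"
    "\<And>i x. x \<noteq> 0 \<Longrightarrow> norm (u i x) = 1 \<and> B x *v u i x = l i x *s u i x"
    "\<And>i x z. x \<noteq> 0 \<Longrightarrow> cmod z = 1 \<Longrightarrow> u i (z *s x) = (z powi a i) *s u i x"
proof -
  have dim: "3 \<le> DIM(complex^'k)" using card by simp
  have sc: "simply_connected (- {0 :: complex^'k})" by (rule simply_connected_punctured_universe[OF dim])
  have lp: "locally path_connected (- {0 :: complex^'k})" by (rule open_imp_locally_path_connected) auto
  have "(1 :: complex^'k) \<in> - {0}" by simp
  then have ne: "- {0 :: complex^'k} \<noteq> {}" by blast
  obtain l :: "'n \<Rightarrow> complex^'k \<Rightarrow> complex" where l: "\<And>i. continuous_on (- {0}) (l i)"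
    "\<And>x. x \<in> - {0} \<Longrightarrow> inj (\<lambda>i. l i x)" "\<And>x. x \<in> - {0} \<Longrightarrow> range (\<lambda>i. l i x) = eigenvalues (B x)"
    using continuous_eigenvalue_branches[OF cont _ sc lp ne] B by (metis ComplD insertI1)
  have linv: "l i (z *s x) = l i x" if x: "x \<noteq> 0" and z: "z \<noteq> 0" for i x z
  proof -
    have "(\<lambda>z. l i (z *s x)) constant_on (- {0})"
    proof (rule continuous_finite_range_constant)
      show "connected (- {0 :: complex})" by (rule connected_punctured_universe) simp
      show "continuous_on (- {0}) (\<lambda>z. l i (z *s x))"
        by (rule continuous_on_compose2[OF l(1)]) (use x in \<open>auto intro!: continuous_on_scale_vec continuous_intros\<close>)
      have "(\<lambda>z. l i (z *s x)) ` (- {0}) \<subseteq> eigenvalues (B x)"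
      proof
        fix c assume "c \<in> (\<lambda>z. l i (z *s x)) ` (- {0})"
        then obtain z where z: "z \<noteq> 0" "c = l i (z *s x)" by auto
        then have "c \<in> eigenvalues (B (z *s x))" using l(3)[of "z *s x"] x by auto
        then show "c \<in> eigenvalues (B x)" using inv[OF x z(1)] by simp
      qed
      moreover have "finite (eigenvalues (B x))"
        using B[OF x] by (simp add: normal_multiplicity_free_def card_ge_0_finite)
      ultimately show "finite ((\<lambda>z. l i (z *s x)) ` (- {0}))" by (rule finite_subset)
    qed
    then obtain c where "\<And>z. z \<noteq> 0 \<Longrightarrow> l i (z *s x) = c" by (auto simp: constant_on_def)
    from this[OF z] this[of 1] show ?thesis by simp
  qed
  define good where "good = (\<lambda>i u (a :: int). continuous_on (- {0}) u \<and>
    (\<forall>x. x \<noteq> 0 \<longrightarrow> norm (u x) = 1 \<and> B x *v u x = l i x *s u x) \<and>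
    (\<forall>x z. x \<noteq> 0 \<longrightarrow> cmod z = 1 \<longrightarrow> u (z *s x) = (z powi a) *s u x))"
  have "\<exists>u a. good i u a" for i
  proof -
    obtain js where js: "set js = UNIV - {i}" using finite_list[of "UNIV - {i}"] by auto
    define P where "P = (\<lambda>x. lagrange_matrix (B x) (l i x) (map (\<lambda>j. l j x) js))"
    have contP: "continuous_on (- {0}) P" unfolding P_def
    proof (rule continuous_on_lagrange_matrix[OF cont l(1)])
      fix x j assume "x \<in> - {0 :: complex^'k}" "j \<in> set js"
      then show "l i x \<noteq> l j x" using l(2)[of x] js by (auto dest: injD)
    qed
    have P: "line_projection (P x)" "P x *v w = w \<Longrightarrow> B x *v w = l i x *s w" if x: "x \<noteq> 0" for x w
    proof -
      have nm: "B x ** conj_transpose (B x) = conj_transpose (B x) ** B x"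
        using B[OF x] by (simp add: normal_multiplicity_free_def)
      note lm = lagrange_matrix_eigenprojection[OF nm l(2) l(3) js]
      show "line_projection (P x)" unfolding P_def using lm(1) x by simp
      show "P x *v w = w \<Longrightarrow> B x *v w = l i x *s w" unfolding P_def using lm(2) x by simp
    qed
    have Pinv: "P (z *s x) = P x" if "x \<noteq> 0" "z \<noteq> 0" for x z
      unfolding P_def using inv[OF that] linv[OF that] by simp
    have "\<exists>u (a::int). continuous_on (- {0}) u \<and> (\<forall>x. x \<noteq> 0 \<longrightarrow> norm (u x) = 1 \<and> P x *v u x = u x) \<and>
      (\<forall>x z. x \<noteq> 0 \<longrightarrow> cmod z = 1 \<longrightarrow> u (z *s x) = (z powi a) *s u x)"
      by (rule equivariant_line_field_section[OF card contP P(1) Pinv])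
    then obtain u and a :: int where "continuous_on (- {0}) u"
      "\<forall>x. x \<noteq> 0 \<longrightarrow> norm (u x) = 1 \<and> P x *v u x = u x"
      "\<forall>x z. x \<noteq> 0 \<longrightarrow> cmod z = 1 \<longrightarrow> u (z *s x) = (z powi a) *s u x"
      by (elim exE conjE)
    then show ?thesis using P(2) unfolding good_def by (intro exI[of _ u] exI[of _ a]) auto
  qed
  then obtain u a where ua: "\<And>i. good i (u i) (a i)" by metis
  show ?thesis
  proof (rule that)
    show "inj (\<lambda>i. l i x)" if "x \<noteq> 0" for x using l(2) that by simp
    fix i
    note uai = ua[of i, unfolded good_def]
    show "continuous_on (- {0}) (u i)" using uai by simp
    show "norm (u i x) = 1 \<and> B x *v u i x = l i x *s u i x" if "x \<noteq> 0" for x using uai that by simp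
    show "u i (z *s x) = (z powi a i) *s u i x" if "x \<noteq> 0" "cmod z = 1" for x z using uai that by simp
  qed
qed

section \<open>Diagonalization over projective space\<close>

lemma span_singleton_vec: "vec.span {v :: complex^'k} = range (\<lambda>c. c *s v)"
  by (rule vec.span_singleton)

lemma span_singleton_eq_iff:
  fixes v w :: "complex^'k"
  assumes "v \<noteq> 0" "w \<noteq> 0"
  shows "vec.span {v} = vec.span {w} \<longleftrightarrow> (\<exists>c. c \<noteq> 0 \<and> w = c *s v)"
proof
  assume "vec.span {v} = vec.span {w}"
  then have "w \<in> vec.span {v}" by (simp add: vec.span_base)
  then show "\<exists>c. c \<noteq> 0 \<and> w = c *s v" using assms(2) by (auto simp: span_singleton_vec)
next
  assume "\<exists>c. c \<noteq> 0 \<and> w = c *s v"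
  then obtain c where c: "c \<noteq> 0" "w = c *s v" by blast
  show "vec.span {v} = vec.span {w}"
  proof (intro equalityI)
    have "v = (1 / c) *s w" using c by simp
    then have "v \<in> vec.span {w}" unfolding span_singleton_vec by blast
    then show "vec.span {v} \<subseteq> vec.span {w}" by (simp add: vec.span_minimal)
    have "w \<in> vec.span {v}" unfolding span_singleton_vec c(2) by blast
    then show "vec.span {w} \<subseteq> vec.span {v}" by (simp add: vec.span_minimal)
  qed
qed

lemma topspace_complex_projective_space:
  "topspace complex_projective_space = (\<lambda>v. vec.span {v}) ` (- {0 :: complex^'k})"
  by (simp add: complex_projective_space_def)

lemma matrix_vector_axis: "(M :: complex^'n^'m) *v axis j 1 = (\<chi> i. M $ i $ j)"
proof -
  have "(\<Sum>k\<in>UNIV. M $ i $ k * (if k = j then 1 else 0)) = M $ i $ j" for i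
    by (subst sum.remove[of _ j]) auto
  then show ?thesis by (simp add: vec_eq_iff matrix_vector_mult_def axis_def)
qed

theorem proposition2p4:
  fixes A :: "(complex^'k) set \<Rightarrow> complex^'n^'n"
    and m :: nat
  assumes "CARD('k) = m + 1"
    and "m > 1"
    and "continuous_map (complex_projective_space :: (complex^'k) set topology) euclidean A"
    and "normal_over complex_projective_space A"
    and "multiplicity_free_over complex_projective_space A"
  shows "diagonalizable_over complex_projective_space A"
proof -
  let ?q = "\<lambda>v :: complex^'k. vec.span {v}"
  have card: "CARD('k) > 2" "CARD('k) > 1" using assms(1,2) by auto
  have quot: "quotient_map (top_of_set (- {0})) complex_projective_space ?q"
    unfolding complex_projective_space_def by (rule quotient_map_quotient_topology)
  define B where "B = (\<lambda>x. A (?q x))"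
  have "continuous_map (top_of_set (- {0})) euclidean (A \<circ> ?q)"
    using quotient_imp_continuous_map[OF quot] assms(3) by (rule continuous_map_compose)
  then have contB: "continuous_on (- {0}) B" by (simp add: B_def o_def)
  have q_top: "?q x \<in> topspace complex_projective_space" if "x \<noteq> 0" for x
    using that by (simp add: topspace_complex_projective_space)
  have nmf: "normal_multiplicity_free (B x)" if "x \<noteq> 0" for x
    using q_top[OF that] assms(4,5)
    by (simp add: B_def normal_multiplicity_free_def normal_over_def multiplicity_free_over_def)
  have inv: "B (z *s x) = B x" if "x \<noteq> 0" "z \<noteq> 0" for x z
  proof -
    have "z *s x \<noteq> 0" using that by simp
    then have "?q x = ?q (z *s x)" using that span_singleton_eq_iff[of x "z *s x"] by blast
    then show ?thesis by (simp add: B_def)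
  qed
  obtain l :: "'n \<Rightarrow> complex^'k \<Rightarrow> complex" and u and a :: "'n \<Rightarrow> int" where
    l: "\<And>x. x \<noteq> 0 \<Longrightarrow> inj (\<lambda>i. l i x)" and
    contu: "\<And>i. continuous_on (- {0}) (u i)" and
    u: "\<And>i x. x \<noteq> 0 \<Longrightarrow> norm (u i x) = 1 \<and> B x *v u i x = l i x *s u i x" and
    weight: "\<And>i x z. x \<noteq> 0 \<Longrightarrow> cmod z = 1 \<Longrightarrow> u i (z *s x) = (z powi a i) *s u i x"
    using equivariant_eigensections[OF card(2) contB nmf inv] by blast
  have orthonormal: "hinner (u i x) (u j x) = (if i = j then 1 else 0)" if x: "x \<noteq> 0" for i j x
  proof (cases "i = j")
    case True then show ?thesis using u[OF x] by (simp add: hinner_self)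
  next
    case False
    then have neq: "l i x \<noteq> l j x" using l[OF x] by (auto dest: injD)
    have "B x ** conj_transpose (B x) = conj_transpose (B x) ** B x"
      using nmf[OF x] by (simp add: normal_multiplicity_free_def)
    then have "hinner (u i x) (u j x) = 0"
      by (rule normal_eigenvectors_orthogonal[OF _ conjunct2[OF u[OF x]] conjunct2[OF u[OF x]] neq])
    then show ?thesis using False by simp
  qed
  define U where "U = (\<lambda>x. column_matrix (\<lambda>i. u i x))"
  have contU: "continuous_on (- {0}) U"
    unfolding U_def column_matrix_def by (intro continuous_on_vec_lambda continuous_on_component contu)
  have unitary: "conj_transpose (U x) ** U x = mat 1" "U x ** conj_transpose (U x) = mat 1" if "x \<noteq> 0" for x
    unfolding U_def using orthonormal_column_matrix_unitary[OF orthonormal[OF that]] by auto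
  have zero: "a i = 0" for i
  proof (rule equivariant_isometry_weights_zero[OF card(1)])
    show "continuous_on (sphere 0 1) U" by (rule continuous_on_subset[OF contU]) auto
    show "U (z *s x) $ r $ i = z powi a i * U x $ r $ i" if "norm x = 1" "cmod z = 1" for x z r i
    proof -
      have "x \<noteq> 0" using that by auto
      then show ?thesis by (simp add: U_def column_matrix_def weight[OF _ that(2)])
    qed
    show "norm (U x *v v) = norm v" if "norm x = 1" for x v
    proof -
      have "x \<noteq> 0" using that by auto
      then show ?thesis by (intro isometry_of_gram unitary)
    qed
  qed
  define W where "W = (\<lambda>L. U (sgn (SOME v. v \<noteq> 0 \<and> ?q v = L)))"
  have W: "W (?q x) = U (sgn x)" if x: "x \<noteq> 0" for x
  proof -
    define v where "v = (SOME v. v \<noteq> 0 \<and> ?q v = ?q x)"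
    have v: "v \<noteq> 0 \<and> ?q v = ?q x" unfolding v_def by (rule someI[of _ x]) (use x in simp)
    then obtain c where c: "c \<noteq> 0" "v = c *s x" using span_singleton_eq_iff[of x v] x by auto
    have "sgn v = sgn c *s sgn x"
      unfolding c(2) sgn_div_norm norm_scale_vec by (simp add: vec_eq_iff complex_eq_iff field_simps)
    moreover have "cmod (sgn c) = 1" using c(1) by (simp add: norm_sgn)
    moreover have "sgn x \<noteq> 0" using x by (simp add: sgn_zero_iff)
    ultimately have "U (sgn v) = U (sgn x)" by (simp add: U_def weight zero)
    then show ?thesis by (simp add: W_def v_def)
  qed
  show ?thesis unfolding diagonalizable_over_def
  proof (intro exI[of _ W] conjI ballI)
    have "continuous_on (- {0}) (\<lambda>x. U (sgn x))"
      by (rule continuous_on_compose2[OF contU]) (auto intro!: continuous_intros simp: sgn_zero_iff)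
    then have "continuous_on (- {0}) (\<lambda>x. W (?q x))"
      by (rule continuous_on_eq) (simp add: W)
    then have "continuous_map (top_of_set (- {0})) euclidean (W \<circ> ?q)" by (simp add: o_def)
    then show "continuous_map complex_projective_space euclidean W"
      using continuous_compose_quotient_map_eq[OF quot] by blast
    have pt: "\<exists>x. x \<noteq> 0 \<and> L = ?q x" if "L \<in> topspace complex_projective_space" for L
      using that by (auto simp: topspace_complex_projective_space)
    show "unitary_over complex_projective_space W" unfolding unitary_over_def
    proof (intro ballI)
      fix L :: "(complex^'k) set" assume "L \<in> topspace complex_projective_space"
      then obtain x where x: "x \<noteq> 0" "L = ?q x" using pt by blast
      then show "conj_transpose (W L) ** W L = mat 1 \<and> W L ** conj_transpose (W L) = mat 1"
        using unitary[of "sgn x"] by (simp add: W sgn_zero_iff)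
    qed
    fix L :: "(complex^'k) set" assume "L \<in> topspace complex_projective_space"
    then obtain x where x: "x \<noteq> 0" "L = ?q x" using pt by blast
    define y where "y = sgn x"
    have y: "y \<noteq> 0" using x(1) by (simp add: y_def sgn_zero_iff)
    have "y = complex_of_real (1 / norm x) *s x" unfolding y_def of_real_scale_vec sgn_div_norm by (simp add: inverse_eq_divide)
    then have By: "B y = A L" using inv[OF x(1), of "complex_of_real (1 / norm x)"] x by (simp add: B_def)
    have "(conj_transpose (U y) ** A L ** U y) $ i $ j = l j y * hinner (u j y) (u i y)" for i j
    proof -
      have "(conj_transpose (U y) ** A L ** U y) $ i $ j = ((conj_transpose (U y) ** A L ** U y) *v axis j 1) $ i"
        by (simp only: matrix_vector_axis vec_lambda_beta)
      also have "\<dots> = (conj_transpose (U y) *v (A L *v (U y *v axis j 1))) $ i"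
        by (simp add: matrix_vector_mul_assoc matrix_mul_assoc)
      also have "U y *v axis j 1 = u j y"
        by (simp add: matrix_vector_axis U_def column_matrix_def)
      also have "A L *v u j y = l j y *s u j y" using u[OF y] By by simp
      also have "(conj_transpose (U y) *v (l j y *s u j y)) $ i = l j y * hinner (u j y) (u i y)"
        unfolding U_def by (simp only: orthonormal_coefficients hinner_scale_left)
      finally show ?thesis .
    qed
    then show "diagonal_matrix (conj_transpose (W L) ** A L ** W L)"
      unfolding diagonal_matrix_def x(2) W[OF x(1)] y_def[symmetric] by (simp add: orthonormal[OF y])
  qed
qed

end
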